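(* Consider the model $$X_0(x)=x,\qquad X_{k+1}(x)=f(X_k(x))+\sigma(X_k(x))W_{k+1},\quad k\ge 0,$$ where $f:\mathbb{R}^d\to\mathbb{R}^d$, $\sigma:\mathbb{R}^d\to\mathcal{M}_{d\times m}$, and $(W_k)$ is a sequence of i.i.d. random variables with values in $\mathbb{R}^m$ such that $\mathbb{E}W_1=0$. Let $C,K>0$ and assume that: (i) the law $\mathbb{P}_W:=\mathbb{P}(W_1\in\cdot)$ satisfies $T_2(C)$ on $\mathbb{R}^m$ with respect to the Euclidean metric; (ii) $|\sigma(x)w|\le K|w|$ for all $(x,w)\in\mathbb{R}^d\times\mathbb{R}^m$; (iii) for some $r\in[0,1)$, $$\sqrt{|f(x)-f(\tilde x)|^2+\mathbb{E}|(\sigma(x)-\sigma(\tilde x))W_1|^2}\le r|x-\tilde x|\qquad\forall x,\tilde x\in\mathbb{R}^d.$$ Let $\mathbb{P}_x^n$ be the law of $(X_k(x))_{1\le k\le n}$ on $(\mathbb{R}^d)^n$. Then $\mathbb{P}_x^n\in T_2\big(CK^2/(1-r)^2\big)$, and for any measurable function $F(x_1,\dots,x_n)\in L^1((\mathbb{R}^d)^n,\mathbb{P}_x^n)$, $$\mathbb{E}\exp\big(\rho\,QF(X_1(x),\dots,X_n(x))\big)\le\exp\big(\rho\,\mathbb{E}F(X_1(x),\dots,X_n(x))\big),$$ where $$\rho:=\frac{(1-r)^2}{CK^2},\qquad QF(x_1,\dots,x_n):=\inf_{y\in(\mathbb{R}^d)^n}\left(F(x+y)+\tfrac12\sum_{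k=1}^n|y_k|^2\right).$$
   Context: $\mathcal{M}_{d\times m}$ is the space of real $d\times m$ matrices; $f$ and $\sigma$ are measurable; $|\cdot|$ is the Euclidean norm. For a metric $\rho_0$ on $S$ and probability measures $\mu,\nu$ on $S$, $W_2^{\rho_0}(\mu,\nu)=\inf_\pi\left(\iint\rho_0(x,y)^2\,d\pi\right)^{1/2}$ over couplings $\pi$ of $(\mu,\nu)$; $H(\nu/\mu)=\int\log\frac{d\nu}{d\mu}\,d\nu$ if $\nu\ll\mu$, $+\infty$ otherwise. $\mu\in T_2(C)$ on $(S,\rho_0)$ means $W_2^{\rho_0}(\mu,\nu)\le\sqrt{2C\,H(\nu/\mu)}$ for every probability measure $\nu$ on $S$. On $(\mathbb{R}^d)^n$ the metric used is $d_{l_2}(x,y)=\left(\sum_{i=1}^n|x_i-y_i|^2\right)^{1/2}$. *)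

theory Defs
  imports "HOL-Probability.Probability"
begin

section \<open>Wasserstein distance, relative entropy and the inequality \<open>T\<^sub>2\<close>\<close>

definition ennreal_sqrt :: "ennreal \<Rightarrow> ennreal" where
  "ennreal_sqrt a = (if a = \<top> then \<top> else ennreal (sqrt (enn2real a)))"

definition couplings :: "'a measure \<Rightarrow> 'a measure \<Rightarrow> ('a \<times> 'a) measure set" where
  "couplings \<mu> \<nu> = {\<pi>. prob_space \<pi> \<and> sets \<pi> = sets (\<mu> \<Otimes>\<^sub>M \<nu>) \<and>
     distr \<pi> \<mu> fst = \<mu> \<and> distr \<pi> \<nu> snd = \<nu>}"

definition W2 :: "('a \<Rightarrow> 'a \<Rightarrow> real) \<Rightarrow> 'a measure \<Rightarrow> 'a measure \<Rightarrow> ennreal" where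
  "W2 d \<mu> \<nu> = (INF \<pi>\<in>couplings \<mu> \<nu>.
     ennreal_sqrt (\<integral>\<^sup>+p. ennreal ((d (fst p) (snd p))\<^sup>2) \<partial>\<pi>))"

text \<open>
  \<^term>\<open>KL_divergence (exp 1) \<mu> \<nu>\<close> is the Bochner integral of \<open>log (d\<nu>/d\<mu>)\<close> under \<open>\<nu>\<close>,
  hence \<open>0\<close> when that function is not integrable. Since \<open>t log t \<ge> -1/e\<close>, the negative part of
  \<open>log (d\<nu>/d\<mu>)\<close> is always \<open>\<nu>\<close>-integrable (\<open>\<mu>\<close>, \<open>\<nu>\<close> probability measures), so
  non-integrability means exactly that the integral is \<open>+\<infinity>\<close>. In the integrable case the value
  is nonnegative, and the coercion to \<^typ>\<open>ennreal\<close> does not truncate it.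
\<close>
definition rel_entropy :: "'a measure \<Rightarrow> 'a measure \<Rightarrow> ennreal" where
  "rel_entropy \<nu> \<mu> =
     (if absolutely_continuous \<mu> \<nu> \<and> integrable \<nu> (entropy_density (exp 1) \<mu> \<nu>)
      then ennreal (KL_divergence (exp 1) \<mu> \<nu>) else \<infinity>)"

definition T2 :: "real \<Rightarrow> ('a \<Rightarrow> 'a \<Rightarrow> real) \<Rightarrow> 'a measure \<Rightarrow> bool" where
  "T2 C d \<mu> \<longleftrightarrow> (\<forall>\<nu>. prob_space \<nu> \<and> sets \<nu> = sets \<mu> \<longrightarrow>
     W2 d \<mu> \<nu> \<le> ennreal_sqrt (ennreal (2 * C) * rel_entropy \<nu> \<mu>))"

section \<open>The Markov chain and its path space\<close>

text \<open>
  \<open>(\<real>\<^sup>d)\<^sup>n\<close> is represented by the extensional functions on \<open>{1..n}\<close>, with the product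
  \<open>\<sigma>\<close>-algebra, which is its Borel \<open>\<sigma>\<close>-algebra.
\<close>
definition path_space :: "nat \<Rightarrow> (nat \<Rightarrow> real^'d) measure" where
  "path_space n = PiM {1..n} (\<lambda>_. borel)"

definition d_l2 :: "nat \<Rightarrow> (nat \<Rightarrow> real^'d) \<Rightarrow> (nat \<Rightarrow> real^'d) \<Rightarrow> real" where
  "d_l2 n x y = sqrt (\<Sum>i=1..n. (norm (x i - y i))\<^sup>2)"

primrec chain :: "(real^'d \<Rightarrow> real^'d) \<Rightarrow> (real^'d \<Rightarrow> real^'m^'d) \<Rightarrow> (nat \<Rightarrow> 'w \<Rightarrow> real^'m)
    \<Rightarrow> real^'d \<Rightarrow> nat \<Rightarrow> 'w \<Rightarrow> real^'d" where
  "chain f \<sigma> W x 0 \<omega> = x"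
| "chain f \<sigma> W x (Suc k) \<omega> =
     f (chain f \<sigma> W x k \<omega>) + \<sigma> (chain f \<sigma> W x k \<omega>) *v W (Suc k) \<omega>"

definition chain_path :: "(real^'d \<Rightarrow> real^'d) \<Rightarrow> (real^'d \<Rightarrow> real^'m^'d) \<Rightarrow> (nat \<Rightarrow> 'w \<Rightarrow> real^'m)
    \<Rightarrow> real^'d \<Rightarrow> nat \<Rightarrow> 'w \<Rightarrow> (nat \<Rightarrow> real^'d)" where
  "chain_path f \<sigma> W x n \<omega> = (\<lambda>k\<in>{1..n}. chain f \<sigma> W x k \<omega>)"

definition path_law :: "'w measure \<Rightarrow> (real^'d \<Rightarrow> real^'d) \<Rightarrow> (real^'d \<Rightarrow> real^'m^'d)
    \<Rightarrow> (nat \<Rightarrow> 'w \<Rightarrow> real^'m) \<Rightarrow> real^'d \<Rightarrow> nat \<Rightarrow> (nat \<Rightarrow> real^'d) measure" where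
  "path_law M f \<sigma> W x n = distr M (path_space n) (chain_path f \<sigma> W x n)"

section \<open>The inf-convolution\<close>

text \<open>The infimum is taken in the extended reals: it may be \<open>-\<infinity>\<close>.\<close>
definition Q_op :: "nat \<Rightarrow> ((nat \<Rightarrow> real^'d) \<Rightarrow> real) \<Rightarrow> (nat \<Rightarrow> real^'d) \<Rightarrow> ereal" where
  "Q_op n F x = (INF y\<in>space (path_space n).
     ereal (F (\<lambda>k\<in>{1..n}. x k + y k) + 1/2 * (\<Sum>k=1..n. (norm (y k))\<^sup>2)))"

fun ereal_exp :: "ereal \<Rightarrow> ennreal" where
  "ereal_exp (ereal r) = ennreal (exp r)"
| "ereal_exp PInfty = \<top>"
| "ereal_exp MInfty = 0"

text \<open>
  For Borel \<open>F\<close> the sets \<open>{Q_op n F < a}\<close> are projections of Borel sets, so \<open>Q_op n F\<close> is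
  universally measurable but in general not Borel. Its composition with a random variable is thus
  measurable for the completed probability, which is why the expectation of a function of it is
  taken there.
\<close>
definition nn_expectation :: "'w measure \<Rightarrow> ('w \<Rightarrow> ennreal) \<Rightarrow> ennreal" where
  "nn_expectation M g = (\<integral>\<^sup>+\<omega>. g \<omega> \<partial>completion M)"

end

theory Submission
  imports Defs
begin

text \<open>
  Couple the chain driven by a tilted noise, with density \<open>G\<close> relative to the product law, with the
  chain driven by the original noise. Given the past, \<open>T\<^sub>2\<close> couples the next tilted innovation
  \<open>z\<close> with an untilted \<open>z'\<close> at a cost of \<open>2 C\<close> times the conditional entropy. As \<open>z'\<close> is centred
  and independent of the past, the squared distances \<open>d\<^sub>k\<close> of the chains satisfy
  \<open>E d\<^sub>k\<^sub>+\<^sub>1 \<le> r E d\<^sub>k + K\<^sup>2 E|z - z'|\<^sup>2 / (1 - r)\<close>; summing over \<open>k\<close>, the chain rule for the entropy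
  gives the constant \<open>C K\<^sup>2 / (1 - r)\<^sup>2\<close>.

  No measurable selection of couplings is needed: after rounding the masses of small cells only
  countably many conditional laws remain, and only the cell of \<open>z\<close> influences the law of \<open>z'\<close>, so
  that \<open>z'\<close> has an explicit conditional density.

  For the exponential inequality let \<open>g \<le> exp (\<rho> QF(X))\<close>, tilt the probability space by \<open>g\<close>, and
  integrate \<open>ln g / \<rho> \<le> F(y) + |X - y|\<^sup>2 / 2\<close> against the coupling of \<open>\<omega>\<close> with an untilted path \<open>y\<close>.
  As the coupling lives over the probability space itself, \<open>QF\<close> need not be measurable.
\<close>

text \<open>After one step the difference of the two chains is
  \<open>A + \<sigma>(X) (z - z')\<close>, where \<open>A\<close> is the difference of the images of
  both states under the common noise \<open>z'\<close>. The contraction hypothesis averages over the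
  untilted law, so the common noise must be \<open>z'\<close>, and \<open>z'\<close> must keep the
  law \<open>P\<close> given both pasts; therefore the one-step kernel sees the tilted past and the
  tilted innovation, never the untilted past. Then \<open>E|A|^2 \<le> r^2 d\<close>, and
  \<open>(a + b)^2 \<le> a^2 / r + b^2 / (1 - r)\<close> gives the recursion. These weights divide
  by \<open>r\<close>, so the estimate is made for some \<open>s > 0\<close> with r \<le> s < 1, and
  s decreases to r at the end.

  The mass lost by rounding is coupled independently. Its cost is small only if the second moments
  are finite and have small tails on average over the past. Finite second moments of the noise are
  not assumed; they are extracted from \<open>T2\<close> itself.

  All plans are densities with respect to products of untilted laws, so the recursion over time
  consists of iterated integrals of nonnegative functions.\<close>

text \<open>
  For a probability density \<open>q\<close> the integral of \<open>psi q\<close> is the relative entropy; its integrand is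
  nonnegative, so that no integrability has to be assumed.
\<close>
definition psi :: "real \<Rightarrow> real" where
  "psi t = t * ln t - t + 1"

definition Ent :: "'a measure \<Rightarrow> ('a \<Rightarrow> real) \<Rightarrow> ennreal" where
  "Ent P q = (\<integral>\<^sup>+z. ennreal (psi (q z)) \<partial>P)"

section \<open>Entropy: convexity of \<open>psi\<close>, Jensen's inequality, agreement with
  \<open>rel_entropy\<close>\<close>

lemma measurable_psi [measurable]: "psi \<in> borel_measurable borel"
  unfolding psi_def[abs_def] by measurable

text \<open>\<open>psi\<close> is convex with derivative \<open>ln\<close>, and the left side is its
  tangent at \<open>s\<close>. The inequality is \<open>ln u \<le> u - 1\<close> at
  \<open>u = s / t\<close>.\<close>

lemma psi_tangent:
  assumes "0 \<le> t" "0 < s"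
  shows "t * ln s - s + 1 \<le> psi t"
proof (cases "t = 0")
  case False
  then have "t > 0" using assms by simp
  have "ln (s / t) \<le> s / t - 1"
    using assms \<open>t > 0\<close> by (intro ln_le_minus_one) simp
  then have "t * ln (s / t) \<le> t * (s / t - 1)"
    using \<open>t > 0\<close> by (intro mult_left_mono) auto
  then show ?thesis
    using assms \<open>t > 0\<close> by (simp add: psi_def ln_div algebra_simps)
qed (use assms in \<open>simp add: psi_def\<close>)

lemma psi_nonneg: "0 \<le> t \<Longrightarrow> 0 \<le> psi t"
  using psi_tangent[of t 1] by simp

text \<open>Expanding \<open>ln (c * v)\<close> leaves the term \<open>v * c * ln c\<close>, which
  is at most 0 for c \<le> 1. This bounds the entropy price of rounding a density down by the factor
  \<open>c\<close>.\<close>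

lemma psi_contract:
  assumes "0 \<le> v" "0 \<le> c" "c \<le> 1"
  shows "psi (c * v) \<le> psi v + (1 - c)"
proof (cases "v = 0 \<or> c = 0")
  case True
  then show ?thesis using psi_nonneg[of v] assms by (auto simp: psi_def)
next
  case False
  then have pos: "v > 0" "c > 0" using assms by auto
  have "psi (c * v) = c * psi v + (1 - c) + v * (c * ln c)"
    using pos by (simp add: psi_def ln_mult algebra_simps)
  also have "v * (c * ln c) \<le> 0"
    using pos assms by (intro mult_nonneg_nonpos) auto
  also have "c * psi v \<le> 1 * psi v"
    using psi_nonneg[of v] pos assms by (intro mult_right_mono) auto
  finally show ?thesis by simp
qed

text \<open>The additivity of the logarithm, arranged so that both sides are sums of nonnegative
  terms and can be integrated in \<open>ennreal\<close>. If \<open>t\<close> is a probability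
  density and \<open>s\<close> a constant, the correction terms integrate to the same value on both
  sides, which is the chain rule for the entropy.\<close>

lemma psi_mult:
  assumes "0 \<le> s" "0 \<le> t"
  shows "psi (s * t) + s + t = t * psi s + s * psi t + 1 + s * t"
proof (cases "s = 0 \<or> t = 0")
  case False
  then show ?thesis using assms by (simp add: psi_def ln_mult algebra_simps)
qed (auto simp: psi_def)

text \<open>
  Jensen's inequality for the relative entropy. Separating the positive and negative parts of the
  logarithm keeps all terms nonnegative; the subtracted one is bounded since
  \<open>s * max 0 (- ln s) \<le> 1\<close>.
\<close>

lemma Ent_coarsen:
  fixes g H :: "'a \<Rightarrow> real"
  assumes "prob_space \<mu>"
    and [measurable]: "g \<in> borel_measurable \<mu>" "H \<in> borel_measurable \<mu>"
    and g0: "\<And>x. x \<in> space \<mu> \<Longrightarrow> 0 \<le> g x" and H0: "\<And>x. x \<in> space \<mu> \<Longrightarrow> 0 \<le> H x"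
    and fin: "(\<integral>\<^sup>+x. ennreal (g x) \<partial>\<mu>) < \<infinity>"
    and eq: "\<And>u. u \<in> borel_measurable borel \<Longrightarrow>
      (\<integral>\<^sup>+x. ennreal (g x) * u (H x) \<partial>\<mu>) = (\<integral>\<^sup>+x. ennreal (H x) * u (H x) \<partial>\<mu>)"
  shows "Ent \<mu> H \<le> Ent \<mu> g"
proof -
  interpret prob_space \<mu> by fact
  define lp where "lp s = max 0 (ln s)" for s :: real
  define lm where "lm s = max 0 (- ln s)" for s :: real
  have [measurable]: "lp \<in> borel_measurable borel" "lm \<in> borel_measurable borel"
    unfolding lp_def[abs_def] lm_def[abs_def] by measurable
  have lpm: "0 \<le> lp s" "0 \<le> lm s" "ln s = lp s - lm s" for s
    by (auto simp: lp_def lm_def)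
  have lm_le: "s * lm s \<le> 1" if "0 \<le> s" for s
  proof (cases "s = 0 \<or> ln s \<ge> 0")
    case True then show ?thesis by (auto simp: lm_def max_def)
  next
    case False
    then have "s > 0" using that by auto
    have "ln (1/s) \<le> 1/s - 1" using \<open>s > 0\<close> by (intro ln_le_minus_one) simp
    then have "s * (- ln s) \<le> s * (1/s - 1)"
      using \<open>s > 0\<close> by (intro mult_left_mono) (auto simp: ln_div)
    then show ?thesis using \<open>s > 0\<close> False by (simp add: lm_def max_def algebra_simps)
  qed
  have gH: "(\<integral>\<^sup>+x. ennreal (g x) \<partial>\<mu>) = (\<integral>\<^sup>+x. ennreal (H x) \<partial>\<mu>)"
    using eq[of "\<lambda>_. 1"] by simp
  have "(\<integral>\<^sup>+x. ennreal (g x) * indicator {0} (H x) \<partial>\<mu>) = 0"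
    by (subst eq) (auto intro!: nn_integral_zero' AE_I2 simp: indicator_def)
  then have "AE x in \<mu>. ennreal (g x) * indicator {0} (H x) = 0"
    by (subst (asm) nn_integral_0_iff_AE) auto
  \<comment> \<open>The tangent of \<open>psi\<close> at \<open>H x\<close> exists only for
    \<open>H x > 0\<close>; on the remaining set \<open>g\<close> vanishes almost everywhere and
    \<open>psi 0 = 1\<close> suffices.\<close>
  then have z: "AE x in \<mu>. H x = 0 \<longrightarrow> g x = 0"
    using AE_space[of \<mu>]
  proof eventually_elim
    case (elim x)
    then show ?case using g0[of x] by (auto simp: indicator_def)
  qed
  let ?A = "\<integral>\<^sup>+x. ennreal (H x) * ennreal (lm (H x)) \<partial>\<mu>"
  let ?B = "\<integral>\<^sup>+x. ennreal (H x) * ennreal (lp (H x)) \<partial>\<mu>"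
  let ?I = "\<integral>\<^sup>+x. ennreal (H x) \<partial>\<mu>"
  have "?A \<le> (\<integral>\<^sup>+x. 1 \<partial>\<mu>)"
    using lm_le H0 lpm by (intro nn_integral_mono) (auto simp: ennreal_mult'[symmetric])
  then have A: "?A < \<infinity>" by (simp add: emeasure_space_1 less_top le_less_trans)
  have I: "?I < \<infinity>" using fin gH by simp
  \<comment> \<open>The tangent inequality at \<open>s = H x\<close>, \<open>t = g x\<close> is
    integrated. The hypothesis \<open>eq\<close>, which makes \<open>H\<close> the conditional
    expectation of \<open>g\<close> given \<open>H\<close>, exchanges \<open>g\<close> and
    \<open>H\<close> in front of functions of \<open>H\<close>.\<close>
  have "?B + 1 = (\<integral>\<^sup>+x. ennreal (g x) * ennreal (lp (H x)) + 1 \<partial>\<mu>)"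
    by (subst nn_integral_add) (auto simp: emeasure_space_1 eq[of "\<lambda>s. ennreal (lp s)"])
  also have "\<dots> \<le> (\<integral>\<^sup>+x. ennreal (psi (g x)) + ennreal (g x) * ennreal (lm (H x)) + ennreal (H x) \<partial>\<mu>)"
    using z AE_space[of \<mu>]
  proof (intro nn_integral_mono_AE, eventually_elim)
    case (elim x)
    have "g x * lp (H x) + 1 \<le> psi (g x) + g x * lm (H x) + H x"
    proof (cases "H x = 0")
      case True
      then show ?thesis using elim by (simp add: psi_def)
    next
      case False
      then have "H x > 0" using elim H0[of x] by auto
      from psi_tangent[OF _ this, of "g x"] show ?thesis
        using elim g0[of x] by (simp add: lpm(3) algebra_simps)
    qed
    moreover have "0 \<le> g x" "0 \<le> H x" "0 \<le> psi (g x)" using elim g0 H0 psi_nonneg by auto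
    ultimately have "ennreal (g x * lp (H x) + 1) \<le> ennreal (psi (g x) + g x * lm (H x) + H x)"
      by (intro ennreal_leI)
    then show ?case
      using \<open>0 \<le> g x\<close> \<open>0 \<le> H x\<close> \<open>0 \<le> psi (g x)\<close> lpm
      by (simp add: ennreal_mult ennreal_plus flip: ennreal_1)
  qed
  also have "\<dots> = Ent \<mu> g + ?A + ?I"
    by (simp add: nn_integral_add Ent_def eq[of "\<lambda>s. ennreal (lm s)"])
  finally have 1: "?B + 1 \<le> Ent \<mu> g + ?A + ?I" .
  have "Ent \<mu> H + ?A + ?I = (\<integral>\<^sup>+x. ennreal (psi (H x)) + ennreal (H x) * ennreal (lm (H x)) + ennreal (H x) \<partial>\<mu>)"
    by (simp add: nn_integral_add Ent_def)
  also have "\<dots> = (\<integral>\<^sup>+x. ennreal (H x) * ennreal (lp (H x)) + 1 \<partial>\<mu>)"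
  proof (intro nn_integral_cong)
    fix x assume x: "x \<in> space \<mu>"
    have "psi (H x) + H x * lm (H x) + H x = H x * lp (H x) + 1"
      by (simp add: psi_def lpm(3) algebra_simps)
    then show "ennreal (psi (H x)) + ennreal (H x) * ennreal (lm (H x)) + ennreal (H x) =
        ennreal (H x) * ennreal (lp (H x)) + 1"
      using H0[OF x] psi_nonneg[OF H0[OF x]] lpm
      by (simp add: ennreal_mult[symmetric] flip: ennreal_plus ennreal_1)
  qed
  also have "\<dots> = ?B + 1"
    by (subst nn_integral_add) (auto simp: emeasure_space_1)
  finally have "Ent \<mu> H + (?A + ?I) \<le> Ent \<mu> g + (?A + ?I)" using 1 by (simp add: add.assoc)
  moreover have "?A + ?I \<noteq> \<top>" using A I by (simp add: less_top)
  ultimately show ?thesis by (simp add: add.commute[of _ "?A + ?I"] ennreal_add_left_cancel_le)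
qed

lemma nn_integral_real_finite:
  fixes q :: "'a \<Rightarrow> real"
  assumes "q \<in> borel_measurable P" "\<And>z. 0 \<le> q z" "(\<integral>\<^sup>+z. ennreal (q z) \<partial>P) = ennreal c" "0 \<le> c"
  shows "integrable P q" "(\<integral>z. q z \<partial>P) = c"
proof -
  show "integrable P q" using assms by (intro integrableI_nonneg) auto
  show "(\<integral>z. q z \<partial>P) = c" using assms by (simp add: integral_eq_nn_integral)
qed

text \<open>\<open>psi (q z)\<close> and \<open>q z * ln (q z)\<close> differ by
  \<open>q z - 1\<close>, which is integrable with integral 0.\<close>

lemma integrable_psi_iff:
  fixes q :: "'a \<Rightarrow> real"
  assumes "prob_space P" and [measurable]: "q \<in> borel_measurable P" and q0: "\<And>z. 0 \<le> q z"
    and one: "(\<integral>\<^sup>+z. ennreal (q z) \<partial>P) = 1"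
  shows "integrable P (\<lambda>z. q z * ln (q z)) \<longleftrightarrow> Ent P q < \<infinity>"
    and "Ent P q < \<infinity> \<Longrightarrow> Ent P q = ennreal (\<integral>z. q z * ln (q z) \<partial>P)"
proof -
  interpret prob_space P by fact
  have q: "integrable P q" "(\<integral>z. q z \<partial>P) = 1"
    using nn_integral_real_finite[of q P 1] one q0 by auto
  have psi: "integrable P (\<lambda>z. psi (q z)) \<longleftrightarrow> Ent P q < \<infinity>"
    using q0 by (simp add: integrable_iff_bounded Ent_def psi_nonneg)
  have *: "integrable P (\<lambda>z. psi (q z) + q z - 1) \<longleftrightarrow> integrable P (\<lambda>z. psi (q z))"
  proof
    assume "integrable P (\<lambda>z. psi (q z) + q z - 1)"
    from Bochner_Integration.integrable_diff[OF this, of "\<lambda>z. q z - 1"]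
    show "integrable P (\<lambda>z. psi (q z))" using q by simp
  qed (use q in auto)
  then show "integrable P (\<lambda>z. q z * ln (q z)) \<longleftrightarrow> Ent P q < \<infinity>"
    using psi by (simp add: psi_def)
  assume "Ent P q < \<infinity>"
  then have i: "integrable P (\<lambda>z. psi (q z))" using psi by simp
  have "Ent P q = ennreal (\<integral>z. psi (q z) \<partial>P)"
    unfolding Ent_def using i q0 psi_nonneg by (intro nn_integral_eq_integral) auto
  also have "(\<integral>z. psi (q z) \<partial>P) = (\<integral>z. (psi (q z) + q z - 1) - q z + 1 \<partial>P)" by simp
  also have "\<dots> = (\<integral>z. psi (q z) + q z - 1 \<partial>P)" using i q * by (simp add: prob_space)
  finally show "Ent P q = ennreal (\<integral>z. q z * ln (q z) \<partial>P)" by (simp add: psi_def)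
qed

text \<open>\<open>q\<close> is almost everywhere the Radon-Nikodym derivative, and the default
  value of \<open>rel_entropy\<close> for a non-integrable entropy density agrees with
  \<open>Ent P q = \<infinity>\<close>.\<close>

lemma rel_entropy_density:
  fixes q :: "'a \<Rightarrow> real"
  assumes "prob_space P" and [measurable]: "q \<in> borel_measurable P" and q0: "\<And>z. 0 \<le> q z"
    and one: "(\<integral>\<^sup>+z. ennreal (q z) \<partial>P) = 1"
  shows "rel_entropy (density P q) P = Ent P q"
proof -
  interpret prob_space P by fact
  have "density P (RN_deriv P (density P q)) = density P q"
    by (intro density_RN_deriv_density) auto
  then have eq: "AE z in P. RN_deriv P (density P q) z = q z"
    by (intro density_unique) auto
  have [measurable]: "entropy_density (exp 1) P (density P q) \<in> borel_measurable P"
    by (auto simp: comp_def entropy_density_def)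
  have "integrable (density P q) (entropy_density (exp 1) P (density P q)) \<longleftrightarrow>
    integrable P (\<lambda>z. q z * entropy_density (exp 1) P (density P q) z)"
    using q0 by (subst integrable_density) auto
  also have "\<dots> \<longleftrightarrow> integrable P (\<lambda>z. q z * ln (q z))"
    using eq q0 by (intro integrable_cong_AE) (auto simp: entropy_density_def log_def)
  finally have 1: "integrable (density P q) (entropy_density (exp 1) P (density P q)) \<longleftrightarrow> Ent P q < \<infinity>"
    using integrable_psi_iff(1)[OF assms] by simp
  have 2: "absolutely_continuous P (density P q)"
    by (intro absolutely_continuousI_density) auto
  have 3: "KL_divergence (exp 1) P (density P q) = (\<integral>z. q z * ln (q z) \<partial>P)"
    using q0 by (subst KL_density) (auto simp: log_def)
  show ?thesis
    unfolding rel_entropy_def using 1 2 3 integrable_psi_iff(2)[OF assms]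
    by (auto simp: not_less top_unique)
qed

subsection \<open>Couplings provided by \<open>T\<^sub>2\<close> and second moments\<close>

abbreviation sqdist :: "'b::metric_space \<Rightarrow> 'b \<Rightarrow> ennreal" where
  "sqdist x y \<equiv> ennreal ((dist x y)\<^sup>2)"

abbreviation sqnorm :: "'b::real_normed_vector \<Rightarrow> ennreal" where
  "sqnorm x \<equiv> ennreal ((norm x)\<^sup>2)"

lemma ennreal_sqrt_less_iff:
  assumes "ennreal_sqrt a < ennreal (sqrt c)" "0 \<le> c"
  shows "a \<le> ennreal c"
  using assms by (cases a) (auto simp: ennreal_sqrt_def ennreal_less_iff intro!: ennreal_leI)

text \<open>The infimum in \<open>W2\<close> is only approached. The slack \<epsilon> is added under
  the square root, so that it becomes an additive error of the squared cost; finiteness of the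
  entropy makes the comparison strict.\<close>

lemma T2_couplingE:
  fixes P :: "'b::euclidean_space measure"
  assumes T2: "T2 C dist P" and P: "prob_space P" "sets P = sets borel"
    and q: "q \<in> borel_measurable P" "\<And>z. 0 \<le> q z" "(\<integral>\<^sup>+z. ennreal (q z) \<partial>P) = 1"
    and Ent: "Ent P q < \<infinity>" and "0 < \<epsilon>" "0 \<le> C"
  obtains \<pi> where "prob_space \<pi>" "sets \<pi> = sets (borel \<Otimes>\<^sub>M borel)"
    "distr \<pi> borel fst = P" "distr \<pi> borel snd = density P q"
    "(\<integral>\<^sup>+p. sqdist (fst p) (snd p) \<partial>\<pi>) \<le> ennreal (2 * C) * Ent P q + ennreal \<epsilon>"
proof -
  interpret prob_space P by fact
  let ?\<nu> = "density P q"
  have \<nu>: "prob_space ?\<nu>" "sets ?\<nu> = sets P"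
    using q by (auto intro!: prob_spaceI simp: emeasure_density)
  obtain b where b: "ennreal (2 * C) * Ent P q = ennreal b" "0 \<le> b"
    using Ent by (cases "Ent P q") (auto simp: \<open>0 \<le> C\<close> simp flip: ennreal_mult)
  have "W2 dist P ?\<nu> \<le> ennreal_sqrt (ennreal (2 * C) * rel_entropy ?\<nu> P)"
    using T2 \<nu> by (simp add: T2_def)
  also have "rel_entropy ?\<nu> P = Ent P q"
    using q P by (intro rel_entropy_density) auto
  also have "ennreal_sqrt (ennreal (2 * C) * Ent P q) < ennreal (sqrt (b + \<epsilon>))"
    using b \<open>0 < \<epsilon>\<close> by (simp add: ennreal_sqrt_def ennreal_less_iff)
  finally obtain \<pi> where \<pi>: "\<pi> \<in> couplings P ?\<nu>"
    "ennreal_sqrt (\<integral>\<^sup>+p. sqdist (fst p) (snd p) \<partial>\<pi>) < ennreal (sqrt (b + \<epsilon>))"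
    unfolding W2_def INF_less_iff by auto
  have c: "prob_space \<pi>" "sets \<pi> = sets (P \<Otimes>\<^sub>M ?\<nu>)" "distr \<pi> P fst = P" "distr \<pi> ?\<nu> snd = ?\<nu>"
    using \<pi>(1) unfolding couplings_def by blast+
  show ?thesis
  proof (rule that[of \<pi>])
    have "sets (P \<Otimes>\<^sub>M ?\<nu>) = sets (borel \<Otimes>\<^sub>M borel)"
      by (intro sets_pair_measure_cong) (simp_all add: P(2))
    then show "sets \<pi> = sets (borel \<Otimes>\<^sub>M borel)" using c(2) by simp
    have "distr \<pi> borel fst = distr \<pi> P fst"
      by (intro distr_cong refl) (simp add: P(2))
    then show "distr \<pi> borel fst = P" using c(3) by (rule trans)
    have "distr \<pi> borel snd = distr \<pi> ?\<nu> snd"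
      by (intro distr_cong refl) (simp add: P(2))
    then show "distr \<pi> borel snd = density P q" using c(4) by (rule trans)
    show "(\<integral>\<^sup>+p. sqdist (fst p) (snd p) \<partial>\<pi>) \<le> ennreal (2 * C) * Ent P q + ennreal \<epsilon>"
      using ennreal_sqrt_less_iff[OF \<pi>(2)] b \<open>0 < \<epsilon>\<close> by simp
  qed fact
qed

lemma norm_diff_sq_le: "(dist x y)\<^sup>2 \<le> 2 * (norm x)\<^sup>2 + 2 * (norm y)\<^sup>2" for x y :: "'b::real_normed_vector"
proof -
  have "(dist x y)\<^sup>2 \<le> (norm x + norm y)\<^sup>2"
    using norm_triangle_ineq4[of x y] by (intro power_mono) (auto simp: dist_norm)
  also have "\<dots> \<le> 2 * (norm x)\<^sup>2 + 2 * (norm y)\<^sup>2"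
    using zero_le_power2[of "norm x - norm y"] by (simp add: power2_sum power2_diff)
  finally show ?thesis .
qed

lemma second_moment_coupling:
  fixes \<pi> :: "('b::euclidean_space \<times> 'b) measure"
  assumes [measurable_cong]: "sets \<pi> = sets (borel \<Otimes>\<^sub>M borel)"
    and cost: "(\<integral>\<^sup>+p. sqdist (fst p) (snd p) \<partial>\<pi>) < \<infinity>"
  shows "(\<integral>\<^sup>+z. sqnorm z \<partial>distr \<pi> borel fst) < \<infinity> \<longleftrightarrow>
         (\<integral>\<^sup>+z. sqnorm z \<partial>distr \<pi> borel snd) < \<infinity>"
proof -
  \<comment> \<open>The points \<open>x - y\<close> and \<open>- y\<close> have distance
    \<open>norm x\<close>.\<close>
  have *: "(norm x)\<^sup>2 \<le> 2 * (dist x y)\<^sup>2 + 2 * (norm y)\<^sup>2" for x y :: 'b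
    using norm_diff_sq_le[of "x - y" "- y"] by (simp add: dist_norm)
  have 1: "(\<integral>\<^sup>+p. sqnorm (f p) \<partial>\<pi>) \<le>
      2 * (\<integral>\<^sup>+p. sqdist (fst p) (snd p) \<partial>\<pi>) + 2 * (\<integral>\<^sup>+p. sqnorm (g p) \<partial>\<pi>)"
    if [measurable]: "f \<in> borel_measurable \<pi>" "g \<in> borel_measurable \<pi>"
      and fg: "\<And>p. dist (f p) (g p) = dist (fst p) (snd p)" for f g :: "'b \<times> 'b \<Rightarrow> 'b"
  proof -
    have "(\<integral>\<^sup>+p. sqnorm (f p) \<partial>\<pi>) \<le>
       (\<integral>\<^sup>+p. 2 * sqdist (fst p) (snd p) + 2 * sqnorm (g p) \<partial>\<pi>)"
    proof (intro nn_integral_mono)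
      fix p
      have "sqnorm (f p) \<le> ennreal (2 * (dist (f p) (g p))\<^sup>2 + 2 * (norm (g p))\<^sup>2)"
        by (intro ennreal_leI *)
      then show "sqnorm (f p) \<le> 2 * sqdist (fst p) (snd p) + 2 * sqnorm (g p)"
        by (simp add: fg ennreal_mult)
    qed
    then show ?thesis by (simp add: nn_integral_add nn_integral_cmult)
  qed
  have "(\<integral>\<^sup>+p. sqnorm (fst p) \<partial>\<pi>) < \<infinity> \<longleftrightarrow> (\<integral>\<^sup>+p. sqnorm (snd p) \<partial>\<pi>) < \<infinity>"
    using 1[of fst snd] 1[of snd fst] cost
    by (auto simp: dist_commute ennreal_mult_less_top elim!: le_less_trans)
  then show ?thesis by (simp add: nn_integral_distr)
qed


text \<open>A coupling of finite cost carries a finite second moment from either marginal to the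
  other. Both directions are needed: from a truncation of \<open>P\<close> to \<open>P\<close>, and
  from \<open>P\<close> to averaged conditional laws.\<close>

lemma T2_second_moment_iff:
  fixes P :: "'b::euclidean_space measure"
  assumes T2: "T2 C dist P" and P: "prob_space P" "sets P = sets borel" and "0 \<le> C"
    and q: "q \<in> borel_measurable P" "\<And>z. 0 \<le> q z" "(\<integral>\<^sup>+z. ennreal (q z) \<partial>P) = 1"
    and E: "Ent P q < \<infinity>"
  shows "(\<integral>\<^sup>+z. sqnorm z \<partial>P) < \<infinity> \<longleftrightarrow> (\<integral>\<^sup>+z. ennreal (q z) * sqnorm z \<partial>P) < \<infinity>"
proof -
  obtain \<pi> where \<pi>: "prob_space \<pi>" "sets \<pi> = sets (borel \<Otimes>\<^sub>M borel)"
    "distr \<pi> borel fst = P" "distr \<pi> borel snd = density P q"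
    "(\<integral>\<^sup>+p. sqdist (fst p) (snd p) \<partial>\<pi>) \<le> ennreal (2 * C) * Ent P q + ennreal 1"
    using T2_couplingE[OF T2 P q E, of 1] \<open>0 \<le> C\<close> by auto
  have "(\<integral>\<^sup>+p. sqdist (fst p) (snd p) \<partial>\<pi>) < \<infinity>"
    using le_less_trans[OF \<pi>(5)] E by (auto simp: ennreal_mult_less_top)
  from second_moment_coupling[OF \<pi>(2) this]
  have "(\<integral>\<^sup>+z. sqnorm z \<partial>P) < \<infinity> \<longleftrightarrow> (\<integral>\<^sup>+z. sqnorm z \<partial>density P q) < \<infinity>"
    unfolding \<pi>(3,4) .
  also have "(\<integral>\<^sup>+z. sqnorm z \<partial>density P q) = (\<integral>\<^sup>+z. ennreal (q z) * sqnorm z \<partial>P)"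
    using q(1) by (intro nn_integral_density) (simp_all add: measurable_cong_sets[OF P(2) refl])
  finally show ?thesis .
qed

text \<open>\<open>P\<close> conditioned on a ball of positive mass has bounded support and finite
  entropy relative to \<open>P\<close>; the transport inequality hands its second moment back to
  \<open>P\<close>.\<close>

lemma T2_second_moment:
  fixes P :: "'b::euclidean_space measure"
  assumes T2: "T2 C dist P" and P: "prob_space P" "sets P = sets borel" and "0 \<le> C"
  shows "(\<integral>\<^sup>+z. sqnorm z \<partial>P) < \<infinity>"
proof -
  interpret prob_space P by fact
  note P(2)[measurable_cong]
  have sp: "space P = UNIV" using sets_eq_imp_space_eq[OF P(2)] by simp
  have "(\<lambda>n. prob (cball 0 (real n))) \<longlonglongrightarrow> prob (\<Union>n. cball 0 (real n))"
    by (intro finite_Lim_measure_incseq) (auto simp: P(2) incseq_def)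
  also have "(\<Union>n. cball 0 (real n)) = space P"
    by (auto simp: sp real_arch_simple)
  finally have "(\<lambda>n. prob (cball 0 (real n))) \<longlonglongrightarrow> 1" by (simp add: prob_space)
  then have "eventually (\<lambda>n. prob (cball 0 (real n)) > 0) sequentially"
    by (rule order_tendstoD) simp
  then obtain n where n: "prob (cball 0 (real n)) > 0" by (auto simp: eventually_sequentially)
  define c where "c = prob (cball 0 (real n))"
  define q :: "'b \<Rightarrow> real" where "q z = indicator (cball 0 (real n)) z / c" for z
  have c: "0 < c" using n by (simp add: c_def)
  have [measurable]: "q \<in> borel_measurable P"
    unfolding q_def[abs_def]
    by (intro borel_measurable_divide borel_measurable_indicator borel_measurable_const) (simp add: P(2))
  have q0: "0 \<le> q z" for z using c by (simp add: q_def)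
  have "(\<integral>\<^sup>+z. ennreal (q z) \<partial>P) = (\<integral>\<^sup>+z. ennreal (1 / c) * indicator (cball 0 (real n)) z \<partial>P)"
    by (intro nn_integral_cong) (auto simp: q_def indicator_def)
  also have "\<dots> = ennreal (1 / c) * ennreal c"
    using P(2) by (simp add: nn_integral_cmult_indicator c_def emeasure_eq_measure)
  also have "\<dots> = 1" using c by (simp flip: ennreal_mult)
  finally have q1: "(\<integral>\<^sup>+z. ennreal (q z) \<partial>P) = 1" .
  \<comment> \<open>\<open>q\<close> takes only the values 0 and \<open>1 / c\<close>, and
    \<open>psi 0 = 1\<close>.\<close>
  have "Ent P q \<le> (\<integral>\<^sup>+z. ennreal (psi (1 / c) + 1) \<partial>P)"
    unfolding Ent_def using psi_nonneg[of "1 / c"] c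
    by (intro nn_integral_mono) (auto simp: q_def indicator_def psi_def intro!: ennreal_leI)
  then have E: "Ent P q < \<infinity>" by (simp add: emeasure_space_1 less_top le_less_trans)
  have "(\<integral>\<^sup>+z. ennreal (q z) * sqnorm z \<partial>P) \<le> (\<integral>\<^sup>+z. ennreal ((real n)\<^sup>2 / c) \<partial>P)"
  proof (intro nn_integral_mono)
    fix z :: 'b
    have "q z * (norm z)\<^sup>2 \<le> (real n)\<^sup>2 / c"
      using c by (auto simp: q_def indicator_def intro!: divide_right_mono power_mono)
    then have "ennreal (q z * (norm z)\<^sup>2) \<le> ennreal ((real n)\<^sup>2 / c)" by (rule ennreal_leI)
    then show "ennreal (q z) * sqnorm z \<le> ennreal ((real n)\<^sup>2 / c)"
      using q0 by (simp add: ennreal_mult)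
  qed
  then have "(\<integral>\<^sup>+z. ennreal (q z) * sqnorm z \<partial>P) < \<infinity>"
    by (simp add: emeasure_space_1 less_top le_less_trans)
  then show ?thesis
    using T2_second_moment_iff[OF T2 P \<open>0 \<le> C\<close> _ q0 q1 E] by simp
qed

subsection \<open>Transport through small cells\<close>

lemma suminf_single_ennreal:
  fixes f :: "nat \<Rightarrow> ennreal"
  shows "(\<Sum>i. f i * indicator {i} k) = f k"
proof -
  have "(\<Sum>i. f i * indicator {i} k) = (\<Sum>i\<in>{k}. f i * indicator {i} k)"
    by (intro suminf_finite) auto
  then show ?thesis by simp
qed

lemma measurable_cell_indicator [measurable (raw)]:
  fixes idx :: "'b \<Rightarrow> nat"
  assumes "idx \<in> measurable M (count_space UNIV)"
  shows "(\<lambda>z. indicator {i} (idx z) :: ennreal) \<in> borel_measurable M"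
  by (rule measurable_compose[OF assms]) simp

lemma nn_integral_cells:
  fixes idx :: "'b \<Rightarrow> nat"
  assumes [measurable]: "idx \<in> measurable P (count_space UNIV)" "f \<in> borel_measurable P"
  shows "(\<integral>\<^sup>+z. f z \<partial>P) = (\<Sum>i. \<integral>\<^sup>+z. f z * indicator {i} (idx z) \<partial>P)"
proof -
  have "(\<integral>\<^sup>+z. f z \<partial>P) = (\<integral>\<^sup>+z. (\<Sum>i. f z * indicator {i} (idx z)) \<partial>P)"
    by (simp only: suminf_single_ennreal)
  also have "\<dots> = (\<Sum>i. \<integral>\<^sup>+z. f z * indicator {i} (idx z) \<partial>P)"
    by (intro nn_integral_suminf) measurable
  finally show ?thesis .
qed

lemma nn_integral_cells_weight:
  fixes idx :: "'b \<Rightarrow> nat"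
  assumes [measurable]: "idx \<in> measurable P (count_space UNIV)" "f \<in> borel_measurable P"
  shows "(\<integral>\<^sup>+z. f z * v (idx z) \<partial>P) = (\<Sum>i. v i * (\<integral>\<^sup>+z. f z * indicator {i} (idx z) \<partial>P))"
proof -
  have "(\<integral>\<^sup>+z. f z * v (idx z) * indicator {i} (idx z) \<partial>P) = v i * (\<integral>\<^sup>+z. f z * indicator {i} (idx z) \<partial>P)" for i
  proof -
    have "(\<integral>\<^sup>+z. f z * v (idx z) * indicator {i} (idx z) \<partial>P) = (\<integral>\<^sup>+z. v i * (f z * indicator {i} (idx z)) \<partial>P)"
      by (intro nn_integral_cong) (auto simp: indicator_def mult.commute)
    then show ?thesis by (simp add: nn_integral_cmult)
  qed
  then show ?thesis by (subst nn_integral_cells[of idx]) auto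
qed

lemma nn_integral_null_cell:
  assumes [measurable]: "idx \<in> measurable P (count_space UNIV)"
    and "(\<integral>\<^sup>+z. indicator {i :: nat} (idx z) \<partial>P) = 0"
  shows "(\<integral>\<^sup>+z. ennreal (p z) * indicator {i} (idx z) \<partial>P) = 0"
proof -
  have "AE z in P. (indicator {i} (idx z) :: ennreal) = 0"
    using assms(2) by (subst (asm) nn_integral_0_iff_AE) auto
  then have "(\<integral>\<^sup>+z. ennreal (p z) * indicator {i} (idx z) \<partial>P) = (\<integral>\<^sup>+z. 0 \<partial>P)"
    by (intro nn_integral_cong_AE) (auto elim!: eventually_mono)
  then show ?thesis by simp
qed

text \<open>A point is labelled by the first member of an enumerated countable dense set that is
  \<delta>-close to it; two points with the same label are both \<delta>-close to one
  member.\<close>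

lemma small_cells_exist:
  fixes \<delta> :: real
  assumes "0 < \<delta>"
  obtains idx :: "'b::euclidean_space \<Rightarrow> nat"
  where "idx \<in> measurable borel (count_space UNIV)"
    and "\<And>y z. idx y = idx z \<Longrightarrow> dist y z \<le> 2 * \<delta>"
proof -
  obtain D :: "'b set" where D: "countable D" "\<And>X. open X \<Longrightarrow> X \<noteq> {} \<Longrightarrow> \<exists>d\<in>D. d \<in> X"
    using countable_dense_setE by blast
  define idx where "idx y = (LEAST i. dist y (from_nat_into D i) < \<delta>)" for y
  have ex: "dist y (from_nat_into D (idx y)) < \<delta>" for y
  proof -
    obtain d where d: "d \<in> D" "d \<in> ball y \<delta>" using D(2)[of "ball y \<delta>"] assms by auto
    obtain i where "from_nat_into D i = d"
      using from_nat_into_surj[OF D(1) d(1)] by auto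
    then have "\<exists>i. dist y (from_nat_into D i) < \<delta>" using d by auto
    then show ?thesis unfolding idx_def by (rule LeastI_ex)
  qed
  have "idx \<in> measurable borel (count_space UNIV)"
    unfolding idx_def[abs_def] by measurable
  moreover have "dist y z \<le> 2 * \<delta>" if "idx y = idx z" for y z
    using ex[of y] ex[of z] dist_triangle2[of y z "from_nat_into D (idx y)"] that by simp
  ultimately show ?thesis using that by blast
qed

text \<open>Rounding to integer powers of \<open>exp \<eta>\<close> has countably many values and a
  relative error that is uniform down to 0, so that every mass keeps at least the fraction
  \<open>exp (- \<eta>)\<close>.\<close>

definition round_down :: "real \<Rightarrow> real \<Rightarrow> real" where
  "round_down \<eta> u = (if u > 0 then exp (\<eta> * of_int \<lfloor>ln u / \<eta>\<rfloor>) else 0)"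

lemma round_down:
  assumes "0 < \<eta>" "0 \<le> u"
  shows "0 \<le> round_down \<eta> u" "round_down \<eta> u \<le> u" "exp (- \<eta>) * u \<le> round_down \<eta> u"
proof -
  show "0 \<le> round_down \<eta> u" by (simp add: round_down_def)
  show "round_down \<eta> u \<le> u"
  proof (cases "u > 0")
    case True
    have "\<eta> * of_int \<lfloor>ln u / \<eta>\<rfloor> \<le> \<eta> * (ln u / \<eta>)"
      using assms by (intro mult_left_mono) auto
    then have "exp (\<eta> * of_int \<lfloor>ln u / \<eta>\<rfloor>) \<le> exp (ln u)" using assms by simp
    then show ?thesis using True by (simp add: round_down_def)
  qed (use assms in \<open>simp add: round_down_def\<close>)
  show "exp (- \<eta>) * u \<le> round_down \<eta> u"
  proof (cases "u > 0")
    case True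
    have "\<eta> * (ln u / \<eta>) \<le> \<eta> * (of_int \<lfloor>ln u / \<eta>\<rfloor> + 1)"
      using assms by (intro mult_left_mono) linarith+
    then have "exp (- \<eta> + ln u) \<le> exp (\<eta> * of_int \<lfloor>ln u / \<eta>\<rfloor>)"
      using assms by (simp add: algebra_simps)
    then show ?thesis using True by (simp only: round_down_def exp_add) simp
  qed (use assms in \<open>simp add: round_down_def\<close>)
qed

text \<open>Young's inequality, from \<open>(\<eta> a - b)^2 / \<eta> \<ge> 0\<close>. The weight
  close to 1 is meant for the transport cost, the large one for the diameter of the cells.\<close>

lemma sq_sum_le:
  fixes a b \<eta> :: real
  assumes "0 < \<eta>"
  shows "(a + b)\<^sup>2 \<le> (1 + \<eta>) * a\<^sup>2 + (1 + 1 / \<eta>) * b\<^sup>2"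
proof -
  have "0 \<le> (\<eta> * a - b)\<^sup>2 / \<eta>" using assms by simp
  also have "\<dots> = (1 + \<eta>) * a\<^sup>2 + (1 + 1 / \<eta>) * b\<^sup>2 - (a + b)\<^sup>2"
    using assms by (simp add: power2_eq_square field_simps)
  finally show ?thesis by simp
qed

text \<open>
  A near-optimal coupling of \<open>P\<close> and \<open>q P\<close> is only used through the measures
  \<open>\<pi> (_ \<times> B\<^sub>i)\<close> for the cells \<open>B\<^sub>i\<close>; these have densities \<open>R i\<close> with respect to \<open>P\<close>, so that no
  disintegration is needed.
\<close>

lemma T2_cell_densities:
  fixes P :: "'b::euclidean_space measure" and idx :: "'b \<Rightarrow> nat"
  assumes T2: "T2 C dist P" and P: "prob_space P" "sets P = sets borel" and "0 \<le> C"
    and idx: "idx \<in> measurable borel (count_space UNIV)"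
    and small: "\<And>y z. idx y = idx z \<Longrightarrow> dist y z \<le> \<delta>"
    and q: "q \<in> borel_measurable P" "\<And>z. 0 \<le> q z" "(\<integral>\<^sup>+z. ennreal (q z) \<partial>P) = 1"
    and E: "Ent P q < \<infinity>" and "0 < \<eta>"
  obtains R :: "nat \<Rightarrow> 'b \<Rightarrow> ennreal" and c :: "nat \<Rightarrow> ennreal"
  where "\<And>i. R i \<in> borel_measurable borel"
    and "\<And>u. u \<in> borel_measurable borel \<Longrightarrow> (\<Sum>i. \<integral>\<^sup>+w. R i w * u w \<partial>P) = (\<integral>\<^sup>+w. u w \<partial>P)"
    and "\<And>i. (\<integral>\<^sup>+w. R i w \<partial>P) = (\<integral>\<^sup>+z. ennreal (q z) * indicator {i} (idx z) \<partial>P)"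
    and "(\<Sum>i. c i) \<le> ennreal (2 * C) * Ent P q + ennreal \<eta>"
    and "\<And>z. (\<integral>\<^sup>+w. R (idx z) w * sqdist z w \<partial>P) \<le>
      ennreal (1 + \<eta>) * c (idx z) +
      ennreal ((1 + 1 / \<eta>) * \<delta>\<^sup>2) * (\<integral>\<^sup>+y. ennreal (q y) * indicator {idx z} (idx y) \<partial>P)"
proof -
  interpret prob_space P by fact
  obtain \<pi> where \<pi>: "prob_space \<pi>" "sets \<pi> = sets (borel \<Otimes>\<^sub>M borel)"
    "distr \<pi> borel fst = P" "distr \<pi> borel snd = density P q"
    "(\<integral>\<^sup>+p. sqdist (fst p) (snd p) \<partial>\<pi>) \<le> ennreal (2 * C) * Ent P q + ennreal \<eta>"
    using T2_couplingE[OF T2 P q E \<open>0 < \<eta>\<close> \<open>0 \<le> C\<close>] by auto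
  note \<pi>(2)[measurable_cong] P(2)[measurable_cong]
  note [measurable] = idx q(1)
  define I where "I i p = (indicator {i} (idx (snd p)) :: ennreal)" for i and p :: "'b \<times> 'b"
  have [measurable]: "I i \<in> borel_measurable \<pi>" for i
    unfolding I_def[abs_def] by measurable
  \<comment> \<open>The first marginal of \<pi> restricted to the pairs whose second point lies in
    cell \<open>i\<close>.\<close>
  define \<tau> where "\<tau> i = distr (density \<pi> (I i)) borel fst" for i
  have \<tau>_int: "(\<integral>\<^sup>+w. u w \<partial>\<tau> i) = (\<integral>\<^sup>+p. I i p * u (fst p) \<partial>\<pi>)"
    if [measurable]: "u \<in> borel_measurable borel" for u i
    unfolding \<tau>_def by (simp add: nn_integral_distr nn_integral_density)
  \<comment> \<open>Dropping the restriction to the cell only enlarges the measure, and the whole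
    first marginal is \<open>P\<close>.\<close>
  have ac: "absolutely_continuous P (\<tau> i)" for i
    unfolding absolutely_continuous_def
  proof
    fix A assume A: "A \<in> null_sets P"
    then have [measurable]: "A \<in> sets borel" using P(2) by auto
    have "emeasure (\<tau> i) A = (\<integral>\<^sup>+p. I i p * indicator A (fst p) \<partial>\<pi>)"
      using \<tau>_int[of "indicator A" i] by (simp add: \<tau>_def)
    also have "\<dots> \<le> (\<integral>\<^sup>+p. indicator A (fst p) \<partial>\<pi>)"
      by (intro nn_integral_mono) (auto simp: I_def indicator_def)
    also have "\<dots> = (\<integral>\<^sup>+w. indicator A w \<partial>distr \<pi> borel fst)"
      by (subst nn_integral_distr) auto
    also have "\<dots> = 0" using A unfolding \<pi>(3) by (simp add: null_sets_def)
    finally show "A \<in> null_sets (\<tau> i)" by (simp add: null_sets_def \<tau>_def)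
  qed
  define R where "R i = RN_deriv P (\<tau> i)" for i
  have R [measurable]: "R i \<in> borel_measurable borel" for i
    unfolding R_def using borel_measurable_RN_deriv[of P "\<tau> i"] by simp
  have R_int: "(\<integral>\<^sup>+w. R i w * u w \<partial>P) = (\<integral>\<^sup>+p. I i p * u (fst p) \<partial>\<pi>)"
    if [measurable]: "u \<in> borel_measurable borel" for u i
  proof -
    have "sets (\<tau> i) = sets P" by (simp add: \<tau>_def P(2))
    moreover have "u \<in> borel_measurable P" by measurable
    ultimately have "(\<integral>\<^sup>+w. R i w * u w \<partial>P) = (\<integral>\<^sup>+w. u w \<partial>\<tau> i)"
      unfolding R_def by (rule RN_deriv_nn_integral[OF ac, symmetric])
    then show ?thesis using \<tau>_int by simp
  qed
  have I_int: "(\<integral>\<^sup>+p. I i p \<partial>\<pi>) = (\<integral>\<^sup>+z. ennreal (q z) * indicator {i} (idx z) \<partial>P)" for i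
  proof -
    have "(\<integral>\<^sup>+p. I i p \<partial>\<pi>) = (\<integral>\<^sup>+z. indicator {i} (idx z) \<partial>distr \<pi> borel snd)"
      unfolding I_def by (subst nn_integral_distr) measurable
    also have "\<dots> = (\<integral>\<^sup>+z. ennreal (q z) * indicator {i} (idx z) \<partial>P)"
      unfolding \<pi>(4) by (subst nn_integral_density) measurable
    finally show ?thesis .
  qed
  define c where "c i = (\<integral>\<^sup>+p. I i p * sqdist (fst p) (snd p) \<partial>\<pi>)" for i
  show ?thesis
  proof (rule that[of R c])
    show "R i \<in> borel_measurable borel" for i by fact
    show "(\<integral>\<^sup>+w. R i w \<partial>P) = (\<integral>\<^sup>+z. ennreal (q z) * indicator {i} (idx z) \<partial>P)" for i
      using R_int[of "\<lambda>_. 1" i] I_int[of i] by simp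
    have "(\<integral>\<^sup>+p. sqdist (fst p) (snd p) \<partial>\<pi>) = (\<Sum>i. c i)"
      unfolding c_def I_def
      by (subst nn_integral_cells[of "\<lambda>p. idx (snd p)"]) (simp_all add: mult.commute)
    then show "(\<Sum>i. c i) \<le> ennreal (2 * C) * Ent P q + ennreal \<eta>" using \<pi>(5) by simp
    show "(\<Sum>i. \<integral>\<^sup>+w. R i w * u w \<partial>P) = (\<integral>\<^sup>+w. u w \<partial>P)"
      if [measurable]: "u \<in> borel_measurable borel" for u
    proof -
      have "(\<integral>\<^sup>+w. u w \<partial>P) = (\<integral>\<^sup>+w. u w \<partial>distr \<pi> borel fst)" by (simp only: \<pi>(3))
      also have "\<dots> = (\<integral>\<^sup>+p. u (fst p) \<partial>\<pi>)" by (subst nn_integral_distr) measurable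
      also have "\<dots> = (\<Sum>i. \<integral>\<^sup>+w. R i w * u w \<partial>P)"
        unfolding R_int[OF that] I_def
        by (subst nn_integral_cells[of "\<lambda>p. idx (snd p)"]) (simp_all add: mult.commute)
      finally show ?thesis by simp
    qed
    \<comment> \<open>The second point of the coupling is replaced by an arbitrary point
      \<open>z\<close> of the same cell. This moves it by at most \<delta>, and
      \<open>sq_sum_le\<close> separates this error from the cost of the coupling.\<close>
    fix z
    have "(\<integral>\<^sup>+w. R (idx z) w * sqdist z w \<partial>P) =
        (\<integral>\<^sup>+p. I (idx z) p * sqdist z (fst p) \<partial>\<pi>)"
      by (rule R_int) measurable
    also have "\<dots> \<le> (\<integral>\<^sup>+p. ennreal (1 + \<eta>) * (I (idx z) p * sqdist (fst p) (snd p)) +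
        ennreal ((1 + 1 / \<eta>) * \<delta>\<^sup>2) * I (idx z) p \<partial>\<pi>)"
    proof (intro nn_integral_mono)
      fix p :: "'b \<times> 'b"
      show "I (idx z) p * sqdist z (fst p) \<le>
        ennreal (1 + \<eta>) * (I (idx z) p * sqdist (fst p) (snd p)) +
        ennreal ((1 + 1 / \<eta>) * \<delta>\<^sup>2) * I (idx z) p"
      proof (cases "idx (snd p) = idx z")
        case True
        have "dist z (fst p) \<le> dist (fst p) (snd p) + dist z (snd p)"
          using dist_triangle2[of z "fst p" "snd p"] by simp
        then have "(dist z (fst p))\<^sup>2 \<le> (dist (fst p) (snd p) + dist z (snd p))\<^sup>2"
          by (intro power_mono) auto
        also have "\<dots> \<le> (1 + \<eta>) * (dist (fst p) (snd p))\<^sup>2 + (1 + 1 / \<eta>) * (dist z (snd p))\<^sup>2"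
          by (rule sq_sum_le) fact
        also have "\<dots> \<le> (1 + \<eta>) * (dist (fst p) (snd p))\<^sup>2 + (1 + 1 / \<eta>) * \<delta>\<^sup>2"
          using small[of z "snd p"] True \<open>0 < \<eta>\<close>
          by (intro add_left_mono mult_left_mono power_mono) auto
        finally have "sqdist z (fst p) \<le>
          ennreal ((1 + \<eta>) * (dist (fst p) (snd p))\<^sup>2 + (1 + 1 / \<eta>) * \<delta>\<^sup>2)" by (rule ennreal_leI)
        also have "\<dots> = ennreal (1 + \<eta>) * sqdist (fst p) (snd p) + ennreal ((1 + 1 / \<eta>) * \<delta>\<^sup>2)"
          using \<open>0 < \<eta>\<close> by (subst ennreal_plus) (simp_all add: ennreal_mult')
        finally show ?thesis using True by (simp add: I_def)
      qed (simp add: I_def)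
    qed
    also have "\<dots> = ennreal (1 + \<eta>) * c (idx z) +
      ennreal ((1 + 1 / \<eta>) * \<delta>\<^sup>2) * (\<integral>\<^sup>+y. ennreal (q y) * indicator {idx z} (idx y) \<partial>P)"
      unfolding c_def I_int[symmetric] by (simp add: nn_integral_add nn_integral_cmult)
    finally show "(\<integral>\<^sup>+w. R (idx z) w * sqdist z w \<partial>P) \<le>
      ennreal (1 + \<eta>) * c (idx z) +
      ennreal ((1 + 1 / \<eta>) * \<delta>\<^sup>2) * (\<integral>\<^sup>+y. ennreal (q y) * indicator {idx z} (idx y) \<partial>P)" .
  qed
qed

text \<open>
  A fraction \<open>q i\<close> of the mass \<open>pm i\<close> of \<open>p\<close> in the \<open>i\<close>-th cell is transported according to
  \<open>R i\<close>; the rest is coupled independently.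
\<close>

locale cell_kernel = prob_space P
  for P :: "'b::euclidean_space measure" +
  fixes idx :: "'b \<Rightarrow> nat" and p :: "'b \<Rightarrow> real" and pm q :: "nat \<Rightarrow> real" and t :: real
    and R :: "nat \<Rightarrow> 'b \<Rightarrow> ennreal"
  assumes sets_P [measurable_cong]: "sets P = sets borel"
    and idx [measurable]: "idx \<in> measurable borel (count_space UNIV)"
    and p [measurable]: "p \<in> borel_measurable borel"
    and p_nonneg: "\<And>z. 0 \<le> p z"
    and p_one: "(\<integral>\<^sup>+z. ennreal (p z) \<partial>P) = 1"
    and pm: "\<And>i. (\<integral>\<^sup>+z. ennreal (p z) * indicator {i} (idx z) \<partial>P) = ennreal (pm i)"
    and pm_nonneg: "\<And>i. 0 \<le> pm i"
    and q: "\<And>i. 0 \<le> q i" "\<And>i. q i \<le> pm i"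
    and t: "0 \<le> t" "(\<Sum>i. ennreal (q i)) = ennreal t"
    and R [measurable]: "\<And>i. R i \<in> borel_measurable borel"
    and R_sum: "\<And>u. u \<in> borel_measurable borel \<Longrightarrow>
      ennreal t * (\<Sum>i. \<integral>\<^sup>+w. R i w * u w \<partial>P) = ennreal t * (\<integral>\<^sup>+w. u w \<partial>P)"
    and R_mass: "\<And>i. ennreal t * (\<integral>\<^sup>+w. R i w \<partial>P) = ennreal (q i)"
begin

text \<open>The density of the conditional law of \<open>z'\<close> given \<open>z\<close>. The
  \<open>R i\<close> belong to the normalised masses \<open>q i / t\<close>, so
  \<open>t / pm i * R i\<close> has mass \<open>q i / pm i\<close>; the constant fills this up to 1
  by an independent draw from \<open>P\<close>. In a cell with \<open>pm i = 0\<close>, division by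
  zero yields the constant density 1.\<close>

definition D :: "'b \<Rightarrow> 'b \<Rightarrow> ennreal" where
  "D z w = ennreal (t / pm (idx z)) * R (idx z) w + ennreal (1 - q (idx z) / pm (idx z))"

lemma D_int:
  assumes [measurable]: "u \<in> borel_measurable borel"
  shows "(\<integral>\<^sup>+w. D z w * u w \<partial>P) =
    ennreal (1 / pm (idx z)) * (ennreal t * (\<integral>\<^sup>+w. R (idx z) w * u w \<partial>P)) +
    ennreal (1 - q (idx z) / pm (idx z)) * (\<integral>\<^sup>+w. u w \<partial>P)"
proof -
  have "ennreal (t / pm i) = ennreal (1 / pm i) * ennreal t" for i
    using t(1) pm_nonneg[of i] by (simp flip: ennreal_mult)
  then show ?thesis
    unfolding D_def by (simp add: distrib_right nn_integral_add nn_integral_cmult mult.assoc)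
qed

lemma D_mass: "(\<integral>\<^sup>+w. D z w \<partial>P) = 1"
proof (cases "pm (idx z) = 0")
  case True
  then show ?thesis using D_int[of "\<lambda>_. 1" z] by (simp add: emeasure_space_1)
next
  case False
  let ?a = "q (idx z) / pm (idx z)"
  have a: "0 \<le> ?a" "?a \<le> 1" using False q[of "idx z"] pm_nonneg[of "idx z"] by auto
  have "(\<integral>\<^sup>+w. D z w \<partial>P) = ennreal (1 / pm (idx z)) * ennreal (q (idx z)) + ennreal (1 - ?a)"
    using D_int[of "\<lambda>_. 1" z] by (simp add: emeasure_space_1 R_mass)
  also have "ennreal (1 / pm (idx z)) * ennreal (q (idx z)) = ennreal ?a"
    using pm_nonneg[of "idx z"] q(1)[of "idx z"] by (simp flip: ennreal_mult)
  also have "ennreal ?a + ennreal (1 - ?a) = 1" using a by (simp flip: ennreal_plus)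
  finally show ?thesis .
qed

text \<open>Weighted with its mass \<open>pm i\<close>, each cell contributes \<open>t R i\<close>
  plus \<open>pm i - q i\<close> times \<open>P\<close>. The first parts sum to \<open>t P\<close>,
  the second ones to \<open>(1 - t) P\<close>.\<close>

lemma D_marginal:
  assumes [measurable]: "u \<in> borel_measurable borel"
  shows "(\<integral>\<^sup>+z. ennreal (p z) * (\<integral>\<^sup>+w. D z w * u w \<partial>P) \<partial>P) = (\<integral>\<^sup>+w. u w \<partial>P)"
proof -
  let ?U = "\<integral>\<^sup>+w. u w \<partial>P"
  let ?v = "\<lambda>i. ennreal (1 / pm i) * (ennreal t * (\<integral>\<^sup>+w. R i w * u w \<partial>P)) + ennreal (1 - q i / pm i) * ?U"
  have v: "?v i * ennreal (pm i) = ennreal t * (\<integral>\<^sup>+w. R i w * u w \<partial>P) + ennreal (pm i - q i) * ?U" for i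
  proof (cases "pm i = 0")
    case True
    \<comment> \<open>In an empty cell \<open>q i = 0\<close>; hence \<open>R i\<close> is almost
      everywhere 0 unless \<open>t = 0\<close>.\<close>
    have "ennreal t * (\<integral>\<^sup>+w. R i w * u w \<partial>P) = 0"
    proof (cases "t = 0")
      case False
      have "ennreal t * (\<integral>\<^sup>+w. R i w \<partial>P) = 0" using R_mass[of i] q[of i] True by simp
      then have "(\<integral>\<^sup>+w. R i w \<partial>P) = 0" using False t(1) by simp
      then have "AE w in P. R i w = 0" by (subst (asm) nn_integral_0_iff_AE) auto
      then have "AE w in P. R i w * u w = 0" by eventually_elim simp
      then show ?thesis by (subst nn_integral_0_iff_AE[THEN iffD2]) auto
    qed simp
    then show ?thesis using True q[of i] by simp
  next
    case False
    then have "pm i > 0" using pm_nonneg[of i] by simp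
    have 1: "ennreal (1 / pm i) * x * ennreal (pm i) = x" for x
    proof -
      have "ennreal (1 / pm i) * x * ennreal (pm i) = ennreal (1 / pm i * pm i) * x"
        using \<open>pm i > 0\<close> by (subst ennreal_mult) (simp_all add: mult_ac)
      then show ?thesis using \<open>pm i > 0\<close> by simp
    qed
    have "ennreal (1 - q i / pm i) * ennreal (pm i) = ennreal ((1 - q i / pm i) * pm i)"
      using \<open>pm i > 0\<close> q[of i] by (intro ennreal_mult[symmetric]) auto
    also have "(1 - q i / pm i) * pm i = pm i - q i" using \<open>pm i > 0\<close> by (simp add: field_simps)
    finally have 2: "ennreal (1 - q i / pm i) * x * ennreal (pm i) = ennreal (pm i - q i) * x" for x
      by (simp add: mult_ac)
    show ?thesis by (simp only: distrib_right 1 2)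
  qed
  have "(\<integral>\<^sup>+z. ennreal (p z) * (\<integral>\<^sup>+w. D z w * u w \<partial>P) \<partial>P) = (\<integral>\<^sup>+z. ennreal (p z) * ?v (idx z) \<partial>P)"
    by (simp add: D_int)
  also have "\<dots> = (\<Sum>i. ?v i * ennreal (pm i))"
    by (subst nn_integral_cells_weight) (simp_all add: pm)
  also have "\<dots> = (\<Sum>i. ennreal t * (\<integral>\<^sup>+w. R i w * u w \<partial>P)) + (\<Sum>i. ennreal (pm i - q i) * ?U)"
    unfolding v by (intro suminf_add[symmetric]) auto
  also have "(\<Sum>i. ennreal t * (\<integral>\<^sup>+w. R i w * u w \<partial>P)) = (\<Sum>i. ennreal (q i)) * ?U"
    using R_sum[OF assms] t by simp
  also have "\<dots> + (\<Sum>i. ennreal (pm i - q i) * ?U) = (\<Sum>i. ennreal (q i) + ennreal (pm i - q i)) * ?U"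
    by (subst suminf_add[symmetric]) (auto simp: distrib_right)
  also have "(\<Sum>i. ennreal (q i) + ennreal (pm i - q i)) = (\<Sum>i. ennreal (pm i))"
    using q by (intro suminf_cong) (simp flip: ennreal_plus)
  also have "\<dots> = 1"
    unfolding pm[symmetric] using p_one by (subst nn_integral_cells[symmetric]) auto
  finally show ?thesis by simp
qed

lemma pm_pos_AE: "AE z in P. p z = 0 \<or> 0 < pm (idx z)"
proof -
  have "AE z in P. \<forall>i. pm i = 0 \<longrightarrow> ennreal (p z) * indicator {i} (idx z) = 0"
  proof (subst AE_all_countable, intro allI)
    fix i
    show "AE z in P. pm i = 0 \<longrightarrow> ennreal (p z) * indicator {i} (idx z) = 0"
    proof (cases "pm i = 0")
      case True
      then have "(\<integral>\<^sup>+z. ennreal (p z) * indicator {i} (idx z) \<partial>P) = 0" by (simp add: pm)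
      then have "AE z in P. ennreal (p z) * indicator {i} (idx z) = 0"
        by (subst (asm) nn_integral_0_iff_AE) auto
      then show ?thesis by eventually_elim simp
    qed simp
  qed
  then show ?thesis
  proof eventually_elim
    case (elim z)
    show ?case
    proof (cases "pm (idx z) = 0")
      case True
      with elim have "ennreal (p z) = 0" by (auto simp: indicator_def)
      then show ?thesis using p_nonneg[of z] by (simp add: ennreal_eq_0_iff)
    qed (use pm_nonneg[of "idx z"] in simp)
  qed
qed

text \<open>In the transported part the factor \<open>1 / pm i\<close> cancels against the mass of
  the cell. The independent fraction \<open>1 - q i / pm i\<close> is at most \<eta> in the first
  \<open>N\<close> cells and at most 1 in the others, and an independent pair costs at most twice
  the sum of the second moments.\<close>

lemma D_cost:
  assumes c: "\<And>z. ennreal t * (\<integral>\<^sup>+w. R (idx z) w * sqdist z w \<partial>P) \<le> c (idx z)"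
    and low: "\<And>i. i < N \<Longrightarrow> exp (- \<eta>) * pm i \<le> q i" and "0 \<le> \<eta>"
  shows "(\<integral>\<^sup>+z. ennreal (p z) * (\<integral>\<^sup>+w. D z w * sqdist z w \<partial>P) \<partial>P) \<le>
    (\<Sum>i. c i) + (\<integral>\<^sup>+z. ennreal (p z) * ((ennreal \<eta> + indicator {N..} (idx z)) *
      (2 * sqnorm z + 2 * (\<integral>\<^sup>+w. sqnorm w \<partial>P))) \<partial>P)"
proof -
  let ?m2 = "\<integral>\<^sup>+w. sqnorm w \<partial>P"
  let ?v = "\<lambda>i. ennreal (1 / pm i) * c i"
  let ?J = "\<lambda>z. (ennreal \<eta> + indicator {N..} (idx z)) * (2 * sqnorm z + 2 * ?m2)"
  have ind [measurable]: "(\<lambda>z. indicator {N..} (idx z) :: ennreal) \<in> borel_measurable borel"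
    by (rule measurable_compose[OF idx]) simp
  have v [measurable]: "(\<lambda>z. ?v (idx z)) \<in> borel_measurable borel"
    by (rule measurable_compose[OF idx]) simp
  have d: "(\<integral>\<^sup>+w. sqdist z w \<partial>P) \<le> 2 * sqnorm z + 2 * ?m2" for z
  proof -
    have "(\<integral>\<^sup>+w. sqdist z w \<partial>P) \<le> (\<integral>\<^sup>+w. 2 * sqnorm z + 2 * sqnorm w \<partial>P)"
    proof (intro nn_integral_mono)
      fix w
      have "sqdist z w \<le> ennreal (2 * (norm z)\<^sup>2 + 2 * (norm w)\<^sup>2)"
        by (intro ennreal_leI norm_diff_sq_le)
      then show "sqdist z w \<le> 2 * sqnorm z + 2 * sqnorm w"
        by (simp add: ennreal_mult)
    qed
    then show ?thesis by (simp add: nn_integral_add nn_integral_cmult emeasure_space_1)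
  qed
  have "(\<integral>\<^sup>+z. ennreal (p z) * (\<integral>\<^sup>+w. D z w * sqdist z w \<partial>P) \<partial>P) \<le>
    (\<integral>\<^sup>+z. ennreal (p z) * ?v (idx z) + ennreal (p z) * ?J z \<partial>P)"
    using pm_pos_AE
  proof (intro nn_integral_mono_AE, eventually_elim)
    case (elim z)
    show ?case
    proof (cases "p z = 0")
      case False
      with elim have pos: "0 < pm (idx z)" by simp
      \<comment> \<open>The bound is \<open>1 - exp (- \<eta>) \<le> \<eta>\<close>.\<close>
      have "1 - q (idx z) / pm (idx z) \<le> \<eta>" if "idx z < N"
      proof -
        have "exp (- \<eta>) \<le> q (idx z) / pm (idx z)" using low[OF that] pos by (simp add: field_simps)
        moreover have "1 - \<eta> \<le> exp (- \<eta>)" using exp_ge_add_one_self[of "- \<eta>"] by simp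
        ultimately show ?thesis by linarith
      qed
      moreover have "1 - q (idx z) / pm (idx z) \<le> 1" using q(1)[of "idx z"] pos by simp
      ultimately have s: "ennreal (1 - q (idx z) / pm (idx z)) \<le> ennreal \<eta> + indicator {N..} (idx z)"
        by (auto simp: indicator_def not_le intro!: ennreal_leI add_increasing)
      have "(\<integral>\<^sup>+w. D z w * sqdist z w \<partial>P) \<le> ?v (idx z) + ?J z"
        unfolding D_int[of "\<lambda>w. sqdist z w" z, simplified]
        by (intro add_mono mult_mono c d s) auto
      from mult_left_mono[OF this zero_le, of "ennreal (p z)"]
      show ?thesis by (simp only: distrib_left)
    qed simp
  qed
  also have "\<dots> = (\<integral>\<^sup>+z. ennreal (p z) * ?v (idx z) \<partial>P) + (\<integral>\<^sup>+z. ennreal (p z) * ?J z \<partial>P)"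
    by (intro nn_integral_add) measurable
  also have "(\<integral>\<^sup>+z. ennreal (p z) * ?v (idx z) \<partial>P) = (\<Sum>i. ?v i * ennreal (pm i))"
    by (subst nn_integral_cells_weight) (simp_all add: pm)
  \<comment> \<open>Only an inequality: for \<open>pm i = 0\<close> the left term is 0.\<close>
  also have "\<dots> \<le> (\<Sum>i. c i)"
  proof (intro suminf_le)
    fix i
    have "?v i * ennreal (pm i) = ennreal (1 / pm i * pm i) * c i"
      using pm_nonneg[of i] by (subst ennreal_mult) (simp_all add: mult_ac)
    also have "\<dots> \<le> 1 * c i" by (intro mult_right_mono) auto
    finally show "?v i * ennreal (pm i) \<le> c i" by simp
  qed auto
  finally show ?thesis by (simp add: add_right_mono)
qed

end

section \<open>The approximation errors: tails, averaged second moments, entropy of rounded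
  densities\<close>

lemma tail_cells_tendsto_0:
  fixes idx :: "'a \<Rightarrow> nat"
  assumes idx [measurable]: "idx \<in> measurable M (count_space UNIV)"
    and [measurable]: "f \<in> borel_measurable M" and fin: "(\<integral>\<^sup>+x. f x \<partial>M) < \<infinity>"
  shows "(\<lambda>N. \<integral>\<^sup>+x. f x * indicator {N..} (idx x) \<partial>M) \<longlonglongrightarrow> 0"
proof -
  have [measurable]: "(\<lambda>z. indicator {N..} (idx z) :: ennreal) \<in> borel_measurable M" for N
    by (rule measurable_compose[OF idx]) simp
  have "(\<lambda>N. \<integral>\<^sup>+x. f x * indicator {N..} (idx x) \<partial>M) \<longlonglongrightarrow> (\<integral>\<^sup>+x. 0 \<partial>M)"
  proof (rule nn_integral_dominated_convergence[where w = f])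
    show "AE x in M. (\<lambda>N. f x * indicator {N..} (idx x)) \<longlonglongrightarrow> 0"
    proof (intro AE_I2 tendsto_eventually)
      fix x
      show "\<forall>\<^sub>F N in sequentially. f x * indicator {N..} (idx x) = 0"
        using eventually_gt_at_top[of "idx x"] by eventually_elim simp
    qed
  qed (use fin in \<open>auto simp: indicator_def\<close>)
  then show ?thesis by simp
qed

text \<open>The mixture of the laws \<open>p a\<close> over \<alpha> has a density \<open>pb\<close>
  whose entropy is at most the averaged entropy, so \<open>T2_second_moment_iff\<close> applies to
  the mixture. This makes the cost of independent coupling integrable over the past although no
  single conditional law is controlled uniformly.\<close>

lemma second_moment_mixture:
  fixes P :: "'b::euclidean_space measure" and p :: "'a \<Rightarrow> 'b \<Rightarrow> real"
  assumes T2: "T2 C dist P" and P: "prob_space P" "sets P = sets borel" and C: "0 \<le> C"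
    and \<alpha>: "prob_space \<alpha>" and p [measurable]: "case_prod p \<in> borel_measurable (\<alpha> \<Otimes>\<^sub>M P)"
    and p0: "\<And>a z. 0 \<le> p a z" and p1: "\<And>a. a \<in> space \<alpha> \<Longrightarrow> (\<integral>\<^sup>+z. ennreal (p a z) \<partial>P) = 1"
    and H: "(\<integral>\<^sup>+a. Ent P (p a) \<partial>\<alpha>) < \<infinity>"
  shows "(\<integral>\<^sup>+a. \<integral>\<^sup>+z. ennreal (p a z) * sqnorm z \<partial>P \<partial>\<alpha>) < \<infinity>"
proof -
  interpret PP: prob_space P by fact
  interpret \<alpha>: prob_space \<alpha> by fact
  interpret pair_sigma_finite \<alpha> P ..
  interpret AP: prob_space "\<alpha> \<Otimes>\<^sub>M P" by (intro prob_space_pair P \<alpha>)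
  note P(2)[measurable_cong]
  define b where "b z = (\<integral>\<^sup>+a. ennreal (p a z) \<partial>\<alpha>)" for z
  define pb where "pb z = enn2real (b z)" for z
  have p2 [measurable]: "(\<lambda>x. p (fst x) (snd x)) \<in> borel_measurable (\<alpha> \<Otimes>\<^sub>M P)"
    using p by (simp add: case_prod_beta')
  have [measurable]: "b \<in> borel_measurable P"
    unfolding b_def[abs_def] by measurable
  have [measurable]: "pb \<in> borel_measurable P"
    unfolding pb_def[abs_def] by measurable
  have pb_nonneg: "0 \<le> pb z" for z by (simp add: pb_def)
  have b_int: "(\<integral>\<^sup>+z. b z * u z \<partial>P) = (\<integral>\<^sup>+a. \<integral>\<^sup>+z. ennreal (p a z) * u z \<partial>P \<partial>\<alpha>)"
    if [measurable]: "u \<in> borel_measurable P" for u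
  proof -
    have "(\<integral>\<^sup>+z. b z * u z \<partial>P) = (\<integral>\<^sup>+z. \<integral>\<^sup>+a. ennreal (p a z) * u z \<partial>\<alpha> \<partial>P)"
      unfolding b_def by (intro nn_integral_cong nn_integral_multc[symmetric]) measurable
    also have "\<dots> = (\<integral>\<^sup>+a. \<integral>\<^sup>+z. ennreal (p a z) * u z \<partial>P \<partial>\<alpha>)"
      by (rule Fubini') measurable
    finally show ?thesis .
  qed
  have one: "(\<integral>\<^sup>+a. \<integral>\<^sup>+z. ennreal (p a z) \<partial>P \<partial>\<alpha>) = 1"
  proof -
    have "(\<integral>\<^sup>+a. \<integral>\<^sup>+z. ennreal (p a z) \<partial>P \<partial>\<alpha>) = (\<integral>\<^sup>+a. 1 \<partial>\<alpha>)"
      using p1 by (intro nn_integral_cong) auto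
    then show ?thesis by (simp add: \<alpha>.emeasure_space_1)
  qed
  have b1: "(\<integral>\<^sup>+z. b z \<partial>P) = 1"
    using b_int[of "\<lambda>_. 1"] one by simp
  have "AE z in P. b z \<noteq> \<infinity>"
    by (rule nn_integral_PInf_AE) (use b1 in auto)
  then have b_pb: "AE z in P. b z = ennreal (pb z)"
    by eventually_elim (simp add: pb_def less_top)
  have pb_int: "(\<integral>\<^sup>+z. ennreal (pb z) * u z \<partial>P) = (\<integral>\<^sup>+a. \<integral>\<^sup>+z. ennreal (p a z) * u z \<partial>P \<partial>\<alpha>)"
    if [measurable]: "u \<in> borel_measurable P" for u
  proof -
    have "(\<integral>\<^sup>+z. ennreal (pb z) * u z \<partial>P) = (\<integral>\<^sup>+z. b z * u z \<partial>P)"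
      using b_pb by (intro nn_integral_cong_AE) (auto elim: eventually_mono)
    then show ?thesis using b_int[OF that] by simp
  qed
  have pb1: "(\<integral>\<^sup>+z. ennreal (pb z) \<partial>P) = 1"
    using pb_int[of "\<lambda>_. 1"] one by simp
  \<comment> \<open>On the product space \<open>pb\<close>, read as a function of the second
    coordinate, is the conditional expectation of \<open>p\<close>.\<close>
  have "Ent (\<alpha> \<Otimes>\<^sub>M P) (\<lambda>x. pb (snd x)) \<le> Ent (\<alpha> \<Otimes>\<^sub>M P) (\<lambda>x. p (fst x) (snd x))"
  proof (rule Ent_coarsen)
    show "(\<integral>\<^sup>+x. ennreal (p (fst x) (snd x)) \<partial>(\<alpha> \<Otimes>\<^sub>M P)) < \<infinity>"
    proof -
      have "(\<integral>\<^sup>+x. ennreal (p (fst x) (snd x)) \<partial>(\<alpha> \<Otimes>\<^sub>M P)) =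
          (\<integral>\<^sup>+a. \<integral>\<^sup>+z. ennreal (p a z) \<partial>P \<partial>\<alpha>)"
        using PP.nn_integral_fst[of "\<lambda>x. ennreal (p (fst x) (snd x))" \<alpha>] by simp
      then show ?thesis using one by simp
    qed
    fix u :: "real \<Rightarrow> ennreal" assume [measurable]: "u \<in> borel_measurable borel"
    have "(\<integral>\<^sup>+x. ennreal (p (fst x) (snd x)) * u (pb (snd x)) \<partial>(\<alpha> \<Otimes>\<^sub>M P)) =
        (\<integral>\<^sup>+a. \<integral>\<^sup>+z. ennreal (p a z) * u (pb z) \<partial>P \<partial>\<alpha>)"
      by (subst PP.nn_integral_fst[symmetric]) auto
    also have "\<dots> = (\<integral>\<^sup>+z. ennreal (pb z) * u (pb z) \<partial>P)"
      by (rule pb_int[symmetric]) measurable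
    also have "\<dots> = (\<integral>\<^sup>+a. \<integral>\<^sup>+z. ennreal (pb z) * u (pb z) \<partial>P \<partial>\<alpha>)"
      by (simp add: \<alpha>.emeasure_space_1)
    also have "\<dots> = (\<integral>\<^sup>+x. ennreal (pb (snd x)) * u (pb (snd x)) \<partial>(\<alpha> \<Otimes>\<^sub>M P))"
      by (subst PP.nn_integral_fst[symmetric]) auto
    finally show "(\<integral>\<^sup>+x. ennreal (p (fst x) (snd x)) * u (pb (snd x)) \<partial>(\<alpha> \<Otimes>\<^sub>M P)) =
      (\<integral>\<^sup>+x. ennreal (pb (snd x)) * u (pb (snd x)) \<partial>(\<alpha> \<Otimes>\<^sub>M P))" .
  qed (use p0 AP.prob_space_axioms in \<open>auto simp: pb_def\<close>)
  also have "Ent (\<alpha> \<Otimes>\<^sub>M P) (\<lambda>x. pb (snd x)) = Ent P pb"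
    unfolding Ent_def by (subst PP.nn_integral_fst[symmetric]) (auto simp: \<alpha>.emeasure_space_1)
  also have "Ent (\<alpha> \<Otimes>\<^sub>M P) (\<lambda>x. p (fst x) (snd x)) = (\<integral>\<^sup>+a. Ent P (p a) \<partial>\<alpha>)"
    unfolding Ent_def by (subst PP.nn_integral_fst[symmetric]) auto
  finally have "Ent P pb < \<infinity>" using H by (rule le_less_trans)
  then have "(\<integral>\<^sup>+z. ennreal (pb z) * sqnorm z \<partial>P) < \<infinity>"
    using T2_second_moment_iff[OF T2 P C _ pb_nonneg pb1] T2_second_moment[OF T2 P C] by simp
  then show ?thesis by (subst (asm) pb_int) auto
qed

text \<open>Three replacements lead from \<open>p\<close> to \<open>t * qh\<close>: averaging over
  cells does not increase the entropy by Jensen, rounding down costs at most \<eta> by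
  \<open>psi_contract\<close>, and discarding the cells from \<open>N\<close> on costs their
  \<open>P\<close>-mass, since \<open>psi 0 = 1\<close>. Undoing the normalisation by
  \<open>t\<close> produces the factor on the left.\<close>

lemma Ent_cells:
  fixes P :: "'b::euclidean_space measure" and idx :: "'b \<Rightarrow> nat"
  assumes P: "prob_space P" "sets P = sets borel"
    and idx [measurable]: "idx \<in> measurable borel (count_space UNIV)"
    and p [measurable]: "p \<in> borel_measurable borel" and p0: "\<And>z. 0 \<le> p z"
    and p1: "(\<integral>\<^sup>+z. ennreal (p z) \<partial>P) = 1"
    and pm: "\<And>i. (\<integral>\<^sup>+z. ennreal (p z) * indicator {i} (idx z) \<partial>P) = ennreal (pm i)"
    and pm0: "\<And>i. 0 \<le> pm i"
    and Pm: "\<And>i. (\<integral>\<^sup>+z. indicator {i} (idx z) \<partial>P) = ennreal (Pm i)" "\<And>i. 0 \<le> Pm i"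
    and q: "\<And>i. 0 \<le> q i" "\<And>i. q i \<le> pm i"
    and low: "\<And>i. i < N \<Longrightarrow> exp (- \<eta>) * pm i \<le> q i" and high: "\<And>i. N \<le> i \<Longrightarrow> q i = 0"
    and "0 \<le> \<eta>" and t: "0 < t"
    and qh: "qh = (\<lambda>z. q (idx z) / (t * Pm (idx z)))"
    and qh1: "(\<integral>\<^sup>+z. ennreal (qh z) \<partial>P) = 1"
  shows "ennreal t * Ent P qh \<le> Ent P p + ennreal \<eta> + (\<integral>\<^sup>+z. indicator {N..} (idx z) \<partial>P)"
proof -
  interpret P: prob_space P by fact
  note P(2)[measurable_cong]
  have [measurable]: "(\<lambda>z. indicator {N..} (idx z) :: ennreal) \<in> borel_measurable borel"
    by (rule measurable_compose[OF idx]) simp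
  have [measurable]: "qh \<in> borel_measurable borel"
    unfolding qh by (rule measurable_compose[OF idx]) simp
  \<comment> \<open>The conditional expectation of \<open>p\<close> given the cell, under
    \<open>P\<close>.\<close>
  define h where "h z = pm (idx z) / Pm (idx z)" for z
  have [measurable]: "h \<in> borel_measurable borel"
    unfolding h_def[abs_def] by (rule measurable_compose[OF idx]) simp
  have h0: "0 \<le> h z" for z using pm0 Pm by (simp add: h_def)
  have qh0: "0 \<le> qh z" for z using q Pm t by (simp add: qh)
  have pm_Pm: "pm i = 0" if "Pm i = 0" for i
    using nn_integral_null_cell[of idx P i p] Pm(1)[of i] pm[of i] pm0[of i] that by (simp add: ennreal_eq_0_iff)
  have "Ent P h \<le> Ent P p"
  proof (rule Ent_coarsen)
    fix u :: "real \<Rightarrow> ennreal" assume [measurable]: "u \<in> borel_measurable borel"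
    have "(\<integral>\<^sup>+z. ennreal (p z) * u (h z) \<partial>P) = (\<Sum>i. u (pm i / Pm i) * ennreal (pm i))"
      unfolding h_def by (subst nn_integral_cells_weight[where v = "\<lambda>i. u (pm i / Pm i)"]) (simp_all add: pm)
    also have "\<dots> = (\<Sum>i. ennreal (pm i / Pm i) * u (pm i / Pm i) * ennreal (Pm i))"
    proof (intro suminf_cong)
      fix i
      have "ennreal (pm i) = ennreal (pm i / Pm i) * ennreal (Pm i)"
        using pm0[of i] Pm(2)[of i] pm_Pm[of i] by (cases "Pm i = 0") (auto simp flip: ennreal_mult)
      then show "u (pm i / Pm i) * ennreal (pm i) = ennreal (pm i / Pm i) * u (pm i / Pm i) * ennreal (Pm i)"
        by (simp add: mult_ac)
    qed
    also have "\<dots> = (\<integral>\<^sup>+z. 1 * (ennreal (h z) * u (h z)) \<partial>P)"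
      unfolding h_def
      by (subst nn_integral_cells_weight[where v = "\<lambda>i. ennreal (pm i / Pm i) * u (pm i / Pm i)"])
         (simp_all add: Pm)
    finally show "(\<integral>\<^sup>+z. ennreal (p z) * u (h z) \<partial>P) = (\<integral>\<^sup>+z. ennreal (h z) * u (h z) \<partial>P)" by simp
  qed (use p0 h0 p1 P in auto)
  have bound: "psi (t * qh z) \<le> psi (h z) + \<eta> + indicator {N..} (idx z)" for z
  proof (cases "idx z < N")
    case True
    show ?thesis
    proof (cases "pm (idx z) = 0")
      case True
      then have "t * qh z = h z" using q[of "idx z"] by (simp add: qh h_def)
      then show ?thesis using \<open>0 \<le> \<eta>\<close> by (simp add: indicator_def)
    next
      case False
      then have pos: "0 < pm (idx z)" using pm0[of "idx z"] by simp
      define c where "c = q (idx z) / pm (idx z)"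
      have "t * qh z = c * h z" using t pos by (simp add: qh h_def c_def)
      moreover have "c \<le> 1" "0 \<le> c" using q[of "idx z"] pos by (auto simp: c_def)
      moreover have "exp (- \<eta>) \<le> c" using low[OF True] pos by (simp add: c_def field_simps)
      moreover have "1 - \<eta> \<le> exp (- \<eta>)" using exp_ge_add_one_self[of "- \<eta>"] by simp
      ultimately show ?thesis using psi_contract[OF h0[of z], of c] True by simp
    qed
  next
    case False
    then have "qh z = 0" using high[of "idx z"] by (simp add: qh)
    then show ?thesis using False psi_nonneg[OF h0[of z]] \<open>0 \<le> \<eta>\<close> by (simp add: psi_def)
  qed
  have t_psi: "0 \<le> psi t" using psi_nonneg[of t] t by simp
  \<comment> \<open>Integrating \<open>psi_mult\<close> shows that the integral of
    \<open>psi (t * qh)\<close> exceeds \<open>t * Ent P qh\<close> by exactly \<open>psi t\<close>,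
    which is nonnegative.\<close>
  have "ennreal t * Ent P qh + (ennreal (psi t) + 1 + ennreal t) =
    (\<integral>\<^sup>+z. ennreal (qh z) * ennreal (psi t) + ennreal t * ennreal (psi (qh z)) + 1 + ennreal t * ennreal (qh z) \<partial>P)"
    by (simp add: nn_integral_add nn_integral_cmult nn_integral_multc Ent_def qh1 P.emeasure_space_1 ac_simps)
  also have "\<dots> = (\<integral>\<^sup>+z. ennreal (psi (t * qh z)) + ennreal t + ennreal (qh z) \<partial>P)"
  proof (intro nn_integral_cong)
    fix z
    have "ennreal (psi (t * qh z) + t + qh z) = ennreal (qh z * psi t + t * psi (qh z) + 1 + t * qh z)"
      using psi_mult[of t "qh z"] t qh0[of z] by simp
    then show "ennreal (qh z) * ennreal (psi t) + ennreal t * ennreal (psi (qh z)) + 1 + ennreal t * ennreal (qh z) =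
        ennreal (psi (t * qh z)) + ennreal t + ennreal (qh z)"
      using t qh0[of z] t_psi psi_nonneg[of "qh z"] psi_nonneg[of "t * qh z"]
      by (simp add: ennreal_mult)
  qed
  also have "\<dots> = (\<integral>\<^sup>+z. ennreal (psi (t * qh z)) \<partial>P) + (ennreal t + 1)"
    by (simp add: nn_integral_add qh1 P.emeasure_space_1 ac_simps)
  also have "\<dots> \<le> (\<integral>\<^sup>+z. ennreal (psi (t * qh z)) \<partial>P) + (ennreal (psi t) + 1 + ennreal t)"
    by (intro add_left_mono) (simp add: ac_simps add_increasing)
  finally have "ennreal t * Ent P qh \<le> (\<integral>\<^sup>+z. ennreal (psi (t * qh z)) \<partial>P)"
    by (subst (asm) (1 2) add.commute) (simp add: ennreal_add_left_cancel_le)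
  also have "\<dots> \<le> (\<integral>\<^sup>+z. ennreal (psi (h z)) + ennreal \<eta> + indicator {N..} (idx z) \<partial>P)"
  proof (intro nn_integral_mono)
    fix z
    have "ennreal (psi (t * qh z)) \<le> ennreal (psi (h z) + \<eta> + indicator {N..} (idx z))"
      by (rule ennreal_leI[OF bound])
    then show "ennreal (psi (t * qh z)) \<le> ennreal (psi (h z)) + ennreal \<eta> + indicator {N..} (idx z)"
      using psi_nonneg[OF h0[of z]] \<open>0 \<le> \<eta>\<close> by (cases "N \<le> idx z") simp_all
  qed
  also have "\<dots> = Ent P h + ennreal \<eta> + (\<integral>\<^sup>+z. indicator {N..} (idx z) \<partial>P)"
    by (simp add: nn_integral_add Ent_def P.emeasure_space_1)
  also have "\<dots> \<le> Ent P p + ennreal \<eta> + (\<integral>\<^sup>+z. indicator {N..} (idx z) \<partial>P)"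
    using \<open>Ent P h \<le> Ent P p\<close> by (intro add_right_mono)
  finally show ?thesis .
qed

section \<open>Countably many keys and the choice of one kernel per key\<close>

definition key_val :: "real \<Rightarrow> int option list \<Rightarrow> nat \<Rightarrow> real" where
  "key_val \<eta> l i = (if i < length l then (case l ! i of None \<Rightarrow> 0 | Some k \<Rightarrow> exp (\<eta> * of_int k)) else 0)"

text \<open>The rounded logarithms of the first \<open>N\<close> masses, with \<open>None\<close>
  for mass 0. The type of keys is countable, so any function of the key is measurable;
  \<open>key_val\<close> recovers the rounded masses from it.\<close>

definition key_of :: "real \<Rightarrow> nat \<Rightarrow> (nat \<Rightarrow> real) \<Rightarrow> int option list" where
  "key_of \<eta> N m = map (\<lambda>i. if m i > 0 then Some \<lfloor>ln (m i) / \<eta>\<rfloor> else None) [0..<N]"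

lemma key_val_key_of: "key_val \<eta> (key_of \<eta> N m) i = (if i < N then round_down \<eta> (m i) else 0)"
  by (simp add: key_val_def key_of_def round_down_def)

lemma key_val_nonneg: "0 \<le> key_val \<eta> l i"
  by (simp add: key_val_def split: option.splits)

lemma measurable_key_of:
  assumes [measurable]: "\<And>i. (\<lambda>a. m a i) \<in> borel_measurable M"
  shows "(\<lambda>a. key_of \<eta> N (m a)) \<in> measurable M (count_space UNIV)"
proof -
  have [measurable]: "Measurable.pred M (\<lambda>a. (if m a i > 0 then Some \<lfloor>ln (m a i) / \<eta>\<rfloor> else None) = x)" for i x
    by (cases x) measurable
  have "Measurable.pred M (\<lambda>a. key_of \<eta> N (m a) = l)" for l
  proof -
    have "(\<lambda>a. key_of \<eta> N (m a) = l) = (\<lambda>a. length l = N \<and>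
      (\<forall>i\<in>{..<N}. (if m a i > 0 then Some \<lfloor>ln (m a i) / \<eta>\<rfloor> else None) = l ! i))"
      by (auto simp: key_of_def list_eq_iff_nth_eq fun_eq_iff)
    then show ?thesis by simp
  qed
  then have "(\<lambda>a. key_of \<eta> N (m a)) -` {l} \<inter> space M \<in> sets M" for l
    by (simp add: pred_def vimage_def Int_def conj_commute)
  then show ?thesis by (subst measurable_count_space_eq2_countable) auto
qed

text \<open>The masses \<open>q i / t\<close> are realised by a density \<open>qh\<close> that is
  constant on each cell; this is possible because \<open>q\<close> vanishes on \<open>P\<close>-null
  cells. \<open>T2_cell_densities\<close> applies to \<open>qh\<close>, and its estimates are scaled
  back by \<open>t\<close>.\<close>

lemma cell_densities_of_key:
  fixes P :: "'b::euclidean_space measure" and idx :: "'b \<Rightarrow> nat"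
  assumes T2: "T2 C dist P" and P: "prob_space P" "sets P = sets borel" and "0 \<le> C"
    and idx: "idx \<in> measurable borel (count_space UNIV)"
    and small: "\<And>y z. idx y = idx z \<Longrightarrow> dist y z \<le> \<delta>" and "0 < \<eta>"
    and Pm: "\<And>i. (\<integral>\<^sup>+z. indicator {i} (idx z) \<partial>P) = ennreal (Pm i)" "\<And>i. 0 \<le> Pm i"
    and q: "\<And>i. 0 \<le> q i" "\<And>i. N \<le> i \<Longrightarrow> q i = 0" "\<And>i. Pm i = 0 \<Longrightarrow> q i = 0"
    and t: "0 < t" "t = (\<Sum>i<N. q i)"
    and qh: "qh = (\<lambda>z. q (idx z) / (t * Pm (idx z)))"
  obtains R :: "nat \<Rightarrow> 'b \<Rightarrow> ennreal" and c :: "nat \<Rightarrow> ennreal"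
  where "\<And>i. R i \<in> borel_measurable borel"
    and "\<And>u. u \<in> borel_measurable borel \<Longrightarrow> (\<Sum>i. \<integral>\<^sup>+w. R i w * u w \<partial>P) = (\<integral>\<^sup>+w. u w \<partial>P)"
    and "\<And>i. ennreal t * (\<integral>\<^sup>+w. R i w \<partial>P) = ennreal (q i)"
    and "(\<integral>\<^sup>+z. ennreal (qh z) \<partial>P) = 1"
    and "(\<Sum>i. c i) \<le> ennreal (2 * C) * Ent P qh + ennreal \<eta>"
    and "\<And>z. ennreal t * (\<integral>\<^sup>+w. R (idx z) w * sqdist z w \<partial>P) \<le>
      ennreal (1 + \<eta>) * (ennreal t * c (idx z)) +
      ennreal ((1 + 1 / \<eta>) * \<delta>\<^sup>2) * ennreal (q (idx z))"
proof -
  interpret P: prob_space P by fact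
  note P(2)[measurable_cong]
  note [measurable] = idx
  have [measurable]: "qh \<in> borel_measurable borel"
    unfolding qh by (rule measurable_compose[OF idx]) simp
  have qh0: "0 \<le> qh z" for z using q Pm t by (simp add: qh)
  have cell: "(\<integral>\<^sup>+z. ennreal (qh z) * indicator {i} (idx z) \<partial>P) = ennreal (q i / t)" for i
  proof -
    have "(\<integral>\<^sup>+z. ennreal (qh z) * indicator {i} (idx z) \<partial>P) =
        (\<integral>\<^sup>+z. ennreal (q i / (t * Pm i)) * indicator {i} (idx z) \<partial>P)"
      by (intro nn_integral_cong) (auto simp: qh indicator_def)
    also have "\<dots> = ennreal (q i / (t * Pm i)) * ennreal (Pm i)"
      by (simp add: nn_integral_cmult Pm)
    also have "\<dots> = ennreal (q i / t)"
      using q(1)[of i] q(3)[of i] Pm(2)[of i] t by (cases "Pm i = 0") (simp_all flip: ennreal_mult)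
    finally show ?thesis .
  qed
  have qh1: "(\<integral>\<^sup>+z. ennreal (qh z) \<partial>P) = 1"
  proof -
    have "(\<integral>\<^sup>+z. ennreal (qh z) \<partial>P) = (\<Sum>i. ennreal (q i / t))"
      by (subst nn_integral_cells[of idx]) (simp_all add: cell)
    also have "\<dots> = (\<Sum>i<N. ennreal (q i / t))"
      using q(2) by (intro suminf_finite) auto
    also have "\<dots> = ennreal (\<Sum>i<N. q i / t)"
      using q t by (intro sum_ennreal) auto
    also have "(\<Sum>i<N. q i / t) = 1" using t by (simp flip: sum_divide_distrib)
    finally show ?thesis by simp
  qed
  \<comment> \<open>\<open>qh\<close> has finitely many values; the summand 1 is
    \<open>psi 0\<close>, attained outside the first \<open>N\<close> cells.\<close>
  define B where "B = 1 + (\<Sum>i<N. psi (q i / (t * Pm i)))"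
  have psi0: "0 \<le> psi (q i / (t * Pm i))" for i
    using q Pm t by (intro psi_nonneg) auto
  have "psi (qh z) \<le> B" for z
  proof (cases "idx z < N")
    case True
    then have "psi (qh z) \<le> (\<Sum>i<N. psi (q i / (t * Pm i)))"
      unfolding qh using psi0 by (intro member_le_sum) auto
    then show ?thesis by (simp add: B_def)
  next
    case False
    then show ?thesis using q(2)[of "idx z"] psi0 by (simp add: qh psi_def[of 0] B_def sum_nonneg)
  qed
  then have "Ent P qh \<le> (\<integral>\<^sup>+z. ennreal B \<partial>P)"
    unfolding Ent_def by (intro nn_integral_mono ennreal_leI)
  then have E: "Ent P qh < \<infinity>" by (simp add: P.emeasure_space_1 le_less_trans)
  have qhP: "qh \<in> borel_measurable P" by measurable
  obtain R :: "nat \<Rightarrow> 'b \<Rightarrow> ennreal" and c :: "nat \<Rightarrow> ennreal"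
    where R: "\<And>i. R i \<in> borel_measurable borel"
    and Rs: "\<And>u. u \<in> borel_measurable borel \<Longrightarrow> (\<Sum>i. \<integral>\<^sup>+w. R i w * u w \<partial>P) = (\<integral>\<^sup>+w. u w \<partial>P)"
    and Rm: "\<And>i. (\<integral>\<^sup>+w. R i w \<partial>P) = (\<integral>\<^sup>+z. ennreal (qh z) * indicator {i} (idx z) \<partial>P)"
    and c: "(\<Sum>i. c i) \<le> ennreal (2 * C) * Ent P qh + ennreal \<eta>"
    and Rc: "\<And>z. (\<integral>\<^sup>+w. R (idx z) w * sqdist z w \<partial>P) \<le>
      ennreal (1 + \<eta>) * c (idx z) +
      ennreal ((1 + 1 / \<eta>) * \<delta>\<^sup>2) * (\<integral>\<^sup>+y. ennreal (qh y) * indicator {idx z} (idx y) \<partial>P)"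
    using T2_cell_densities[OF T2 P \<open>0 \<le> C\<close> idx small qhP qh0 qh1 E \<open>0 < \<eta>\<close>] by blast
  have tq: "ennreal t * ennreal (q i / t) = ennreal (q i)" for i
    using t q(1)[of i] by (simp flip: ennreal_mult)
  show ?thesis
  proof (rule that[of R c])
    fix z
    have "ennreal t * (\<integral>\<^sup>+w. R (idx z) w * sqdist z w \<partial>P) \<le>
      ennreal t * (ennreal (1 + \<eta>) * c (idx z) +
      ennreal ((1 + 1 / \<eta>) * \<delta>\<^sup>2) * ennreal (q (idx z) / t))"
      using Rc[of z] unfolding cell by (intro mult_left_mono) auto
    also have "\<dots> = ennreal (1 + \<eta>) * (ennreal t * c (idx z)) +
      ennreal ((1 + 1 / \<eta>) * \<delta>\<^sup>2) * (ennreal t * ennreal (q (idx z) / t))"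
      by (simp only: distrib_left mult_ac)
    finally show "ennreal t * (\<integral>\<^sup>+w. R (idx z) w * sqdist z w \<partial>P) \<le>
      ennreal (1 + \<eta>) * (ennreal t * c (idx z)) +
      ennreal ((1 + 1 / \<eta>) * \<delta>\<^sup>2) * ennreal (q (idx z))" by (simp only: tq)
  qed (use R Rs Rm c cell qh1 tq in auto)
qed

text \<open>For each parameter \<open>a\<close> the kernel is that of \<open>cell_kernel\<close>,
  with the masses of \<open>p a\<close> rounded. Only the masses themselves and the key depend on
  \<open>a\<close>, and the densities \<open>R\<close> are chosen once per key, which gives joint
  measurability. The second coordinate has the law \<open>P\<close> for every single
  \<open>a\<close>, not just on average; this is the independence from the past that the induction
  over time requires.\<close>

lemma one_step_kernel:
  fixes P :: "'b::euclidean_space measure" and p :: "'a \<Rightarrow> 'b \<Rightarrow> real"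
  assumes T2: "T2 C dist P" and P: "prob_space P" "sets P = sets borel" and C: "0 \<le> C"
    and \<alpha>: "prob_space \<alpha>" and p: "case_prod p \<in> borel_measurable (\<alpha> \<Otimes>\<^sub>M borel)"
    and p0: "\<And>a z. 0 \<le> p a z" and p1: "\<And>a. a \<in> space \<alpha> \<Longrightarrow> (\<integral>\<^sup>+z. ennreal (p a z) \<partial>P) = 1"
    and H: "(\<integral>\<^sup>+a. Ent P (p a) \<partial>\<alpha>) < \<infinity>" and "0 < \<epsilon>"
  obtains D :: "'a \<Rightarrow> 'b \<Rightarrow> 'b \<Rightarrow> ennreal"
  where "(\<lambda>(a, z, w). D a z w) \<in> borel_measurable (\<alpha> \<Otimes>\<^sub>M (borel \<Otimes>\<^sub>M borel))"
    and "\<And>a z. a \<in> space \<alpha> \<Longrightarrow> (\<integral>\<^sup>+w. D a z w \<partial>P) = 1"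
    and "\<And>a u. a \<in> space \<alpha> \<Longrightarrow> u \<in> borel_measurable borel \<Longrightarrow>
      (\<integral>\<^sup>+z. ennreal (p a z) * (\<integral>\<^sup>+w. D a z w * u w \<partial>P) \<partial>P) = (\<integral>\<^sup>+w. u w \<partial>P)"
    and "(\<integral>\<^sup>+a. \<integral>\<^sup>+z. ennreal (p a z) * (\<integral>\<^sup>+w. D a z w * sqdist z w \<partial>P) \<partial>P \<partial>\<alpha>) \<le>
      ennreal (2 * C) * (\<integral>\<^sup>+a. Ent P (p a) \<partial>\<alpha>) + ennreal \<epsilon>"
proof -
  interpret PP: prob_space P by fact
  interpret \<alpha>: prob_space \<alpha> by fact
  note P(2)[measurable_cong]
  have p2 [measurable]: "(\<lambda>x. p (fst x) (snd x)) \<in> borel_measurable (\<alpha> \<Otimes>\<^sub>M borel)"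
    using p by (simp add: case_prod_beta')
  have pa [measurable]: "p a \<in> borel_measurable borel" if "a \<in> space \<alpha>" for a
    using measurable_compose[OF measurable_Pair1'[OF that, of borel] p2] by simp
  obtain Hr where Hr: "(\<integral>\<^sup>+a. Ent P (p a) \<partial>\<alpha>) = ennreal Hr" "0 \<le> Hr"
    using H by (cases "\<integral>\<^sup>+a. Ent P (p a) \<partial>\<alpha>") auto
  define m2 where "m2 = (\<integral>\<^sup>+w. sqnorm w \<partial>P)"
  have m2: "m2 < \<infinity>" unfolding m2_def by (rule T2_second_moment[OF T2 P C])
  \<comment> \<open>A bound for the mean squared distance of \<open>z\<close> to an independent
    point with law \<open>P\<close>, as in \<open>D_cost\<close>.\<close>
  define S where "S = (\<lambda>z::'b. 2 * sqnorm z + 2 * m2)"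
  have [measurable]: "S \<in> borel_measurable borel" unfolding S_def by measurable
  have S_fin: "(\<integral>\<^sup>+a. \<integral>\<^sup>+z. ennreal (p a z) * S z \<partial>P \<partial>\<alpha>) < \<infinity>"
  proof -
    have "(\<integral>\<^sup>+a. \<integral>\<^sup>+z. ennreal (p a z) * S z \<partial>P \<partial>\<alpha>) =
      (\<integral>\<^sup>+a. 2 * (\<integral>\<^sup>+z. ennreal (p a z) * sqnorm z \<partial>P) + 2 * m2 \<partial>\<alpha>)"
    proof (intro nn_integral_cong)
      fix a assume a: "a \<in> space \<alpha>"
      note [measurable] = pa[OF a]
      have "(\<integral>\<^sup>+z. ennreal (p a z) * S z \<partial>P) =
          (\<integral>\<^sup>+z. 2 * (ennreal (p a z) * sqnorm z) + ennreal (p a z) * (2 * m2) \<partial>P)"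
        unfolding S_def by (intro nn_integral_cong) (simp add: distrib_left mult_ac)
      also have "\<dots> = 2 * (\<integral>\<^sup>+z. ennreal (p a z) * sqnorm z \<partial>P) + 2 * m2"
        by (simp add: nn_integral_add nn_integral_cmult nn_integral_multc p1[OF a])
      finally show "(\<integral>\<^sup>+z. ennreal (p a z) * S z \<partial>P) =
        2 * (\<integral>\<^sup>+z. ennreal (p a z) * sqnorm z \<partial>P) + 2 * m2" .
    qed
    also have "\<dots> = 2 * (\<integral>\<^sup>+a. \<integral>\<^sup>+z. ennreal (p a z) * sqnorm z \<partial>P \<partial>\<alpha>) + 2 * m2"
      by (simp add: nn_integral_add nn_integral_cmult \<alpha>.emeasure_space_1)
    also have "\<dots> < \<infinity>"
      using second_moment_mixture[OF T2 P C \<alpha> _ p0 p1 H] m2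
      by (auto simp: ennreal_mult_less_top measurable_cong_sets[OF sets_pair_measure_cong[OF refl P(2)] refl] p)
    finally show ?thesis .
  qed
  then obtain Sr where Sr: "(\<integral>\<^sup>+a. \<integral>\<^sup>+z. ennreal (p a z) * S z \<partial>P \<partial>\<alpha>) = ennreal Sr" "0 \<le> Sr"
    by (cases "\<integral>\<^sup>+a. \<integral>\<^sup>+z. ennreal (p a z) * S z \<partial>P \<partial>\<alpha>") auto
  \<comment> \<open>The sum of the coefficients of \<eta> in the total error computed at the end,
    after bounding \<eta> squared by \<eta>.\<close>
  define B where "B = 2 * C * Hr + 8 * C + 2 + 8 + Sr + 1"
  define \<eta> where "\<eta> = min 1 (\<epsilon> / B)"
  have "0 \<le> 2 * C * Hr" using C Hr by simp
  then have B: "0 < B" unfolding B_def using C Sr by linarith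
  have \<eta>: "0 < \<eta>" "\<eta> \<le> 1" "\<eta> * B \<le> \<epsilon>"
    using B \<open>0 < \<epsilon>\<close> by (auto simp: \<eta>_def min_def field_simps)
  obtain idx :: "'b \<Rightarrow> nat" where idx [measurable]: "idx \<in> measurable borel (count_space UNIV)"
    and small: "\<And>y z. idx y = idx z \<Longrightarrow> dist y z \<le> 2 * \<eta>"
    using small_cells_exist[OF \<eta>(1)] by blast
  have indN [measurable]: "(\<lambda>z. indicator {N..} (idx z) :: ennreal) \<in> borel_measurable borel" for N
    by (rule measurable_compose[OF idx]) simp
  obtain N where N1: "(\<integral>\<^sup>+z. indicator {N..} (idx z) \<partial>P) \<le> ennreal \<eta>"
    and N2: "(\<integral>\<^sup>+a. \<integral>\<^sup>+z. ennreal (p a z) * S z * indicator {N..} (idx z) \<partial>P \<partial>\<alpha>) \<le> ennreal \<eta>"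
  proof -
    have "(\<lambda>N. \<integral>\<^sup>+z. 1 * indicator {N..} (idx z) \<partial>P) \<longlonglongrightarrow> 0"
      by (rule tail_cells_tendsto_0) (simp_all add: PP.emeasure_space_1)
    then have 1: "eventually (\<lambda>N. (\<integral>\<^sup>+z. 1 * indicator {N..} (idx z) \<partial>P) < ennreal \<eta>) sequentially"
      by (rule order_tendstoD) (simp add: \<eta>)
    have "(\<lambda>N. \<integral>\<^sup>+x. (ennreal (p (fst x) (snd x)) * S (snd x)) * indicator {N..} (idx (snd x)) \<partial>(\<alpha> \<Otimes>\<^sub>M P)) \<longlonglongrightarrow> 0"
    proof (rule tail_cells_tendsto_0)
      show "(\<integral>\<^sup>+x. ennreal (p (fst x) (snd x)) * S (snd x) \<partial>(\<alpha> \<Otimes>\<^sub>M P)) < \<infinity>"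
        using S_fin PP.nn_integral_fst[of "\<lambda>x. ennreal (p (fst x) (snd x)) * S (snd x)" \<alpha>] by simp
    qed simp_all
    then have 2: "eventually (\<lambda>N. (\<integral>\<^sup>+x. (ennreal (p (fst x) (snd x)) * S (snd x)) * indicator {N..} (idx (snd x)) \<partial>(\<alpha> \<Otimes>\<^sub>M P)) < ennreal \<eta>) sequentially"
      by (rule order_tendstoD) (simp add: \<eta>)
    obtain N where "(\<integral>\<^sup>+z. 1 * indicator {N..} (idx z) \<partial>P) < ennreal \<eta>"
      "(\<integral>\<^sup>+x. (ennreal (p (fst x) (snd x)) * S (snd x)) * indicator {N..} (idx (snd x)) \<partial>(\<alpha> \<Otimes>\<^sub>M P)) < ennreal \<eta>"
      using eventually_conj[OF 1 2] by (auto simp: eventually_sequentially)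
    moreover have "(\<integral>\<^sup>+x. (ennreal (p (fst x) (snd x)) * S (snd x)) * indicator {N..} (idx (snd x)) \<partial>(\<alpha> \<Otimes>\<^sub>M P)) =
       (\<integral>\<^sup>+a. \<integral>\<^sup>+z. ennreal (p a z) * S z * indicator {N..} (idx z) \<partial>P \<partial>\<alpha>)"
      using PP.nn_integral_fst[of "\<lambda>x. (ennreal (p (fst x) (snd x)) * S (snd x)) * indicator {N..} (idx (snd x))" \<alpha>] by simp
    ultimately show ?thesis using that[of N] by simp
  qed
  define pm where "pm a i = enn2real (\<integral>\<^sup>+z. ennreal (p a z) * indicator {i} (idx z) \<partial>P)" for a i
  define Pm where "Pm i = enn2real (\<integral>\<^sup>+z. indicator {i} (idx z) \<partial>P)" for i
  have pm: "(\<integral>\<^sup>+z. ennreal (p a z) * indicator {i} (idx z) \<partial>P) = ennreal (pm a i)" if "a \<in> space \<alpha>" for a i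
  proof -
    have "(\<integral>\<^sup>+z. ennreal (p a z) * indicator {i} (idx z) \<partial>P) \<le> (\<integral>\<^sup>+z. ennreal (p a z) \<partial>P)"
      by (intro nn_integral_mono) (auto simp: indicator_def)
    then show ?thesis using p1[OF that] by (simp add: pm_def le_less_trans)
  qed
  have Pm: "(\<integral>\<^sup>+z. indicator {i} (idx z) \<partial>P) = ennreal (Pm i)" "0 \<le> Pm i" for i
  proof -
    have "(\<integral>\<^sup>+z. indicator {i} (idx z) \<partial>P) \<le> (\<integral>\<^sup>+z. 1 \<partial>P)"
      by (intro nn_integral_mono) (auto simp: indicator_def)
    then show "(\<integral>\<^sup>+z. indicator {i} (idx z) \<partial>P) = ennreal (Pm i)"
      by (simp add: Pm_def PP.emeasure_space_1 le_less_trans)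
  qed (simp add: Pm_def)
  have pm0: "0 \<le> pm a i" for a i by (simp add: pm_def)
  have [measurable]: "(\<lambda>a. pm a i) \<in> borel_measurable \<alpha>" for i
    unfolding pm_def by measurable
  have pm_Pm: "pm a i = 0" if "a \<in> space \<alpha>" "Pm i = 0" for a i
    using nn_integral_null_cell[of idx P i "p a"] Pm(1)[of i] pm[OF that(1), of i] pm0[of a i] that
    by (simp add: ennreal_eq_0_iff)
  define q where "q = key_val \<eta>"
  define t where "t l = (\<Sum>i<N. q l i)" for l
  define qh where "qh l z = q l (idx z) / (t l * Pm (idx z))" for l z
  \<comment> \<open>The requirements of \<open>cell_densities_of_key\<close>. They hold for every
    key that comes from some \<open>a\<close> and retains positive mass; other keys get arbitrary
    measurable densities.\<close>
  define valid where "valid l \<longleftrightarrow> 0 < t l \<and> (\<forall>i\<ge>N. q l i = 0) \<and> (\<forall>i. Pm i = 0 \<longrightarrow> q l i = 0)" for l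
  define good where "good l R c \<longleftrightarrow> (\<forall>i. R i \<in> borel_measurable borel) \<and> (valid l \<longrightarrow>
      (\<forall>u. u \<in> borel_measurable borel \<longrightarrow> (\<Sum>i. \<integral>\<^sup>+w. R i w * u w \<partial>P) = (\<integral>\<^sup>+w. u w \<partial>P)) \<and>
      (\<forall>i. ennreal (t l) * (\<integral>\<^sup>+w. R i w \<partial>P) = ennreal (q l i)) \<and>
      (\<integral>\<^sup>+z. ennreal (qh l z) \<partial>P) = 1 \<and>
      (\<Sum>i. c i) \<le> ennreal (2 * C) * Ent P (qh l) + ennreal \<eta> \<and>
      (\<forall>z. ennreal (t l) * (\<integral>\<^sup>+w. R (idx z) w * sqdist z w \<partial>P) \<le>
        ennreal (1 + \<eta>) * (ennreal (t l) * c (idx z)) +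
        ennreal ((1 + 1 / \<eta>) * (2 * \<eta>)\<^sup>2) * ennreal (q l (idx z))))" for l and R :: "nat \<Rightarrow> 'b \<Rightarrow> ennreal" and c :: "nat \<Rightarrow> ennreal"
  have "\<exists>R c. good l R c" for l
  proof (cases "valid l")
    case True
    have q0: "0 \<le> q l i" for i by (simp add: q_def key_val_nonneg)
    show ?thesis
      unfolding good_def
      by (rule cell_densities_of_key[OF T2 P C idx small \<eta>(1) Pm q0, where N = N and t = "t l" and qh = "qh l"])
         (use True in \<open>auto simp: valid_def t_def qh_def fun_eq_iff\<close>)
  next
    case False
    then show ?thesis unfolding good_def by (intro exI[of _ "\<lambda>_ _. 0"]) auto
  qed
  \<comment> \<open>This choice is made over the countable set of keys, so the dependence of
    \<open>R\<close> on the key raises no question of measurability.\<close>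
  then obtain R :: "int option list \<Rightarrow> nat \<Rightarrow> 'b \<Rightarrow> ennreal" and c :: "int option list \<Rightarrow> nat \<Rightarrow> ennreal"
    where good: "\<And>l. good l (R l) (c l)"
    by metis
  have R [measurable]: "R l i \<in> borel_measurable borel" for l i
    using good[of l] unfolding good_def by blast
  have Rs: "valid l \<Longrightarrow> u \<in> borel_measurable borel \<Longrightarrow> (\<Sum>i. \<integral>\<^sup>+w. R l i w * u w \<partial>P) = (\<integral>\<^sup>+w. u w \<partial>P)" for l u
    using good[of l] unfolding good_def by blast
  have Rm: "valid l \<Longrightarrow> ennreal (t l) * (\<integral>\<^sup>+w. R l i w \<partial>P) = ennreal (q l i)" for l i
    using good[of l] unfolding good_def by blast
  have qh1: "valid l \<Longrightarrow> (\<integral>\<^sup>+z. ennreal (qh l z) \<partial>P) = 1" for l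
    using good[of l] unfolding good_def by blast
  have c: "valid l \<Longrightarrow> (\<Sum>i. c l i) \<le> ennreal (2 * C) * Ent P (qh l) + ennreal \<eta>" for l
    using good[of l] unfolding good_def by blast
  have Rc: "valid l \<Longrightarrow> ennreal (t l) * (\<integral>\<^sup>+w. R l (idx z) w * sqdist z w \<partial>P) \<le>
        ennreal (1 + \<eta>) * (ennreal (t l) * c l (idx z)) +
        ennreal ((1 + 1 / \<eta>) * (2 * \<eta>)\<^sup>2) * ennreal (q l (idx z))" for l z
    using good[of l] unfolding good_def by blast
  define key where "key a = key_of \<eta> N (pm a)" for a
  have key [measurable]: "key \<in> measurable \<alpha> (count_space UNIV)"
    unfolding key_def[abs_def] by (rule measurable_key_of) simp
  have q_key: "q (key a) i = (if i < N then round_down \<eta> (pm a i) else 0)" for a i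
    by (simp add: q_def key_def key_val_key_of)
  have q_le: "0 \<le> q (key a) i" "q (key a) i \<le> pm a i" for a i
    using round_down[OF \<eta>(1) pm0[of a i]] pm0[of a i] by (auto simp: q_key)
  have q_low: "exp (- \<eta>) * pm a i \<le> q (key a) i" if "i < N" for a i
    using round_down(3)[OF \<eta>(1) pm0[of a i]] that by (simp add: q_key)
  have t0: "0 \<le> t (key a)" for a unfolding t_def by (intro sum_nonneg q_le)
  have q_sum: "(\<Sum>i. ennreal (q (key a) i)) = ennreal (t (key a))" for a
  proof -
    have "(\<Sum>i. ennreal (q (key a) i)) = (\<Sum>i<N. ennreal (q (key a) i))"
      by (intro suminf_finite) (auto simp: q_key)
    then show ?thesis using q_le by (simp add: t_def)
  qed
  have valid: "valid (key a)" if "a \<in> space \<alpha>" "t (key a) \<noteq> 0" for a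
  proof -
    have "q (key a) i = 0" if "Pm i = 0" for i
      using pm_Pm[OF \<open>a \<in> space \<alpha>\<close> that] q_le[of a i] by simp
    then show ?thesis unfolding valid_def using that t0[of a] by (auto simp: q_key)
  qed
  \<comment> \<open>If rounding and truncation leave no mass, the conditions on \<open>R\<close> in
    \<open>cell_kernel\<close> hold trivially and the whole mass is coupled independently.\<close>
  have q_t0: "q (key a) i = 0" if "t (key a) = 0" for a i
  proof (cases "i < N")
    case True
    have "q (key a) i \<le> t (key a)" unfolding t_def using True q_le by (intro member_le_sum) auto
    then show ?thesis using that q_le[of a i] by simp
  qed (simp add: q_key)
  have ck: "cell_kernel P idx (p a) (pm a) (q (key a)) (t (key a)) (R (key a))" if a: "a \<in> space \<alpha>" for a
  proof unfold_locales
    fix u :: "'b \<Rightarrow> ennreal" assume u: "u \<in> borel_measurable borel"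
    show "ennreal (t (key a)) * (\<Sum>i. \<integral>\<^sup>+w. R (key a) i w * u w \<partial>P) = ennreal (t (key a)) * (\<integral>\<^sup>+w. u w \<partial>P)"
      using Rs[OF valid[OF a] u] by (cases "t (key a) = 0") auto
  next
    fix i
    show "ennreal (t (key a)) * (\<integral>\<^sup>+w. R (key a) i w \<partial>P) = ennreal (q (key a) i)"
      using Rm[OF valid[OF a]] q_t0[of a i] by (cases "t (key a) = 0") auto
  qed (rule P(2) idx pa[OF a] p0 p1[OF a] pm[OF a] pm0 q_le t0 q_sum R)+
  define D where "D a z w = ennreal (t (key a) / pm a (idx z)) * R (key a) (idx z) w +
    ennreal (1 - q (key a) (idx z) / pm a (idx z))" for a z w
  have D_eq: "cell_kernel.D idx (pm a) (q (key a)) (t (key a)) (R (key a)) = D a" if "a \<in> space \<alpha>" for a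
    by (intro ext) (simp add: D_def cell_kernel.D_def[OF ck[OF that]])
  let ?cost = "\<lambda>a. \<integral>\<^sup>+z. ennreal (p a z) * (\<integral>\<^sup>+w. D a z w * sqdist z w \<partial>P) \<partial>P"
  let ?tail = "\<lambda>a. \<integral>\<^sup>+z. ennreal (p a z) * S z * indicator {N..} (idx z) \<partial>P"
  let ?mom = "\<lambda>a. \<integral>\<^sup>+z. ennreal (p a z) * S z \<partial>P"
  \<comment> \<open>Within the bracket one \<eta> stems from rounding, one from the discarded cells,
    and the one outside it from the near-optimal coupling. \<open>1 + \<eta>\<close> is the Young
    weight, and \<open>8 * \<eta>\<close> bounds the diameter term \<open>(1 + 1 / \<eta>) * (2 *
    \<eta>)^2 = 4 * \<eta>^2 + 4 * \<eta>\<close>.\<close>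
  define bd where "bd h = ennreal (1 + \<eta>) * (ennreal (2 * C) * (h + ennreal \<eta> + ennreal \<eta>) + ennreal \<eta>) + ennreal (8 * \<eta>)" for h
  have cost: "?cost a \<le>
    bd (Ent P (p a)) +
    (\<integral>\<^sup>+z. ennreal \<eta> * (ennreal (p a z) * S z) + ennreal (p a z) * S z * indicator {N..} (idx z) \<partial>P)"
    if a: "a \<in> space \<alpha>" for a
  proof -
    interpret ck: cell_kernel P idx "p a" "pm a" "q (key a)" "t (key a)" "R (key a)" by (rule ck[OF a])
    have t_le: "t (key a) \<le> 1"
    proof -
      have "(\<Sum>i. ennreal (q (key a) i)) \<le> (\<Sum>i. ennreal (pm a i))"
        by (intro suminf_le ennreal_leI q_le) auto
      also have "\<dots> = 1"
        unfolding pm[OF a, symmetric] using p1[OF a] pa[OF a] by (subst nn_integral_cells[symmetric]) auto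
      finally show ?thesis unfolding q_sum by simp
    qed
    let ?c = "\<lambda>i. ennreal (1 + \<eta>) * (ennreal (t (key a)) * c (key a) i) +
        ennreal ((1 + 1 / \<eta>) * (2 * \<eta>)\<^sup>2) * ennreal (q (key a) i)"
    have "?cost a \<le>
      (\<Sum>i. ?c i) + (\<integral>\<^sup>+z. ennreal (p a z) * ((ennreal \<eta> + indicator {N..} (idx z)) * S z) \<partial>P)"
      unfolding D_eq[OF a, symmetric] S_def m2_def
    proof (rule ck.D_cost)
      show "ennreal (t (key a)) * (\<integral>\<^sup>+w. R (key a) (idx z) w * sqdist z w \<partial>P) \<le> ?c (idx z)" for z
        using Rc[OF valid[OF a]] by (cases "t (key a) = 0") auto
    qed (use q_low \<eta> in auto)
    also have "(\<Sum>i. ?c i) \<le> bd (Ent P (p a))"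
    proof -
      have "(\<Sum>i. ?c i) = ennreal (1 + \<eta>) * (ennreal (t (key a)) * (\<Sum>i. c (key a) i)) +
        ennreal ((1 + 1 / \<eta>) * (2 * \<eta>)\<^sup>2) * ennreal (t (key a))"
        unfolding q_sum[symmetric] by (subst suminf_add[symmetric]) auto
      also have "\<dots> \<le> bd (Ent P (p a))"
        unfolding bd_def
      proof (intro add_mono mult_left_mono)
        show "ennreal (t (key a)) * (\<Sum>i. c (key a) i) \<le> ennreal (2 * C) * (Ent P (p a) + ennreal \<eta> + ennreal \<eta>) + ennreal \<eta>"
        proof (cases "t (key a) = 0")
          case False
          note v = valid[OF a False]
          have "ennreal (t (key a)) * (\<Sum>i. c (key a) i) \<le>
            ennreal (t (key a)) * (ennreal (2 * C) * Ent P (qh (key a)) + ennreal \<eta>)"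
            by (intro mult_left_mono c[OF v]) auto
          also have "\<dots> = ennreal (2 * C) * (ennreal (t (key a)) * Ent P (qh (key a))) + ennreal (t (key a)) * ennreal \<eta>"
            by (simp add: distrib_left mult_ac)
          also have "\<dots> \<le> ennreal (2 * C) * (Ent P (p a) + ennreal \<eta> + ennreal \<eta>) + 1 * ennreal \<eta>"
          proof (intro add_mono mult_left_mono mult_right_mono)
            have "ennreal (t (key a)) * Ent P (qh (key a)) \<le>
              Ent P (p a) + ennreal \<eta> + (\<integral>\<^sup>+z. indicator {N..} (idx z) \<partial>P)"
              by (rule Ent_cells[OF P idx pa[OF a] p0 p1[OF a] pm[OF a] pm0 Pm q_le q_low _ _ _ _ qh1[OF v]])
                 (use \<eta> t0[of a] False in \<open>auto simp: q_key qh_def[abs_def]\<close>)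
            then show "ennreal (t (key a)) * Ent P (qh (key a)) \<le> Ent P (p a) + ennreal \<eta> + ennreal \<eta>"
              using N1 by (rule order_trans[OF _ add_left_mono])
          qed (use t_le in auto)
          finally show ?thesis by simp
        qed simp
        have e: "(1 + 1 / \<eta>) * (2 * \<eta>)\<^sup>2 = 4 * \<eta> * \<eta> + 4 * \<eta>"
          using \<eta> by (simp add: power2_eq_square field_simps)
        have "ennreal (4 * \<eta> * \<eta> + 4 * \<eta>) * ennreal (t (key a)) \<le> ennreal (8 * \<eta>) * 1"
          using t_le \<eta> mult_left_mono[of \<eta> 1 \<eta>] by (intro mult_mono ennreal_leI) auto
        then show "ennreal ((1 + 1 / \<eta>) * (2 * \<eta>)\<^sup>2) * ennreal (t (key a)) \<le> ennreal (8 * \<eta>)"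
          by (simp only: e mult_1_right)
      qed auto
      finally show ?thesis .
    qed
    also have "(\<integral>\<^sup>+z. ennreal (p a z) * ((ennreal \<eta> + indicator {N..} (idx z)) * S z) \<partial>P) =
      (\<integral>\<^sup>+z. ennreal \<eta> * (ennreal (p a z) * S z) + ennreal (p a z) * S z * indicator {N..} (idx z) \<partial>P)"
      by (intro nn_integral_cong) (simp only: distrib_left distrib_right mult_ac)
    finally show ?thesis by (simp add: add_right_mono)
  qed
  show ?thesis
  proof (rule that[of D])
    show "(\<lambda>(a, z, w). D a z w) \<in> borel_measurable (\<alpha> \<Otimes>\<^sub>M (borel \<Otimes>\<^sub>M borel))"
    proof -
      let ?M = "\<alpha> \<Otimes>\<^sub>M ((borel :: 'b measure) \<Otimes>\<^sub>M (borel :: 'b measure))"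
      have k [measurable]: "(\<lambda>x. key (fst x)) \<in> measurable ?M (count_space UNIV)" by measurable
      have i [measurable]: "(\<lambda>x. idx (fst (snd x))) \<in> measurable ?M (count_space UNIV)" by measurable
      have [measurable]: "(\<lambda>x. t (key (fst x))) \<in> borel_measurable ?M"
        by (rule measurable_compose[OF k]) simp
      have [measurable]: "(\<lambda>x. pm (fst x) (idx (fst (snd x)))) \<in> borel_measurable ?M"
        by (rule measurable_compose_countable[OF _ i]) measurable
      have [measurable]: "(\<lambda>x. q (key (fst x)) (idx (fst (snd x)))) \<in> borel_measurable ?M"
        by (rule measurable_compose_countable[OF _ i], rule measurable_compose[OF k]) simp
      have [measurable]: "(\<lambda>x. R (key (fst x)) (idx (fst (snd x))) (snd (snd x))) \<in> borel_measurable ?M"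
        by (rule measurable_compose_countable[OF _ i], rule measurable_compose_countable[OF _ k]) measurable
      show ?thesis unfolding D_def case_prod_beta' by measurable
    qed
    show "(\<integral>\<^sup>+w. D a z w \<partial>P) = 1" if a: "a \<in> space \<alpha>" for a z
      using cell_kernel.D_mass[OF ck[OF a], of z] by (simp add: D_eq[OF a])
    show "(\<integral>\<^sup>+z. ennreal (p a z) * (\<integral>\<^sup>+w. D a z w * u w \<partial>P) \<partial>P) = (\<integral>\<^sup>+w. u w \<partial>P)"
      if a: "a \<in> space \<alpha>" and "u \<in> borel_measurable borel" for a u
      using cell_kernel.D_marginal[OF ck[OF a] that(2)] by (simp add: D_eq[OF a])
    let ?H = "\<integral>\<^sup>+a. Ent P (p a) \<partial>\<alpha>"
    have [measurable]: "(\<lambda>a. Ent P (p a)) \<in> borel_measurable \<alpha>"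
      unfolding Ent_def by measurable
    have "(\<integral>\<^sup>+a. ?cost a \<partial>\<alpha>) \<le>
      (\<integral>\<^sup>+a. bd (Ent P (p a)) +
      (ennreal \<eta> * ?mom a + ?tail a) \<partial>\<alpha>)"
    proof (intro nn_integral_mono)
      fix a assume a: "a \<in> space \<alpha>"
      note [measurable] = pa[OF a]
      show "?cost a \<le>
        bd (Ent P (p a)) +
        (ennreal \<eta> * ?mom a + ?tail a)"
        using cost[OF a] by (simp add: nn_integral_add nn_integral_cmult)
    qed
    also have "\<dots> = bd ?H +
      (ennreal \<eta> * (\<integral>\<^sup>+a. ?mom a \<partial>\<alpha>) +
        (\<integral>\<^sup>+a. ?tail a \<partial>\<alpha>))"
      unfolding bd_def by (simp add: nn_integral_add nn_integral_cmult \<alpha>.emeasure_space_1)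
    also have "\<dots> \<le> bd ?H + (ennreal \<eta> * ennreal Sr + ennreal \<eta>)"
      unfolding Sr(1) by (intro add_left_mono N2)
    also have "\<dots> = ennreal ((1 + \<eta>) * (2 * C * (Hr + \<eta> + \<eta>) + \<eta>) + 8 * \<eta> + (\<eta> * Sr + \<eta>))"
      unfolding bd_def Hr(1) using \<eta> C Hr(2) Sr(2) by (simp flip: ennreal_mult ennreal_plus)
    also have "\<dots> \<le> ennreal (2 * C * Hr + \<epsilon>)"
    proof (rule ennreal_leI)
      have "\<eta> * (4 * C * \<eta> + \<eta>) \<le> 1 * (4 * C * \<eta> + \<eta>)"
        using \<eta> C by (intro mult_right_mono) auto
      then have "(1 + \<eta>) * (2 * C * (Hr + \<eta> + \<eta>) + \<eta>) + 8 * \<eta> + (\<eta> * Sr + \<eta>) \<le> 2 * C * Hr + \<eta> * B"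
        by (simp add: B_def algebra_simps)
      also have "\<dots> \<le> 2 * C * Hr + \<epsilon>" using \<eta> by simp
      finally show "(1 + \<eta>) * (2 * C * (Hr + \<eta> + \<eta>) + \<eta>) + 8 * \<eta> + (\<eta> * Sr + \<eta>) \<le> 2 * C * Hr + \<epsilon>" .
    qed
    also have "\<dots> = ennreal (2 * C) * ?H + ennreal \<epsilon>"
      using C Hr \<open>0 < \<epsilon>\<close> by (simp add: ennreal_mult)
    finally show "(\<integral>\<^sup>+a. ?cost a \<partial>\<alpha>) \<le>
      ennreal (2 * C) * ?H + ennreal \<epsilon>" .
  qed
qed

subsection \<open>Product noise\<close>

lemma measurable_uncurry2:
  assumes "(\<lambda>(a, z). K a z) \<in> measurable (A \<Otimes>\<^sub>M B) M"
    and "f \<in> measurable N A" "g \<in> measurable N B"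
  shows "(\<lambda>x. K (f x) (g x)) \<in> measurable N M"
  using measurable_compose[OF measurable_Pair[OF assms(2,3)] assms(1)] by simp

lemma measurable_uncurry3:
  assumes "(\<lambda>(a, z, w). K a z w) \<in> measurable (A \<Otimes>\<^sub>M (B \<Otimes>\<^sub>M D)) M"
    and "f \<in> measurable N A" "g \<in> measurable N B" "h \<in> measurable N D"
  shows "(\<lambda>x. K (f x) (g x) (h x)) \<in> measurable N M"
  using measurable_compose[OF measurable_Pair[OF assms(2) measurable_Pair[OF assms(3,4)]] assms(1)] by simp

locale noise = prob_space P for P :: "'b::euclidean_space measure" +
  assumes sets_P [measurable_cong]: "sets P = sets borel"
begin

definition Pn :: "nat \<Rightarrow> (nat \<Rightarrow> 'b) measure" where
  "Pn n = PiM {1..n} (\<lambda>_. P)"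

lemma sets_Pn [measurable_cong]: "sets (Pn n) = sets (PiM {1..n} (\<lambda>_. borel))"
  unfolding Pn_def by (intro sets_PiM_cong) (simp_all add: sets_P)

lemma space_Pn: "space (Pn n) = extensional {1..n}"
  using sets_eq_imp_space_eq[OF sets_P] by (auto simp: Pn_def space_PiM PiE_def Pi_def)

lemma prob_space_Pn: "prob_space (Pn n)"
  unfolding Pn_def by (intro prob_space_PiM prob_space_axioms)

lemma nn_integral_Pn_0: "(\<integral>\<^sup>+w. f w \<partial>Pn 0) = f (\<lambda>_. undefined)"
proof -
  interpret product_prob_space "\<lambda>_::nat. P" "{}" ..
  show ?thesis unfolding Pn_def by (simp add: PiM_empty nn_integral_count_space_finite)
qed

lemma nn_integral_Pn_Suc:
  assumes "f \<in> borel_measurable (Pn (Suc n))"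
  shows "(\<integral>\<^sup>+w. f w \<partial>Pn (Suc n)) = (\<integral>\<^sup>+w. \<integral>\<^sup>+z. f (w(Suc n := z)) \<partial>P \<partial>Pn n)"
proof -
  interpret product_sigma_finite "\<lambda>_::nat. P" ..
  show ?thesis
    using product_nn_integral_insert[of "{1..n}" "Suc n" f] assms
    by (simp add: Pn_def atLeastAtMostSuc_conv)
qed

lemma measurable_Pn_upd [measurable (raw)]:
  assumes "f \<in> measurable N (Pn n)" "g \<in> measurable N borel"
  shows "(\<lambda>x. (f x)(Suc n := g x)) \<in> measurable N (Pn (Suc n))"
  using assms unfolding Pn_def
  by (intro measurable_fun_upd[where J = "{1..n}"]) (auto simp: measurable_cong_sets[OF refl sets_P])

lemma measurable_Pn_restrict [measurable (raw)]:
  assumes "f \<in> measurable N (Pn (Suc n))"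
  shows "(\<lambda>x. restrict (f x) {1..n}) \<in> measurable N (Pn n)"
  using measurable_compose[OF assms, of "\<lambda>f. restrict f {1..n}" "Pn n"]
  by (simp add: Pn_def measurable_restrict_subset)

lemma measurable_Pn_component:
  assumes "f \<in> measurable N (Pn n)" "k \<in> {1..n}"
  shows "(\<lambda>x. f x k) \<in> measurable N borel"
proof -
  have "(\<lambda>x. x k) \<in> measurable (Pn n) P"
    unfolding Pn_def using assms(2) by (rule measurable_component_singleton)
  from measurable_compose[OF assms(1) this] show ?thesis
    by (simp add: measurable_cong_sets[OF refl sets_P])
qed

lemma restrict_Pn_upd: "w \<in> space (Pn n) \<Longrightarrow> restrict (w(Suc n := z)) {1..n} = w"
  by (auto simp: space_Pn extensional_def restrict_def fun_eq_iff)

lemma upd_in_space_Pn: "w \<in> space (Pn n) \<Longrightarrow> w(Suc n := z) \<in> space (Pn (Suc n))"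
  by (auto simp: space_Pn extensional_def)

lemma measurable_Pn_section:
  assumes G: "G \<in> borel_measurable (Pn (Suc n))" and "w \<in> space (Pn n)"
  shows "(\<lambda>z. G (w(Suc n := z))) \<in> borel_measurable borel"
  by (rule measurable_compose[OF measurable_Pn_upd[OF measurable_const[OF assms(2)] measurable_ident_sets[OF refl]] G])

text \<open>A coupling of the tilted law, with density \<open>G\<close>, and \<open>Pn n\<close>,
  disintegrated along the tilted coordinate: \<open>D w\<close> is the density of the conditional
  law of the untilted noise given \<open>w\<close>. Normalisation is required at every
  \<open>w\<close>, so that \<open>D\<close> can be composed with later kernels without exceptional
  sets.\<close>

definition kernel_plan :: "nat \<Rightarrow> ((nat \<Rightarrow> 'b) \<Rightarrow> real) \<Rightarrow> ((nat \<Rightarrow> 'b) \<Rightarrow> (nat \<Rightarrow> 'b) \<Rightarrow> ennreal) \<Rightarrow> bool" where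
  "kernel_plan n G D \<longleftrightarrow> (\<lambda>(w, w'). D w w') \<in> borel_measurable (Pn n \<Otimes>\<^sub>M Pn n) \<and>
    (\<forall>w \<in> space (Pn n). (\<integral>\<^sup>+w'. D w w' \<partial>Pn n) = 1) \<and>
    (\<forall>u \<in> borel_measurable (Pn n).
      (\<integral>\<^sup>+w. ennreal (G w) * (\<integral>\<^sup>+w'. D w w' * u w' \<partial>Pn n) \<partial>Pn n) = (\<integral>\<^sup>+w. u w \<partial>Pn n))"

definition plan_cost :: "nat \<Rightarrow> ((nat \<Rightarrow> 'b) \<Rightarrow> real) \<Rightarrow> ((nat \<Rightarrow> 'b) \<Rightarrow> (nat \<Rightarrow> 'b) \<Rightarrow> ennreal) \<Rightarrow>
    ((nat \<Rightarrow> 'b) \<Rightarrow> (nat \<Rightarrow> 'b) \<Rightarrow> ennreal) \<Rightarrow> ennreal" where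
  "plan_cost n G D c = (\<integral>\<^sup>+w. ennreal (G w) * (\<integral>\<^sup>+w'. D w w' * c w w' \<partial>Pn n) \<partial>Pn n)"

text \<open>\<open>g\<close> is the marginal density of the first \<open>n\<close> coordinates and
  \<open>p w\<close> the conditional density of the last one. The entropy identity is
  \<open>psi_mult\<close> integrated over the last coordinate. The exceptional null set does not
  depend on \<open>h\<close>, because later the test functions vary with \<open>w\<close>.\<close>

lemma disintegrate_last:
  fixes G :: "(nat \<Rightarrow> 'b) \<Rightarrow> real"
  assumes G [measurable]: "G \<in> borel_measurable (Pn (Suc n))" and G0: "\<And>w. 0 \<le> G w"
    and G1: "(\<integral>\<^sup>+w. ennreal (G w) \<partial>Pn (Suc n)) = 1"
  obtains g :: "(nat \<Rightarrow> 'b) \<Rightarrow> real" and p :: "(nat \<Rightarrow> 'b) \<Rightarrow> 'b \<Rightarrow> real"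
  where "g \<in> borel_measurable (Pn n)" "\<And>w. 0 \<le> g w" "(\<integral>\<^sup>+w. ennreal (g w) \<partial>Pn n) = 1"
    and "case_prod p \<in> borel_measurable (Pn n \<Otimes>\<^sub>M borel)" "\<And>w z. 0 \<le> p w z"
    and "\<And>w. w \<in> space (Pn n) \<Longrightarrow> (\<integral>\<^sup>+z. ennreal (p w z) \<partial>P) = 1"
    and "AE w in Pn n. \<forall>h \<in> borel_measurable borel. (\<integral>\<^sup>+z. ennreal (G (w(Suc n := z))) * h z \<partial>P) =
      ennreal (g w) * (\<integral>\<^sup>+z. ennreal (p w z) * h z \<partial>P)"
    and "Ent (Pn (Suc n)) G = Ent (Pn n) g + (\<integral>\<^sup>+w. ennreal (g w) * Ent P (p w) \<partial>Pn n)"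
proof -
  define b where "b w = (\<integral>\<^sup>+z. ennreal (G (w(Suc n := z))) \<partial>P)" for w
  define g where "g w = enn2real (b w)" for w
  \<comment> \<open>The value 1 for \<open>g w = 0\<close> keeps \<open>p w\<close> a probability
    density everywhere. This case includes an infinite marginal integral, which
    \<open>enn2real\<close> sends to 0.\<close>
  define p where "p w z = (if g w = 0 then 1 else G (w(Suc n := z)) / g w)" for w z
  have G2 [measurable]: "(\<lambda>x. G ((fst x)(Suc n := snd x))) \<in> borel_measurable (Pn n \<Otimes>\<^sub>M borel)"
    by (rule measurable_compose[OF _ G]) measurable
  have [measurable]: "b \<in> borel_measurable (Pn n)"
    unfolding b_def[abs_def] by measurable
  have g [measurable]: "g \<in> borel_measurable (Pn n)"
    unfolding g_def[abs_def] by measurable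
  have p2 [measurable]: "(\<lambda>x. p (fst x) (snd x)) \<in> borel_measurable (Pn n \<Otimes>\<^sub>M borel)"
    unfolding p_def by measurable
  have g0: "0 \<le> g w" for w by (simp add: g_def)
  have p0: "0 \<le> p w z" for w z using G0 g0 by (simp add: p_def)
  have b1: "(\<integral>\<^sup>+w. b w \<partial>Pn n) = 1"
    using nn_integral_Pn_Suc[of "\<lambda>w. ennreal (G w)" n] G1 by (simp add: b_def)
  have "AE w in Pn n. b w \<noteq> \<infinity>"
    by (rule nn_integral_PInf_AE) (use b1 in auto)
  then have good: "AE w in Pn n. b w = ennreal (g w)"
    by eventually_elim (simp add: g_def less_top)
  have g1: "(\<integral>\<^sup>+w. ennreal (g w) \<partial>Pn n) = 1"
    unfolding b1[symmetric] using good by (intro nn_integral_cong_AE) (auto elim: eventually_mono)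
  have Gm: "(\<lambda>z. G (w(Suc n := z))) \<in> borel_measurable borel" if "w \<in> space (Pn n)" for w
    by (rule measurable_Pn_section[OF G that])
  have pm: "p w \<in> borel_measurable borel" if "w \<in> space (Pn n)" for w
  proof -
    note [measurable] = Gm[OF that]
    show ?thesis unfolding p_def[abs_def] by measurable
  qed
  have p1: "(\<integral>\<^sup>+z. ennreal (p w z) \<partial>P) = 1" if w: "w \<in> space (Pn n)" for w
  proof (cases "g w = 0")
    case True
    then show ?thesis by (simp add: p_def emeasure_space_1)
  next
    case False
    then have pos: "0 < g w" using g0[of w] by simp
    then have b: "b w = ennreal (g w)" by (simp add: g_def enn2real_positive_iff)
    have m: "(\<lambda>z. ennreal (G (w(Suc n := z)))) \<in> borel_measurable P"
      using measurable_compose[OF Gm[OF w] measurable_ennreal] by (simp add: measurable_cong_sets[OF sets_P refl])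
    have "(\<integral>\<^sup>+z. ennreal (p w z) \<partial>P) = (\<integral>\<^sup>+z. ennreal (1 / g w) * ennreal (G (w(Suc n := z))) \<partial>P)"
      using pos G0 by (intro nn_integral_cong) (simp add: p_def flip: ennreal_mult)
    also have "\<dots> = ennreal (1 / g w) * b w"
      by (simp add: nn_integral_cmult[OF m] b_def)
    also have "\<dots> = 1" unfolding b using pos by (simp flip: ennreal_mult)
    finally show ?thesis .
  qed
  have G_gp: "AE z in P. G (w(Suc n := z)) = g w * p w z"
    if w: "w \<in> space (Pn n)" and b: "b w = ennreal (g w)" for w
  proof (cases "g w = 0")
    case True
    have m: "(\<lambda>z. ennreal (G (w(Suc n := z)))) \<in> borel_measurable P"
      using measurable_compose[OF Gm[OF w] measurable_ennreal] by (simp add: measurable_cong_sets[OF sets_P refl])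
    have "(\<integral>\<^sup>+z. ennreal (G (w(Suc n := z))) \<partial>P) = 0" using b True by (simp add: b_def)
    then have "AE z in P. ennreal (G (w(Suc n := z))) = 0"
      using nn_integral_0_iff_AE[OF m] by simp
    then show ?thesis
    proof eventually_elim
      case (elim z)
      then show ?case using G0[of "w(Suc n := z)"] True by (simp add: ennreal_eq_0_iff)
    qed
  qed (simp add: p_def)
  have Gh: "(\<integral>\<^sup>+z. ennreal (G (w(Suc n := z))) * h z \<partial>P) = ennreal (g w) * (\<integral>\<^sup>+z. ennreal (p w z) * h z \<partial>P)"
    if w: "w \<in> space (Pn n)" and b: "b w = ennreal (g w)" and "h \<in> borel_measurable borel" for w h
  proof -
    have "(\<integral>\<^sup>+z. ennreal (G (w(Suc n := z))) * h z \<partial>P) = (\<integral>\<^sup>+z. ennreal (g w) * (ennreal (p w z) * h z) \<partial>P)"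
      using G_gp[OF w b] g0 p0
      by (intro nn_integral_cong_AE) (auto elim!: eventually_mono simp: ennreal_mult mult.assoc)
    moreover have "(\<lambda>z. ennreal (p w z) * h z) \<in> borel_measurable P"
      using that(3) pm[OF w] by simp
    ultimately show ?thesis by (simp add: nn_integral_cmult)
  qed
  \<comment> \<open>Since \<open>p w\<close> has mass 1, the correction terms of
    \<open>psi_mult\<close> add up to \<open>g w + 1\<close> on both sides, and this finite amount
    is cancelled.\<close>
  have Ent_section: "(\<integral>\<^sup>+z. ennreal (psi (G (w(Suc n := z)))) \<partial>P) = ennreal (psi (g w)) + ennreal (g w) * Ent P (p w)"
    if w: "w \<in> space (Pn n)" and b: "b w = ennreal (g w)" for w
  proof -
    note [measurable] = pm[OF w]
    have "(\<integral>\<^sup>+z. ennreal (psi (G (w(Suc n := z)))) \<partial>P) = (\<integral>\<^sup>+z. ennreal (psi (g w * p w z)) \<partial>P)"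
      using G_gp[OF w b] by (intro nn_integral_cong_AE) (auto elim!: eventually_mono)
    moreover have "(\<integral>\<^sup>+z. ennreal (psi (g w * p w z)) \<partial>P) + (ennreal (g w) + 1) =
      (\<integral>\<^sup>+z. ennreal (psi (g w * p w z)) + ennreal (g w) + ennreal (p w z) \<partial>P)"
      by (simp add: nn_integral_add p1[OF w] emeasure_space_1 ac_simps)
    moreover have "\<dots> = (\<integral>\<^sup>+z. ennreal (p w z) * ennreal (psi (g w)) + ennreal (g w) * ennreal (psi (p w z)) + 1 +
        ennreal (g w) * ennreal (p w z) \<partial>P)"
    proof (intro nn_integral_cong)
      fix z
      have "ennreal (psi (g w * p w z) + g w + p w z) =
          ennreal (p w z * psi (g w) + g w * psi (p w z) + 1 + g w * p w z)"
        using psi_mult[OF g0[of w] p0[of w z]] by simp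
      then show "ennreal (psi (g w * p w z)) + ennreal (g w) + ennreal (p w z) =
        ennreal (p w z) * ennreal (psi (g w)) + ennreal (g w) * ennreal (psi (p w z)) + 1 +
        ennreal (g w) * ennreal (p w z)"
        using g0[of w] p0[of w z] psi_nonneg[of "g w"] psi_nonneg[of "p w z"] psi_nonneg[of "g w * p w z"]
        by (simp add: ennreal_mult)
    qed
    moreover have "\<dots> = (ennreal (psi (g w)) + ennreal (g w) * Ent P (p w)) + (ennreal (g w) + 1)"
      by (simp add: nn_integral_add nn_integral_cmult nn_integral_multc p1[OF w] emeasure_space_1 Ent_def ac_simps)
    ultimately have "(ennreal (g w) + 1) + (\<integral>\<^sup>+z. ennreal (psi (G (w(Suc n := z)))) \<partial>P) =
      (ennreal (g w) + 1) + (ennreal (psi (g w)) + ennreal (g w) * Ent P (p w))"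
      by (simp only: add.commute)
    then show ?thesis by (subst (asm) ennreal_add_left_cancel) simp
  qed
  have [measurable]: "(\<lambda>w. Ent P (p w)) \<in> borel_measurable (Pn n)"
    unfolding Ent_def by measurable
  have "Ent (Pn (Suc n)) G = (\<integral>\<^sup>+w. \<integral>\<^sup>+z. ennreal (psi (G (w(Suc n := z)))) \<partial>P \<partial>Pn n)"
    unfolding Ent_def by (rule nn_integral_Pn_Suc) measurable
  also have "\<dots> = (\<integral>\<^sup>+w. ennreal (psi (g w)) + ennreal (g w) * Ent P (p w) \<partial>Pn n)"
    using good AE_space[of "Pn n"] by (intro nn_integral_cong_AE) (auto elim!: eventually_elim2 simp: Ent_section)
  also have "\<dots> = Ent (Pn n) g + (\<integral>\<^sup>+w. ennreal (g w) * Ent P (p w) \<partial>Pn n)"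
    by (simp add: nn_integral_add Ent_def[of "Pn n"])
  finally have E: "Ent (Pn (Suc n)) G = Ent (Pn n) g + (\<integral>\<^sup>+w. ennreal (g w) * Ent P (p w) \<partial>Pn n)" .
  show ?thesis
  proof (rule that[of g p])
    show "AE w in Pn n. \<forall>h \<in> borel_measurable borel. (\<integral>\<^sup>+z. ennreal (G (w(Suc n := z))) * h z \<partial>P) =
      ennreal (g w) * (\<integral>\<^sup>+z. ennreal (p w z) * h z \<partial>P)"
      using good AE_space[of "Pn n"] by eventually_elim (simp add: Gh)
    show "case_prod p \<in> borel_measurable (Pn n \<Otimes>\<^sub>M borel)" using p2 by (simp add: case_prod_beta')
  qed (use g g0 g1 p0 p1 E in auto)
qed

text \<open>\<open>c n\<close> is the cost up to time \<open>n\<close>, and \<open>e n\<close> the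
  part of the next cost that depends on the untilted innovation only. Given both pasts this
  innovation has law \<open>P\<close>, so \<open>e_int\<close> brings \<open>e n\<close> back to
  \<open>c n\<close>, and each step adds only \<open>L\<close> times a one-step transport cost. That
  cost is \<open>2 * C\<close> times a conditional entropy, and the chain rule adds the conditional
  entropies up.\<close>

lemma chain_transport:
  fixes c :: "nat \<Rightarrow> (nat \<Rightarrow> 'b) \<Rightarrow> (nat \<Rightarrow> 'b) \<Rightarrow> ennreal"
    and e :: "nat \<Rightarrow> (nat \<Rightarrow> 'b) \<Rightarrow> (nat \<Rightarrow> 'b) \<Rightarrow> 'b \<Rightarrow> ennreal"
    and G :: "(nat \<Rightarrow> 'b) \<Rightarrow> real"
  assumes T2: "T2 C dist P" and C: "0 \<le> C" and L: "0 \<le> L"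
    and c_meas: "\<And>n. (\<lambda>(w, w'). c n w w') \<in> borel_measurable (Pn n \<Otimes>\<^sub>M Pn n)"
    and e_meas: "\<And>n. (\<lambda>(w, w', z). e n w w' z) \<in> borel_measurable (Pn n \<Otimes>\<^sub>M (Pn n \<Otimes>\<^sub>M borel))"
    and c0: "\<And>w w'. c 0 w w' = 0"
    and cSuc: "\<And>n w w' z z'. w \<in> space (Pn n) \<Longrightarrow> w' \<in> space (Pn n) \<Longrightarrow>
      c (Suc n) (w(Suc n := z)) (w'(Suc n := z')) \<le> e n w w' z' + ennreal L * sqdist z z'"
    and e_int: "\<And>n w w'. w \<in> space (Pn n) \<Longrightarrow> w' \<in> space (Pn n) \<Longrightarrow> (\<integral>\<^sup>+z. e n w w' z \<partial>P) \<le> c n w w'"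
  shows "G \<in> borel_measurable (Pn n) \<Longrightarrow> (\<And>w. 0 \<le> G w) \<Longrightarrow> (\<integral>\<^sup>+w. ennreal (G w) \<partial>Pn n) = 1 \<Longrightarrow>
    Ent (Pn n) G < \<infinity> \<Longrightarrow> 0 < \<epsilon> \<Longrightarrow>
    \<exists>D. kernel_plan n G D \<and>
      plan_cost n G D (c n) \<le> ennreal L * (ennreal (2 * C) * Ent (Pn n) G) + ennreal \<epsilon>"
proof (induction n arbitrary: G \<epsilon>)
  case 0
  show ?case
    using 0(3) unfolding kernel_plan_def plan_cost_def by (intro exI[of _ "\<lambda>_ _. 1"]) (simp add: nn_integral_Pn_0 c0 prob_space.emeasure_space_1[OF prob_space_Pn])
next
  case (Suc n)
  note G = Suc.prems(1) and G0 = Suc.prems(2) and G1 = Suc.prems(3) and GE = Suc.prems(4)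
  obtain g p where g [measurable]: "g \<in> borel_measurable (Pn n)" and g0: "\<And>w. 0 \<le> g w"
    and g1: "(\<integral>\<^sup>+w. ennreal (g w) \<partial>Pn n) = 1"
    and p_meas: "case_prod p \<in> borel_measurable (Pn n \<Otimes>\<^sub>M borel)" and p0: "\<And>w z. 0 \<le> p w z"
    and p1: "\<And>w. w \<in> space (Pn n) \<Longrightarrow> (\<integral>\<^sup>+z. ennreal (p w z) \<partial>P) = 1"
    and good: "AE w in Pn n. \<forall>h \<in> borel_measurable borel. (\<integral>\<^sup>+z. ennreal (G (w(Suc n := z))) * h z \<partial>P) =
      ennreal (g w) * (\<integral>\<^sup>+z. ennreal (p w z) * h z \<partial>P)"
    and E: "Ent (Pn (Suc n)) G = Ent (Pn n) g + (\<integral>\<^sup>+w. ennreal (g w) * Ent P (p w) \<partial>Pn n)"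
    by (rule disintegrate_last[OF G G0 G1]) blast
  have gE: "Ent (Pn n) g < \<infinity>" and pE: "(\<integral>\<^sup>+w. ennreal (g w) * Ent P (p w) \<partial>Pn n) < \<infinity>"
    using GE unfolding E by auto
  have "0 < \<epsilon> / 2" using Suc.prems(5) by simp
  from Suc.IH[OF g g0 g1 gE this] obtain D
    where D: "(\<lambda>(w, w'). D w w') \<in> borel_measurable (Pn n \<Otimes>\<^sub>M Pn n)"
      and D1: "\<And>w. w \<in> space (Pn n) \<Longrightarrow> (\<integral>\<^sup>+w'. D w w' \<partial>Pn n) = 1"
      and Du: "\<And>u. u \<in> borel_measurable (Pn n) \<Longrightarrow>
        (\<integral>\<^sup>+w. ennreal (g w) * (\<integral>\<^sup>+w'. D w w' * u w' \<partial>Pn n) \<partial>Pn n) = (\<integral>\<^sup>+w. u w \<partial>Pn n)"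
      and Dc: "plan_cost n g D (c n) \<le> ennreal L * (ennreal (2 * C) * Ent (Pn n) g) + ennreal (\<epsilon> / 2)"
    unfolding kernel_plan_def by blast
  \<comment> \<open>The law of the tilted past; the one-step kernel uses this past as its
    parameter.\<close>
  define \<alpha> where "\<alpha> = density (Pn n) g"
  have \<alpha>: "prob_space \<alpha>"
    unfolding \<alpha>_def by (intro prob_spaceI) (simp add: emeasure_density g1)
  have sets_\<alpha> [measurable_cong]: "sets \<alpha> = sets (Pn n)" by (simp add: \<alpha>_def)
  have space_\<alpha>: "space \<alpha> = space (Pn n)" by (simp add: \<alpha>_def)
  have p_meas': "(\<lambda>(w, z). p w z) \<in> borel_measurable (Pn n \<Otimes>\<^sub>M borel)" using p_meas by simp
  note [measurable (raw)] = measurable_uncurry2[OF D] measurable_uncurry2[OF c_meas]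
    measurable_uncurry3[OF e_meas] measurable_uncurry2[OF p_meas']
  have \<alpha>_int: "(\<integral>\<^sup>+a. h a \<partial>\<alpha>) = (\<integral>\<^sup>+w. ennreal (g w) * h w \<partial>Pn n)" if "h \<in> borel_measurable (Pn n)" for h
    unfolding \<alpha>_def using that by (intro nn_integral_density) auto
  have Ent_meas: "(\<lambda>w. Ent P (p w)) \<in> borel_measurable (Pn n)"
    unfolding Ent_def by measurable
  have p\<alpha>: "case_prod p \<in> borel_measurable (\<alpha> \<Otimes>\<^sub>M borel)"
    using p_meas by (simp add: measurable_cong_sets[OF sets_pair_measure_cong[OF sets_\<alpha> refl] refl])
  have p\<alpha>1: "\<And>a. a \<in> space \<alpha> \<Longrightarrow> (\<integral>\<^sup>+z. ennreal (p a z) \<partial>P) = 1" using p1 by (simp add: space_\<alpha>)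
  have p\<alpha>E: "(\<integral>\<^sup>+a. Ent P (p a) \<partial>\<alpha>) < \<infinity>" using pE by (simp add: \<alpha>_int[OF Ent_meas])
  \<comment> \<open>Multiplied by \<open>L\<close> this error is at most half of \<epsilon>; the
    summand 1 covers \<open>L = 0\<close>.\<close>
  have \<epsilon>': "0 < \<epsilon> / (2 * (L + 1))" using Suc.prems(5) L by simp
  obtain K where K': "(\<lambda>(a, z, w). K a z w) \<in> borel_measurable (\<alpha> \<Otimes>\<^sub>M (borel \<Otimes>\<^sub>M borel))"
    and K1: "\<And>a z. a \<in> space \<alpha> \<Longrightarrow> (\<integral>\<^sup>+w. K a z w \<partial>P) = 1"
    and Ku: "\<And>a u. a \<in> space \<alpha> \<Longrightarrow> u \<in> borel_measurable borel \<Longrightarrow>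
      (\<integral>\<^sup>+z. ennreal (p a z) * (\<integral>\<^sup>+w. K a z w * u w \<partial>P) \<partial>P) = (\<integral>\<^sup>+w. u w \<partial>P)"
    and Kc: "(\<integral>\<^sup>+a. \<integral>\<^sup>+z. ennreal (p a z) * (\<integral>\<^sup>+w. K a z w * sqdist z w \<partial>P) \<partial>P \<partial>\<alpha>) \<le>
      ennreal (2 * C) * (\<integral>\<^sup>+a. Ent P (p a) \<partial>\<alpha>) + ennreal (\<epsilon> / (2 * (L + 1)))"
    using one_step_kernel[OF T2 prob_space_axioms sets_P C \<alpha> p\<alpha> p0 p\<alpha>1 p\<alpha>E \<epsilon>'] by blast
  have K: "(\<lambda>(a, z, w). K a z w) \<in> borel_measurable (Pn n \<Otimes>\<^sub>M (borel \<Otimes>\<^sub>M borel))"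
    using K' by (simp add: measurable_cong_sets[OF sets_pair_measure_cong[OF sets_\<alpha> refl] refl])
  note [measurable (raw)] = measurable_uncurry3[OF K]
  let ?I = "{1..n}"
  \<comment> \<open>\<open>K\<close> is evaluated at the tilted past only. Given that past, the new
    pair of innovations is therefore independent of the untilted past.\<close>
  define D' where "D' v v' = D (restrict v ?I) (restrict v' ?I) * K (restrict v ?I) (v (Suc n)) (v' (Suc n))" for v v'
  have D'_meas: "(\<lambda>(w, w'). D' w w') \<in> borel_measurable (Pn (Suc n) \<Otimes>\<^sub>M Pn (Suc n))"
  proof -
    have [measurable]: "(\<lambda>x. fst x (Suc n)) \<in> measurable (Pn (Suc n) \<Otimes>\<^sub>M Pn (Suc n)) borel"
      "(\<lambda>x. snd x (Suc n)) \<in> measurable (Pn (Suc n) \<Otimes>\<^sub>M Pn (Suc n)) borel"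
      by (rule measurable_Pn_component[of _ _ "Suc n"]; simp)+
    show ?thesis unfolding D'_def case_prod_beta' by measurable
  qed
  note [measurable (raw)] = measurable_uncurry2[OF D'_meas]
  have D'_upd: "D' (w(Suc n := z)) (w'(Suc n := z')) = D w w' * K w z z'"
    if "w \<in> space (Pn n)" "w' \<in> space (Pn n)" for w w' z z'
    using that by (simp only: D'_def restrict_Pn_upd fun_upd_same)
  define J where "J w h = (\<integral>\<^sup>+z. ennreal (p w z) * (\<integral>\<^sup>+z'. K w z z' * h z z' \<partial>P) \<partial>P)" for w h
  interpret PnP: prob_space "Pn n" by (rule prob_space_Pn)
  interpret PS: prob_space "Pn (Suc n)" by (rule prob_space_Pn)
  interpret pair_sigma_finite "Pn n" P ..
  \<comment> \<open>Since \<open>K\<close> does not involve \<open>w'\<close>, Fubini lets the new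
    pair be integrated, through \<open>J\<close>, while both pasts are fixed.\<close>
  have swap: "(\<integral>\<^sup>+v. ennreal (G v) * (\<integral>\<^sup>+v'. D' v v' * F v v' \<partial>Pn (Suc n)) \<partial>Pn (Suc n)) =
    (\<integral>\<^sup>+w. ennreal (g w) * (\<integral>\<^sup>+w'. D w w' * J w (\<lambda>z z'. F (w(Suc n := z)) (w'(Suc n := z'))) \<partial>Pn n) \<partial>Pn n)"
    if F: "(\<lambda>(w, w'). F w w') \<in> borel_measurable (Pn (Suc n) \<Otimes>\<^sub>M Pn (Suc n))" for F
  proof -
    note [measurable (raw)] = measurable_uncurry2[OF F]
    note G[measurable]
    have "(\<integral>\<^sup>+v. ennreal (G v) * (\<integral>\<^sup>+v'. D' v v' * F v v' \<partial>Pn (Suc n)) \<partial>Pn (Suc n)) =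
      (\<integral>\<^sup>+w. \<integral>\<^sup>+z. ennreal (G (w(Suc n := z))) *
        (\<integral>\<^sup>+v'. D' (w(Suc n := z)) v' * F (w(Suc n := z)) v' \<partial>Pn (Suc n)) \<partial>P \<partial>Pn n)"
      by (rule nn_integral_Pn_Suc) measurable
    also have "\<dots> = (\<integral>\<^sup>+w. ennreal (g w) * (\<integral>\<^sup>+w'. D w w' * J w (\<lambda>z z'. F (w(Suc n := z)) (w'(Suc n := z'))) \<partial>Pn n) \<partial>Pn n)"
      using good AE_space[of "Pn n"]
    proof (intro nn_integral_cong_AE, eventually_elim)
      fix w
      assume gw: "\<forall>h \<in> borel_measurable borel. (\<integral>\<^sup>+z. ennreal (G (w(Suc n := z))) * h z \<partial>P) =
          ennreal (g w) * (\<integral>\<^sup>+z. ennreal (p w z) * h z \<partial>P)"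
        and w [simp]: "w \<in> space (Pn n)"
      have cw [measurable (raw)]: "(\<lambda>x. w) \<in> measurable N (Pn n)" for N :: "'c measure"
        by simp
      let ?DF = "\<lambda>z w' z'. D' (w(Suc n := z)) (w'(Suc n := z')) * F (w(Suc n := z)) (w'(Suc n := z'))"
      define Y where "Y z w' = (\<integral>\<^sup>+z'. K w z z' * F (w(Suc n := z)) (w'(Suc n := z')) \<partial>P)" for z w'
      have Y: "(\<lambda>(z, w'). Y z w') \<in> borel_measurable (borel \<Otimes>\<^sub>M Pn n)"
        unfolding Y_def case_prod_beta' by measurable
      note [measurable (raw)] = measurable_uncurry2[OF Y]
      define X where "X z = (\<integral>\<^sup>+v'. D' (w(Suc n := z)) v' * F (w(Suc n := z)) v' \<partial>Pn (Suc n))" for z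
      have X_meas: "X \<in> borel_measurable borel"
        unfolding X_def[abs_def] by measurable
      have X: "X z = (\<integral>\<^sup>+w'. D w w' * Y z w' \<partial>Pn n)" for z
      proof -
        have zw [simp]: "w(Suc n := z) \<in> space (Pn (Suc n))" by (rule upd_in_space_Pn[OF w])
        have "X z = (\<integral>\<^sup>+w'. \<integral>\<^sup>+z'. ?DF z w' z' \<partial>P \<partial>Pn n)"
          unfolding X_def by (rule nn_integral_Pn_Suc) measurable
        also have "\<dots> = (\<integral>\<^sup>+w'. D w w' * Y z w' \<partial>Pn n)"
        proof (intro nn_integral_cong)
          fix w' assume w' [simp]: "w' \<in> space (Pn n)"
          have "(\<integral>\<^sup>+z'. ?DF z w' z' \<partial>P) =
            (\<integral>\<^sup>+z'. D w w' * (K w z z' * F (w(Suc n := z)) (w'(Suc n := z'))) \<partial>P)"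
            by (simp only: D'_upd[OF w w'] mult.assoc)
          also have "\<dots> = D w w' * Y z w'"
            unfolding Y_def by (rule nn_integral_cmult) measurable
          finally show "(\<integral>\<^sup>+z'. ?DF z w' z' \<partial>P) = D w w' * Y z w'" .
        qed
        finally show ?thesis .
      qed
      have "(\<integral>\<^sup>+z. ennreal (G (w(Suc n := z))) * X z \<partial>P) = ennreal (g w) * (\<integral>\<^sup>+z. ennreal (p w z) * X z \<partial>P)"
        using gw X_meas by blast
      also have "(\<integral>\<^sup>+z. ennreal (p w z) * X z \<partial>P) = (\<integral>\<^sup>+z. \<integral>\<^sup>+w'. D w w' * (ennreal (p w z) * Y z w') \<partial>Pn n \<partial>P)"
      proof (intro nn_integral_cong)
        fix z
        have "ennreal (p w z) * X z = (\<integral>\<^sup>+w'. ennreal (p w z) * (D w w' * Y z w') \<partial>Pn n)"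
          unfolding X by (rule nn_integral_cmult[symmetric]) measurable
        then show "ennreal (p w z) * X z = (\<integral>\<^sup>+w'. D w w' * (ennreal (p w z) * Y z w') \<partial>Pn n)"
          by (simp only: mult_ac)
      qed
      also have "\<dots> = (\<integral>\<^sup>+w'. \<integral>\<^sup>+z. D w w' * (ennreal (p w z) * Y z w') \<partial>P \<partial>Pn n)"
        by (rule Fubini') measurable
      also have "\<dots> = (\<integral>\<^sup>+w'. D w w' * (\<integral>\<^sup>+z. ennreal (p w z) * Y z w' \<partial>P) \<partial>Pn n)"
        by (intro nn_integral_cong nn_integral_cmult) measurable
      finally show "(\<integral>\<^sup>+z. ennreal (G (w(Suc n := z))) *
        (\<integral>\<^sup>+v'. D' (w(Suc n := z)) v' * F (w(Suc n := z)) v' \<partial>Pn (Suc n)) \<partial>P) =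
        ennreal (g w) * (\<integral>\<^sup>+w'. D w w' * J w (\<lambda>z z'. F (w(Suc n := z)) (w'(Suc n := z'))) \<partial>Pn n)"
        unfolding X_def Y_def J_def .
    qed
    finally show ?thesis .
  qed
  show ?case
    unfolding kernel_plan_def
  proof (intro exI[of _ D'] conjI ballI)
    show "(\<lambda>(w, w'). D' w w') \<in> borel_measurable (Pn (Suc n) \<Otimes>\<^sub>M Pn (Suc n))" by fact
  next
    fix v assume v [simp]: "v \<in> space (Pn (Suc n))"
    have r [simp]: "restrict v ?I \<in> space (Pn n)" by (simp add: space_Pn)
    have "(\<integral>\<^sup>+v'. D' v v' \<partial>Pn (Suc n)) = (\<integral>\<^sup>+w'. \<integral>\<^sup>+z'. D' v (w'(Suc n := z')) \<partial>P \<partial>Pn n)"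
      by (rule nn_integral_Pn_Suc) measurable
    also have "\<dots> = (\<integral>\<^sup>+w'. D (restrict v ?I) w' \<partial>Pn n)"
    proof (intro nn_integral_cong)
      fix w' assume w': "w' \<in> space (Pn n)"
      have "(\<integral>\<^sup>+z'. D' v (w'(Suc n := z')) \<partial>P) = (\<integral>\<^sup>+z'. D (restrict v ?I) w' * K (restrict v ?I) (v (Suc n)) z' \<partial>P)"
        by (simp only: D'_def restrict_Pn_upd[OF w'] fun_upd_same)
      also have "\<dots> = D (restrict v ?I) w' * (\<integral>\<^sup>+z'. K (restrict v ?I) (v (Suc n)) z' \<partial>P)"
        by (rule nn_integral_cmult) measurable
      also have "\<dots> = D (restrict v ?I) w'"
        by (simp only: K1[OF r[folded space_\<alpha>]] mult_1_right)
      finally show "(\<integral>\<^sup>+z'. D' v (w'(Suc n := z')) \<partial>P) = D (restrict v ?I) w'" .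
    qed
    also have "\<dots> = 1" by (rule D1[OF r])
    finally show "(\<integral>\<^sup>+v'. D' v v' \<partial>Pn (Suc n)) = 1" .
  next
    fix u :: "(nat \<Rightarrow> 'b) \<Rightarrow> ennreal" assume u [measurable]: "u \<in> borel_measurable (Pn (Suc n))"
    let ?u = "\<lambda>w'. \<integral>\<^sup>+z'. u (w'(Suc n := z')) \<partial>P"
    have um: "(\<lambda>w'. ?u w') \<in> borel_measurable (Pn n)" by measurable
    have "(\<integral>\<^sup>+v. ennreal (G v) * (\<integral>\<^sup>+v'. D' v v' * u v' \<partial>Pn (Suc n)) \<partial>Pn (Suc n)) =
      (\<integral>\<^sup>+w. ennreal (g w) * (\<integral>\<^sup>+w'. D w w' * J w (\<lambda>z z'. u (w'(Suc n := z'))) \<partial>Pn n) \<partial>Pn n)"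
      by (rule swap) measurable
    also have "\<dots> = (\<integral>\<^sup>+w. ennreal (g w) * (\<integral>\<^sup>+w'. D w w' * ?u w' \<partial>Pn n) \<partial>Pn n)"
    proof (rule nn_integral_cong)
      fix w assume w: "w \<in> space (Pn n)"
      have "J w (\<lambda>z z'. u (w'(Suc n := z'))) = ?u w'" if "w' \<in> space (Pn n)" for w'
        using w that unfolding J_def by (intro Ku measurable_Pn_section u) (simp add: space_\<alpha>)
      then have "(\<integral>\<^sup>+w'. D w w' * J w (\<lambda>z z'. u (w'(Suc n := z'))) \<partial>Pn n) =
        (\<integral>\<^sup>+w'. D w w' * ?u w' \<partial>Pn n)"
        by (auto intro: nn_integral_cong)
      then show "ennreal (g w) * (\<integral>\<^sup>+w'. D w w' * J w (\<lambda>z z'. u (w'(Suc n := z'))) \<partial>Pn n) =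
        ennreal (g w) * (\<integral>\<^sup>+w'. D w w' * ?u w' \<partial>Pn n)"
        by (rule arg_cong)
    qed
    also have "\<dots> = (\<integral>\<^sup>+w'. \<integral>\<^sup>+z'. u (w'(Suc n := z')) \<partial>P \<partial>Pn n)"
      by (rule Du[OF um])
    also have "\<dots> = (\<integral>\<^sup>+v. u v \<partial>Pn (Suc n))"
      by (rule nn_integral_Pn_Suc[OF u, symmetric])
    finally show "(\<integral>\<^sup>+v. ennreal (G v) * (\<integral>\<^sup>+v'. D' v v' * u v' \<partial>Pn (Suc n)) \<partial>Pn (Suc n)) =
      (\<integral>\<^sup>+v. u v \<partial>Pn (Suc n))" .
  next
    define Q where "Q w = J w (\<lambda>z z'. sqdist z z')" for w
    have Q [measurable]: "Q \<in> borel_measurable (Pn n)"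
      unfolding Q_def[abs_def] J_def by measurable
    let ?c = "\<lambda>w w'. J w (\<lambda>z z'. c (Suc n) (w(Suc n := z)) (w'(Suc n := z')))"
    let ?D = "\<lambda>w. \<integral>\<^sup>+w'. D w w' * c n w w' \<partial>Pn n"
    \<comment> \<open>\<open>e n\<close> sees only \<open>z'\<close>, whose conditional law is
      \<open>P\<close> by \<open>Ku\<close>, so \<open>e_int\<close> applies. The remaining part is
      the one-step cost \<open>Q w\<close>, which is free of \<open>w'\<close>.\<close>
    have inner: "?c w w' \<le> c n w w' + ennreal L * Q w"
      if w [simp]: "w \<in> space (Pn n)" and w' [simp]: "w' \<in> space (Pn n)" for w w'
    proof -
      define A where "A z = (\<integral>\<^sup>+z'. K w z z' * e n w w' z' \<partial>P)" for z
      define B where "B z = (\<integral>\<^sup>+z'. K w z z' * sqdist z z' \<partial>P)" for z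
      have [measurable]: "A \<in> borel_measurable borel" "B \<in> borel_measurable borel"
        unfolding A_def[abs_def] B_def[abs_def] by measurable
      have AB: "(\<integral>\<^sup>+z'. K w z z' * (e n w w' z' + ennreal L * sqdist z z') \<partial>P) = A z + ennreal L * B z" for z
      proof -
        have "(\<integral>\<^sup>+z'. K w z z' * (e n w w' z' + ennreal L * sqdist z z') \<partial>P) =
          (\<integral>\<^sup>+z'. K w z z' * e n w w' z' + ennreal L * (K w z z' * sqdist z z') \<partial>P)"
          by (simp only: distrib_left mult_ac)
        also have "\<dots> = A z + (\<integral>\<^sup>+z'. ennreal L * (K w z z' * sqdist z z') \<partial>P)"
          unfolding A_def by (rule nn_integral_add) measurable
        also have "(\<integral>\<^sup>+z'. ennreal L * (K w z z' * sqdist z z') \<partial>P) = ennreal L * B z"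
          unfolding B_def by (rule nn_integral_cmult) measurable
        finally show ?thesis .
      qed
      have "?c w w' \<le> (\<integral>\<^sup>+z. ennreal (p w z) * (A z + ennreal L * B z) \<partial>P)"
        unfolding J_def AB[symmetric] by (intro nn_integral_mono mult_left_mono cSuc[OF w w']) simp_all
      also have "\<dots> = (\<integral>\<^sup>+z. ennreal (p w z) * A z + ennreal L * (ennreal (p w z) * B z) \<partial>P)"
        by (simp only: distrib_left mult_ac)
      also have "\<dots> = (\<integral>\<^sup>+z. ennreal (p w z) * A z \<partial>P) + (\<integral>\<^sup>+z. ennreal L * (ennreal (p w z) * B z) \<partial>P)"
        by (rule nn_integral_add) measurable
      also have "(\<integral>\<^sup>+z. ennreal (p w z) * A z \<partial>P) = (\<integral>\<^sup>+z'. e n w w' z' \<partial>P)"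
        unfolding A_def
      proof (rule Ku)
        show "e n w w' \<in> borel_measurable borel" by measurable
      qed (simp add: space_\<alpha>)
      also have "(\<integral>\<^sup>+z. ennreal L * (ennreal (p w z) * B z) \<partial>P) = ennreal L * Q w"
        unfolding Q_def J_def B_def by (rule nn_integral_cmult) measurable
      finally show ?thesis
        using e_int[OF w w'] by (rule order_trans[OF _ add_right_mono])
    qed
    have "plan_cost (Suc n) G D' (c (Suc n)) = (\<integral>\<^sup>+w. ennreal (g w) * (\<integral>\<^sup>+w'. D w w' * ?c w w' \<partial>Pn n) \<partial>Pn n)"
      unfolding plan_cost_def by (rule swap[OF c_meas])
    also have "\<dots> \<le> (\<integral>\<^sup>+w. ennreal (g w) * ?D w + ennreal L * (ennreal (g w) * Q w) \<partial>Pn n)"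
    proof (intro nn_integral_mono)
      fix w assume w [simp]: "w \<in> space (Pn n)"
      have "(\<integral>\<^sup>+w'. D w w' * ?c w w' \<partial>Pn n) \<le> (\<integral>\<^sup>+w'. D w w' * c n w w' + D w w' * (ennreal L * Q w) \<partial>Pn n)"
        unfolding distrib_left[symmetric] by (intro nn_integral_mono mult_left_mono inner[OF w]) auto
      also have "\<dots> = ?D w + (\<integral>\<^sup>+w'. D w w' * (ennreal L * Q w) \<partial>Pn n)"
        by (rule nn_integral_add) measurable
      also have "(\<integral>\<^sup>+w'. D w w' * (ennreal L * Q w) \<partial>Pn n) = (\<integral>\<^sup>+w'. D w w' \<partial>Pn n) * (ennreal L * Q w)"
        by (rule nn_integral_multc) measurable
      finally have "(\<integral>\<^sup>+w'. D w w' * ?c w w' \<partial>Pn n) \<le> ?D w + ennreal L * Q w"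
        by (simp only: D1[OF w] mult_1_left)
      from mult_left_mono[OF this zero_le, of "ennreal (g w)"]
      show "ennreal (g w) * (\<integral>\<^sup>+w'. D w w' * ?c w w' \<partial>Pn n) \<le> ennreal (g w) * ?D w + ennreal L * (ennreal (g w) * Q w)"
        by (simp only: distrib_left mult_ac)
    qed
    also have "\<dots> = (\<integral>\<^sup>+w. ennreal (g w) * ?D w \<partial>Pn n) + (\<integral>\<^sup>+w. ennreal L * (ennreal (g w) * Q w) \<partial>Pn n)"
      by (rule nn_integral_add) measurable
    also have "\<dots> = plan_cost n g D (c n) + ennreal L * (\<integral>\<^sup>+a. Q a \<partial>\<alpha>)"
      unfolding plan_cost_def \<alpha>_int[OF Q]
      by (intro arg_cong2[where f = plus] refl nn_integral_cmult) measurable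
    also have "\<dots> \<le> (ennreal L * (ennreal (2 * C) * Ent (Pn n) g) + ennreal (\<epsilon> / 2)) +
      ennreal L * (ennreal (2 * C) * (\<integral>\<^sup>+a. Ent P (p a) \<partial>\<alpha>) + ennreal (\<epsilon> / (2 * (L + 1))))"
      using Kc unfolding Q_def J_def by (intro add_mono Dc mult_left_mono) auto
    also have "\<dots> = ennreal L * (ennreal (2 * C) * Ent (Pn (Suc n)) G) + (ennreal (\<epsilon> / 2) + ennreal L * ennreal (\<epsilon> / (2 * (L + 1))))"
      unfolding E \<alpha>_int[OF Ent_meas] by (simp only: distrib_left ac_simps)
    also have "ennreal (\<epsilon> / 2) + ennreal L * ennreal (\<epsilon> / (2 * (L + 1))) \<le> ennreal \<epsilon>"
    proof -
      have "L * (\<epsilon> / (2 * (L + 1))) \<le> \<epsilon> / 2"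
        using L Suc.prems(5) by (simp add: field_simps)
      then have "ennreal (\<epsilon> / 2 + L * (\<epsilon> / (2 * (L + 1)))) \<le> ennreal \<epsilon>"
        by (intro ennreal_leI) linarith
      moreover have "ennreal (\<epsilon> / 2 + L * (\<epsilon> / (2 * (L + 1)))) =
        ennreal (\<epsilon> / 2) + ennreal L * ennreal (\<epsilon> / (2 * (L + 1)))"
        using L Suc.prems(5) \<epsilon>' by (subst ennreal_plus) (simp_all only: ennreal_mult less_imp_le, simp_all)
      ultimately show ?thesis by (simp only:)
    qed
    finally show "plan_cost (Suc n) G D' (c (Suc n)) \<le> ennreal L * (ennreal (2 * C) * Ent (Pn (Suc n)) G) + ennreal \<epsilon>"
      by (simp add: add_left_mono)
  qed
qed

end

subsection \<open>The contractive chain\<close>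

lemma measurable_matrix_vector_mult [measurable (raw)]:
  fixes A :: "'a \<Rightarrow> real^'m^'d"
  assumes "A \<in> borel_measurable N" "v \<in> borel_measurable N"
  shows "(\<lambda>x. A x *v v x) \<in> borel_measurable N"
proof (rule borel_measurable_continuous_Pair[OF assms])
  show "continuous_on UNIV (\<lambda>x::(real^'m^'d) \<times> (real^'m). fst x *v snd x)"
    unfolding matrix_vector_mult_def by (intro continuous_intros)
qed

lemma measurable_chain:
  fixes f :: "real^'d \<Rightarrow> real^'d" and \<sigma> :: "real^'d \<Rightarrow> real^'m^'d"
  assumes [measurable]: "f \<in> borel_measurable borel" "\<sigma> \<in> borel_measurable borel"
    and "\<And>i. 1 \<le> i \<Longrightarrow> i \<le> k \<Longrightarrow> W i \<in> borel_measurable N"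
  shows "chain f \<sigma> W x k \<in> borel_measurable N"
  using assms(3)
proof (induction k)
  case 0
  then show ?case by simp
next
  case (Suc k)
  have [measurable]: "chain f \<sigma> W x k \<in> borel_measurable N" "W (Suc k) \<in> borel_measurable N"
    using Suc by simp_all
  show ?case by simp
qed

abbreviation coord_chain :: "(real^'d \<Rightarrow> real^'d) \<Rightarrow> (real^'d \<Rightarrow> real^'m^'d) \<Rightarrow> real^'d
    \<Rightarrow> nat \<Rightarrow> (nat \<Rightarrow> real^'m) \<Rightarrow> real^'d" where
  "coord_chain f \<sigma> x \<equiv> chain f \<sigma> (\<lambda>k w. w k) x"

lemma chain_eq_coord_chain:
  assumes "\<And>i. 1 \<le> i \<Longrightarrow> i \<le> k \<Longrightarrow> W i \<omega> = w i"
  shows "chain f \<sigma> W x k \<omega> = coord_chain f \<sigma> x k w"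
  using assms by (induction k) auto

text \<open>Convexity of the square at the points \<open>a / r\<close> and
  \<open>b / (1 - r)\<close> with weights \<open>r\<close> and \<open>1 - r\<close>. The weight
  \<open>1 / r\<close> turns a squared contraction factor \<open>r^2\<close> into
  \<open>r\<close>.\<close>

lemma sq_sum_le_convex:
  fixes a b r :: real
  assumes "0 < r" "r < 1"
  shows "(a + b)\<^sup>2 \<le> a\<^sup>2 / r + b\<^sup>2 / (1 - r)"
proof -
  have "1 + (1 - r) / r = 1 / r" "1 + 1 / ((1 - r) / r) = 1 / (1 - r)"
    using assms by (simp_all add: field_simps)
  then show ?thesis using sq_sum_le[of "(1 - r) / r" a b] assms by simp
qed

lemma ennreal_add_mult:
  "0 \<le> a \<Longrightarrow> 0 \<le> b \<Longrightarrow> 0 \<le> c \<Longrightarrow> ennreal (a + b * c) = ennreal a + ennreal b * ennreal c"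
  by (simp add: ennreal_mult)

text \<open>The cross term is linear in the centred variable \<open>z\<close> and integrates to
  0.\<close>

lemma nn_integral_norm_add_sq:
  fixes B :: "real^'m^'d" and P :: "(real^'m) measure"
  assumes P: "prob_space P" "sets P = sets borel" and int: "integrable P (\<lambda>z. z)" "(\<integral>z. z \<partial>P) = 0"
    and B: "integrable P (\<lambda>z. (norm (B *v z))\<^sup>2)"
  shows "(\<integral>\<^sup>+z. ennreal ((norm (u + B *v z))\<^sup>2) \<partial>P) = ennreal ((norm u)\<^sup>2 + (\<integral>z. (norm (B *v z))\<^sup>2 \<partial>P))"
proof -
  interpret prob_space P by fact
  have bl: "bounded_linear (\<lambda>z. u \<bullet> (B *v z))"
    by (intro bounded_linear_compose[OF bounded_linear_inner_right matrix_vector_mul_bounded_linear])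
  have eq: "(norm (u + B *v z))\<^sup>2 = (norm u)\<^sup>2 + 2 * (u \<bullet> (B *v z)) + (norm (B *v z))\<^sup>2" for z
    by (simp add: power2_norm_eq_inner inner_add_left inner_add_right inner_commute)
  have i: "integrable P (\<lambda>z. u \<bullet> (B *v z))"
    by (rule integrable_bounded_linear[OF bl int(1)])
  have z: "(\<integral>z. u \<bullet> (B *v z) \<partial>P) = 0"
    using integral_bounded_linear[OF bl int(1)] int(2) by simp
  have "(\<integral>\<^sup>+z. ennreal ((norm (u + B *v z))\<^sup>2) \<partial>P) = ennreal (\<integral>z. (norm (u + B *v z))\<^sup>2 \<partial>P)"
  proof (rule nn_integral_eq_integral)
    show "integrable P (\<lambda>z. (norm (u + B *v z))\<^sup>2)" using i B by (simp add: eq)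
  qed simp
  also have "(\<integral>z. (norm (u + B *v z))\<^sup>2 \<partial>P) = (norm u)\<^sup>2 + (\<integral>z. (norm (B *v z))\<^sup>2 \<partial>P)"
    using i B by (simp add: eq z prob_space)
  finally show ?thesis .
qed

locale contractive_model = noise P for P :: "(real^'m) measure" +
  fixes f :: "real^'d \<Rightarrow> real^'d" and \<sigma> :: "real^'d \<Rightarrow> real^'m^'d" and x :: "real^'d" and C K r :: real
  assumes T2_P: "T2 C dist P" and C_pos: "0 < C" and K_pos: "0 < K"
    and f_meas [measurable]: "f \<in> borel_measurable borel"
    and \<sigma>_meas [measurable]: "\<sigma> \<in> borel_measurable borel"
    and mean: "integrable P (\<lambda>z. z)" "(\<integral>z. z \<partial>P) = 0"
    and \<sigma>_bound: "\<And>x w. norm (\<sigma> x *v w) \<le> K * norm w"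
    and r: "0 \<le> r" "r < 1"
    and contraction: "\<And>x x'. integrable P (\<lambda>z. (norm ((\<sigma> x - \<sigma> x') *v z))\<^sup>2)"
      "\<And>x x'. (norm (f x - f x'))\<^sup>2 + (\<integral>z. (norm ((\<sigma> x - \<sigma> x') *v z))\<^sup>2 \<partial>P) \<le> r\<^sup>2 * (norm (x - x'))\<^sup>2"
begin

abbreviation ch :: "nat \<Rightarrow> (nat \<Rightarrow> real^'m) \<Rightarrow> real^'d" where
  "ch \<equiv> coord_chain f \<sigma> x"

definition dsq :: "nat \<Rightarrow> (nat \<Rightarrow> real^'m) \<Rightarrow> (nat \<Rightarrow> real^'m) \<Rightarrow> real" where
  "dsq k w w' = (norm (ch k w - ch k w'))\<^sup>2"

definition path_cost :: "nat \<Rightarrow> (nat \<Rightarrow> real^'m) \<Rightarrow> (nat \<Rightarrow> real^'m) \<Rightarrow> real" where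
  "path_cost n w w' = (\<Sum>k=1..n. dsq k w w')"

lemma dsq_nonneg: "0 \<le> dsq k w w'" by (simp add: dsq_def)

lemma path_cost_nonneg: "0 \<le> path_cost n w w'" by (simp add: path_cost_def dsq_nonneg sum_nonneg)

lemma ch_upd: "k \<le> n \<Longrightarrow> ch k (w(Suc n := z)) = ch k w"
  by (rule chain_eq_coord_chain) simp

lemma ch_meas: "k \<le> n \<Longrightarrow> ch k \<in> borel_measurable (Pn n)"
  by (intro measurable_chain f_meas \<sigma>_meas) (auto intro: measurable_Pn_component)

lemma ch_meas_compose [measurable (raw)]:
  "k \<le> n \<Longrightarrow> h \<in> measurable N (Pn n) \<Longrightarrow> (\<lambda>y. ch k (h y)) \<in> borel_measurable N"
  by (rule measurable_compose[OF _ ch_meas])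

lemma dsq_meas:
  assumes "k \<le> n" "h \<in> measurable N (Pn n)" "h' \<in> measurable N (Pn n)"
  shows "(\<lambda>y. dsq k (h y) (h' y)) \<in> borel_measurable N"
proof -
  have [measurable]: "(\<lambda>y. ch k (h y)) \<in> borel_measurable N" "(\<lambda>y. ch k (h' y)) \<in> borel_measurable N"
    using assms by (auto intro: ch_meas_compose)
  show ?thesis unfolding dsq_def by measurable
qed

lemma path_cost_meas [measurable (raw)]:
  assumes "h \<in> measurable N (Pn n)" "h' \<in> measurable N (Pn n)"
  shows "(\<lambda>y. path_cost n (h y) (h' y)) \<in> borel_measurable N"
  unfolding path_cost_def using assms by (intro borel_measurable_sum dsq_meas) auto

text \<open>\<open>chain_transport\<close> with \<open>L = K^2 / (1 - s)^2\<close>, applied to the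
  path cost augmented by a potential that makes the contraction close exactly.\<close>

lemma transport_pos:
  assumes s: "0 < s" "s < 1" "r \<le> s"
    and G: "G \<in> borel_measurable (Pn n)" "\<And>w. 0 \<le> G w" "(\<integral>\<^sup>+w. ennreal (G w) \<partial>Pn n) = 1"
      "Ent (Pn n) G < \<infinity>" and "0 < \<epsilon>"
  shows "\<exists>D. kernel_plan n G D \<and>
      plan_cost n G D (\<lambda>w w'. ennreal (path_cost n w w')) \<le>
        ennreal (K\<^sup>2 / (1 - s)\<^sup>2) * (ennreal (2 * C) * Ent (Pn n) G) + ennreal \<epsilon>"
proof -
  let ?b = "ennreal (K\<^sup>2 / (1 - s)\<^sup>2) * (ennreal (2 * C) * Ent (Pn n) G) + ennreal \<epsilon>"
  \<comment> \<open>The potential prices the future of the current distance: contracted by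
    \<open>s\<close> in each later step, it contributes \<open>s + s^2 + ... = s / (1 - s)\<close>
    times itself.\<close>
  define c where "c n w w' = ennreal (path_cost n w w' + s / (1 - s) * dsq n w w')" for n w w'
  \<comment> \<open>The difference of the chains after a step in which both use the noise
    \<open>z\<close>, in practice the untilted one. The true difference adds \<sigma> at the tilted
    state, applied to the difference of the innovations.\<close>
  define A where "A n w w' z = (f (ch n w) - f (ch n w')) + (\<sigma> (ch n w) - \<sigma> (ch n w')) *v z" for n w w' z
  \<comment> \<open>The coefficient is the Young weight \<open>1 / s\<close> times
    \<open>1 + s / (1 - s) = 1 / (1 - s)\<close>.\<close>
  define e where "e n w w' z = ennreal (path_cost n w w' + (norm (A n w w' z))\<^sup>2 / (s * (1 - s)))" for n w w' z
  have "\<exists>D. kernel_plan n G D \<and>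
      plan_cost n G D (c n) \<le> ?b"
  proof (rule chain_transport[OF T2_P _ _ _ _ _ _ _ G \<open>0 < \<epsilon>\<close>, where e = e])
    show "(\<lambda>(w, w'). c n w w') \<in> borel_measurable (Pn n \<Otimes>\<^sub>M Pn n)" for n
    proof -
      have [measurable]: "(\<lambda>x. dsq n (fst x) (snd x)) \<in> borel_measurable (Pn n \<Otimes>\<^sub>M Pn n)"
        by (rule dsq_meas) auto
      show ?thesis unfolding c_def case_prod_beta' by measurable
    qed
    show "(\<lambda>(w, w', z). e n w w' z) \<in> borel_measurable (Pn n \<Otimes>\<^sub>M (Pn n \<Otimes>\<^sub>M borel))" for n
    proof -
      have [measurable]: "(\<lambda>x. ch n (fst x)) \<in> borel_measurable (Pn n \<Otimes>\<^sub>M (Pn n \<Otimes>\<^sub>M (borel :: (real^'m) measure)))"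
        "(\<lambda>x. ch n (fst (snd x))) \<in> borel_measurable (Pn n \<Otimes>\<^sub>M (Pn n \<Otimes>\<^sub>M (borel :: (real^'m) measure)))"
        by (rule ch_meas_compose[of n n]; measurable)+
      show ?thesis unfolding e_def A_def case_prod_beta' by measurable
    qed
    show "c 0 w w' = 0" for w w' by (simp add: c_def path_cost_def dsq_def)
    show "c (Suc n) (w(Suc n := z)) (w'(Suc n := z')) \<le> e n w w' z' + ennreal (K\<^sup>2 / (1 - s)\<^sup>2) * sqdist z z'"
      for n w w' z z'
    proof -
      let ?v = "w(Suc n := z)" and ?v' = "w'(Suc n := z')"
      let ?X = "ch n w"
      have S: "path_cost (Suc n) ?v ?v' = path_cost n w w' + dsq (Suc n) ?v ?v'"
        by (simp add: path_cost_def dsq_def ch_upd)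
      have "ch (Suc n) ?v - ch (Suc n) ?v' = A n w w' z' + \<sigma> ?X *v (z - z')"
        by (simp add: A_def ch_upd matrix_vector_mult_diff_rdistrib matrix_vector_mult_diff_distrib)
      then have "norm (ch (Suc n) ?v - ch (Suc n) ?v') \<le> norm (A n w w' z') + K * norm (z - z')"
        using norm_triangle_ineq[of "A n w w' z'" "\<sigma> ?X *v (z - z')"] \<sigma>_bound[of ?X "z - z'"] by simp
      then have "dsq (Suc n) ?v ?v' \<le> (norm (A n w w' z') + K * norm (z - z'))\<^sup>2"
        unfolding dsq_def by (rule power_mono) simp
      also have "\<dots> \<le> (norm (A n w w' z'))\<^sup>2 / s + (K * norm (z - z'))\<^sup>2 / (1 - s)"
        by (rule sq_sum_le_convex) fact+
      finally have d: "dsq (Suc n) ?v ?v' \<le> (norm (A n w w' z'))\<^sup>2 / s + (K * norm (z - z'))\<^sup>2 / (1 - s)" .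
      \<comment> \<open>The new distance counts once in the path and \<open>s / (1 - s)\<close>
        times in the potential. With the Young weight \<open>1 / (1 - s)\<close> this gives the
        square in the denominator of \<open>L\<close>.\<close>
      have "path_cost (Suc n) ?v ?v' + s / (1 - s) * dsq (Suc n) ?v ?v' =
          path_cost n w w' + dsq (Suc n) ?v ?v' / (1 - s)"
        unfolding S using s by (simp add: field_simps)
      also have "\<dots> \<le> path_cost n w w' + ((norm (A n w w' z'))\<^sup>2 / s + (K * norm (z - z'))\<^sup>2 / (1 - s)) / (1 - s)"
        using s d by (intro add_left_mono divide_right_mono) auto
      also have "\<dots> = (path_cost n w w' + (norm (A n w w' z'))\<^sup>2 / (s * (1 - s))) + K\<^sup>2 / (1 - s)\<^sup>2 * (dist z z')\<^sup>2"
        by (simp add: add_divide_distrib power_mult_distrib dist_norm power2_eq_square)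
      finally have "c (Suc n) ?v ?v' \<le> ennreal ((path_cost n w w' + (norm (A n w w' z'))\<^sup>2 / (s * (1 - s))) + K\<^sup>2 / (1 - s)\<^sup>2 * (dist z z')\<^sup>2)"
        unfolding c_def by (rule ennreal_leI)
      also have "\<dots> = e n w w' z' + ennreal (K\<^sup>2 / (1 - s)\<^sup>2) * sqdist z z'"
        unfolding e_def using s path_cost_nonneg[of n w w'] by (intro ennreal_add_mult) auto
      finally show ?thesis .
    qed
    show "(\<integral>\<^sup>+z. e n w w' z \<partial>P) \<le> c n w w'" for n w w'
    proof -
      let ?u = "f (ch n w) - f (ch n w')" and ?B = "\<sigma> (ch n w) - \<sigma> (ch n w')"
      have "(\<integral>\<^sup>+z. e n w w' z \<partial>P) = (\<integral>\<^sup>+z. ennreal (path_cost n w w') + ennreal (1 / (s * (1 - s))) * ennreal ((norm (A n w w' z))\<^sup>2) \<partial>P)"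
        unfolding e_def using s path_cost_nonneg[of n w w']
        by (intro nn_integral_cong) (simp flip: ennreal_mult ennreal_plus)
      also have "\<dots> = ennreal (path_cost n w w') + ennreal (1 / (s * (1 - s))) * (\<integral>\<^sup>+z. ennreal ((norm (A n w w' z))\<^sup>2) \<partial>P)"
        unfolding A_def by (simp add: nn_integral_add nn_integral_cmult emeasure_space_1)
      also have "(\<integral>\<^sup>+z. ennreal ((norm (A n w w' z))\<^sup>2) \<partial>P) = ennreal ((norm ?u)\<^sup>2 + (\<integral>z. (norm (?B *v z))\<^sup>2 \<partial>P))"
        unfolding A_def by (rule nn_integral_norm_add_sq[OF prob_space_axioms sets_P mean contraction(1)])
      also have "\<dots> \<le> ennreal (s\<^sup>2 * dsq n w w')"
      proof (rule ennreal_leI)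
        have "(norm ?u)\<^sup>2 + (\<integral>z. (norm (?B *v z))\<^sup>2 \<partial>P) \<le> r\<^sup>2 * dsq n w w'"
          unfolding dsq_def by (rule contraction(2))
        also have "\<dots> \<le> s\<^sup>2 * dsq n w w'"
          using r s dsq_nonneg by (intro mult_right_mono power_mono) auto
        finally show "(norm ?u)\<^sup>2 + (\<integral>z. (norm (?B *v z))\<^sup>2 \<partial>P) \<le> s\<^sup>2 * dsq n w w'" .
      qed
      also have "ennreal (path_cost n w w') + ennreal (1 / (s * (1 - s))) * ennreal (s\<^sup>2 * dsq n w w') = c n w w'"
      proof -
        \<comment> \<open>The factor \<open>s^2\<close> from the contraction reproduces the
          coefficient of the potential.\<close>
        have "1 / (s * (1 - s)) * (s\<^sup>2 * dsq n w w') = s / (1 - s) * dsq n w w'"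
          using s by (simp add: power2_eq_square)
        then show ?thesis
          unfolding c_def using s path_cost_nonneg[of n w w'] dsq_nonneg[of n w w']
          by (simp flip: ennreal_mult ennreal_plus)
      qed
      finally show ?thesis by (simp add: add_left_mono mult_left_mono)
    qed
  qed (use C_pos in auto)
  then obtain D where D: "kernel_plan n G D"
    "plan_cost n G D (c n) \<le> ?b"
    by blast
  have "ennreal (path_cost n w w') \<le> c n w w'" for w w'
    unfolding c_def using s dsq_nonneg[of n w w'] by (intro ennreal_leI) simp
  then have "plan_cost n G D (\<lambda>w w'. ennreal (path_cost n w w')) \<le> plan_cost n G D (c n)"
    unfolding plan_cost_def by (intro nn_integral_mono mult_left_mono) auto
  with D show ?thesis by (blast intro: order_trans)
qed

text \<open>The bound of \<open>transport_pos\<close> is continuous in \<open>s\<close>; choosing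
  \<open>s\<close> slightly above \<open>r\<close> uses half of \<epsilon> and covers
  \<open>r = 0\<close>.\<close>

lemma transport:
  assumes G: "G \<in> borel_measurable (Pn n)" "\<And>w. 0 \<le> G w" "(\<integral>\<^sup>+w. ennreal (G w) \<partial>Pn n) = 1"
      "Ent (Pn n) G < \<infinity>" and "0 < \<epsilon>"
  obtains D where "kernel_plan n G D"
    and "plan_cost n G D (\<lambda>w w'. ennreal (path_cost n w w')) \<le>
        ennreal (2 * (C * K\<^sup>2 / (1 - r)\<^sup>2)) * Ent (Pn n) G + ennreal \<epsilon>"
proof -
  obtain E where E: "Ent (Pn n) G = ennreal E" "0 \<le> E"
    using G(4) by (cases "Ent (Pn n) G") auto
  let ?b = "\<lambda>s. K\<^sup>2 / (1 - s)\<^sup>2 * (2 * C * E)"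
  obtain s where s: "0 < s" "s < 1" "r \<le> s" "?b s \<le> ?b r + \<epsilon> / 2"
  proof -
    have "(?b \<longlongrightarrow> ?b r) (at_right r)"
      using r by (intro tendsto_intros) auto
    then have "eventually (\<lambda>s. ?b s < ?b r + \<epsilon> / 2) (at_right r)"
      using \<open>0 < \<epsilon>\<close> by (intro order_tendstoD(2)) auto
    moreover have "eventually (\<lambda>s. s \<in> {r<..<1}) (at_right r)"
      using r by (intro eventually_at_right_real)
    ultimately have "eventually (\<lambda>s. ?b s < ?b r + \<epsilon> / 2 \<and> s \<in> {r<..<1}) (at_right r)"
      by (rule eventually_conj)
    then obtain s where "?b s < ?b r + \<epsilon> / 2" "s \<in> {r<..<1}"
      using eventually_happens[of _ "at_right r"] by (auto simp: trivial_limit_at_right_real)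
    then show ?thesis using r by (intro that[of s]) auto
  qed
  have "0 < \<epsilon> / 2" using \<open>0 < \<epsilon>\<close> by simp
  have bound: "ennreal (K\<^sup>2 / (1 - s)\<^sup>2) * (ennreal (2 * C) * Ent (Pn n) G) + ennreal (\<epsilon> / 2) \<le>
    ennreal (2 * (C * K\<^sup>2 / (1 - r)\<^sup>2)) * Ent (Pn n) G + ennreal \<epsilon>"
  proof -
    have "ennreal (?b s + \<epsilon> / 2) \<le> ennreal (2 * (C * K\<^sup>2 / (1 - r)\<^sup>2) * E + \<epsilon>)"
      using s(4) by (intro ennreal_leI) (simp add: mult_ac)
    then show ?thesis
      using E C_pos \<open>0 < \<epsilon>\<close> by (simp only: E(1) ennreal_mult[symmetric] ennreal_plus[symmetric] divide_nonneg_nonneg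
        mult_nonneg_nonneg zero_le_power2 less_imp_le zero_le_numeral)
  qed
  show ?thesis
    using transport_pos[OF s(1-3) G \<open>0 < \<epsilon> / 2\<close>] that order_trans[OF _ bound] by blast
qed

section \<open>Couplings over a probability space that carries the noise\<close>

definition path :: "nat \<Rightarrow> (nat \<Rightarrow> real^'m) \<Rightarrow> nat \<Rightarrow> real^'d" where
  "path n w = (\<lambda>k\<in>{1..n}. ch k w)"

lemma path_meas [measurable]: "path n \<in> measurable (Pn n) (path_space n)"
  unfolding path_def[abs_def] path_space_def by (intro measurable_restrict ch_meas) auto

lemma d_l2_path: "(d_l2 n (path n w) (path n w'))\<^sup>2 = path_cost n w w'"
  unfolding d_l2_def path_cost_def dsq_def path_def by (simp add: sum_nonneg)

text \<open>The tilt by \<open>q\<close> gives \<open>V\<close> a density \<open>G\<close>, the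
  conditional expectation of \<open>q\<close> given \<open>V\<close>, whose entropy is no larger. A
  plan for \<open>G\<close> is lifted by letting the untilted noise depend on \<open>v\<close>
  through \<open>V v\<close>. A general \<open>N\<close> admits tilts that are not functions of the
  noise, as they occur in the exponential inequality.\<close>

lemma lifted_coupling:
  fixes N :: "'w measure" and V :: "'w \<Rightarrow> nat \<Rightarrow> real^'m"
  assumes N: "prob_space N" and V [measurable]: "V \<in> measurable N (Pn n)" and dV: "distr N (Pn n) V = Pn n"
    and q [measurable]: "q \<in> borel_measurable N" and q0: "\<And>v. 0 \<le> q v"
    and q1: "(\<integral>\<^sup>+v. ennreal (q v) \<partial>N) = 1" and E: "Ent N q < \<infinity>" and "0 < \<epsilon>"
  obtains \<Gamma> where "prob_space \<Gamma>" "sets \<Gamma> = sets (N \<Otimes>\<^sub>M Pn n)"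
    "distr \<Gamma> N fst = density N q" "distr \<Gamma> (Pn n) snd = Pn n"
    "(\<integral>\<^sup>+y. ennreal (path_cost n (V (fst y)) (snd y)) \<partial>\<Gamma>) \<le>
      ennreal (2 * (C * K\<^sup>2 / (1 - r)\<^sup>2)) * Ent N q + ennreal \<epsilon>"
proof -
  let ?C2 = "ennreal (2 * (C * K\<^sup>2 / (1 - r)\<^sup>2))"
  interpret N: prob_space N by fact
  interpret Pn: prob_space "Pn n" by (rule prob_space_Pn)
  have V_int: "(\<integral>\<^sup>+v. u (V v) \<partial>N) = (\<integral>\<^sup>+w. u w \<partial>Pn n)" if [measurable]: "u \<in> borel_measurable (Pn n)" for u
    using nn_integral_distr[OF V, of u] by (simp add: dV)
  define \<nu> where "\<nu> = distr (density N q) (Pn n) V"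
  have \<nu>_int: "(\<integral>\<^sup>+w. u w \<partial>\<nu>) = (\<integral>\<^sup>+v. ennreal (q v) * u (V v) \<partial>N)" if [measurable]: "u \<in> borel_measurable (Pn n)" for u
    unfolding \<nu>_def by (simp add: nn_integral_distr nn_integral_density)
  have sets_\<nu>: "sets \<nu> = sets (Pn n)" by (simp add: \<nu>_def)
  have "prob_space (density N q)" by (intro prob_spaceI) (simp add: emeasure_density q1)
  then have "prob_space \<nu>" unfolding \<nu>_def by (rule prob_space.prob_space_distr) simp
  then have fin: "finite_measure \<nu>" by (rule prob_space.finite_measure)
  have ac: "absolutely_continuous (Pn n) \<nu>"
    unfolding absolutely_continuous_def
  proof
    fix A assume A: "A \<in> null_sets (Pn n)"
    then have [measurable]: "A \<in> sets (Pn n)" by auto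
    have "(\<integral>\<^sup>+v. indicator A (V v) \<partial>N) = 0" using V_int[of "indicator A"] A by (simp add: null_sets_def)
    then have "AE v in N. (indicator A (V v) :: ennreal) = 0"
      by (subst (asm) nn_integral_0_iff_AE) auto
    then have "(\<integral>\<^sup>+v. ennreal (q v) * indicator A (V v) \<partial>N) = (\<integral>\<^sup>+v. 0 \<partial>N)"
      by (intro nn_integral_cong_AE) (auto elim!: eventually_mono)
    then have "emeasure \<nu> A = 0" using \<nu>_int[of "indicator A"] by (simp add: sets_\<nu>)
    then show "A \<in> null_sets \<nu>" by (simp add: null_sets_def sets_\<nu>)
  qed
  \<comment> \<open>A real-valued version of the derivative of the tilted law of \<open>V\<close>;
    by \<open>G_int\<close>, \<open>G (V v)\<close> is the conditional expectation of
    \<open>q\<close>.\<close>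
  obtain G where G [measurable]: "G \<in> borel_measurable (Pn n)"
    and G_RN: "AE w in Pn n. RN_deriv (Pn n) \<nu> w = ennreal (G w)" and G0: "\<And>w. 0 \<le> G w"
    using Pn.real_RN_deriv[OF fin ac sets_\<nu>] by blast
  have G_int: "(\<integral>\<^sup>+v. ennreal (q v) * u (V v) \<partial>N) = (\<integral>\<^sup>+w. ennreal (G w) * u w \<partial>Pn n)"
    if u: "u \<in> borel_measurable (Pn n)" for u
  proof -
    have "(\<integral>\<^sup>+w. u w \<partial>\<nu>) = (\<integral>\<^sup>+w. RN_deriv (Pn n) \<nu> w * u w \<partial>Pn n)"
      by (rule Pn.RN_deriv_nn_integral[OF ac sets_\<nu> u])
    also have "\<dots> = (\<integral>\<^sup>+w. ennreal (G w) * u w \<partial>Pn n)"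
      using G_RN by (intro nn_integral_cong_AE) (auto elim!: eventually_mono)
    finally show ?thesis using \<nu>_int[OF u] by simp
  qed
  have G1: "(\<integral>\<^sup>+w. ennreal (G w) \<partial>Pn n) = 1"
    using G_int[of "\<lambda>_. 1"] q1 by simp
  have "Ent (Pn n) G = Ent N (\<lambda>v. G (V v))"
    unfolding Ent_def by (rule V_int[symmetric]) measurable
  also have "\<dots> \<le> Ent N q"
  proof (rule Ent_coarsen[OF N q])
    fix u :: "real \<Rightarrow> ennreal" assume [measurable]: "u \<in> borel_measurable borel"
    have "(\<integral>\<^sup>+v. ennreal (q v) * u (G (V v)) \<partial>N) = (\<integral>\<^sup>+w. ennreal (G w) * u (G w) \<partial>Pn n)"
      by (rule G_int) measurable
    also have "\<dots> = (\<integral>\<^sup>+v. ennreal (G (V v)) * u (G (V v)) \<partial>N)"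
      by (rule V_int[symmetric]) measurable
    finally show "(\<integral>\<^sup>+v. ennreal (q v) * u (G (V v)) \<partial>N) = (\<integral>\<^sup>+v. ennreal (G (V v)) * u (G (V v)) \<partial>N)" .
  qed (use q0 G0 q1 in auto)
  finally have Ent_le: "Ent (Pn n) G \<le> Ent N q" .
  then have "Ent (Pn n) G < \<infinity>" using E by (rule le_less_trans)
  from transport[OF G G0 G1 this \<open>0 < \<epsilon>\<close>] obtain D
    where plan: "kernel_plan n G D"
    and Dc: "plan_cost n G D (\<lambda>w w'. ennreal (path_cost n w w')) \<le>
        ?C2 * Ent (Pn n) G + ennreal \<epsilon>"
    by blast
  have D: "(\<lambda>(w, w'). D w w') \<in> borel_measurable (Pn n \<Otimes>\<^sub>M Pn n)"
    and D1: "\<And>w. w \<in> space (Pn n) \<Longrightarrow> (\<integral>\<^sup>+w'. D w w' \<partial>Pn n) = 1"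
    and Du: "\<And>u. u \<in> borel_measurable (Pn n) \<Longrightarrow> plan_cost n G D (\<lambda>w. u) = (\<integral>\<^sup>+w. u w \<partial>Pn n)"
    using plan unfolding kernel_plan_def plan_cost_def by simp_all
  note [measurable (raw)] = measurable_uncurry2[OF D]
  \<comment> \<open>The first coordinate follows the tilted law on \<open>N\<close>; given
    \<open>v\<close>, the second has density \<open>D (V v)\<close>.\<close>
  define \<Gamma> where "\<Gamma> = density (N \<Otimes>\<^sub>M Pn n) (\<lambda>y. ennreal (q (fst y)) * D (V (fst y)) (snd y))"
  have \<Gamma>_int: "(\<integral>\<^sup>+y. F (fst y) (snd y) \<partial>\<Gamma>) = (\<integral>\<^sup>+v. ennreal (q v) * (\<integral>\<^sup>+w'. D (V v) w' * F v w' \<partial>Pn n) \<partial>N)"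
    if F: "(\<lambda>(v, w'). F v w') \<in> borel_measurable (N \<Otimes>\<^sub>M Pn n)" for F
  proof -
    note [measurable (raw)] = measurable_uncurry2[OF F]
    have "(\<integral>\<^sup>+y. F (fst y) (snd y) \<partial>\<Gamma>) =
      (\<integral>\<^sup>+y. (ennreal (q (fst y)) * D (V (fst y)) (snd y)) * F (fst y) (snd y) \<partial>(N \<Otimes>\<^sub>M Pn n))"
      unfolding \<Gamma>_def by (rule nn_integral_density) measurable
    also have "\<dots> = (\<integral>\<^sup>+v. \<integral>\<^sup>+w'. (ennreal (q v) * D (V v) w') * F v w' \<partial>Pn n \<partial>N)"
      using Pn.nn_integral_fst[of "\<lambda>y. (ennreal (q (fst y)) * D (V (fst y)) (snd y)) * F (fst y) (snd y)" N] by simp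
    also have "\<dots> = (\<integral>\<^sup>+v. ennreal (q v) * (\<integral>\<^sup>+w'. D (V v) w' * F v w' \<partial>Pn n) \<partial>N)"
    proof (rule nn_integral_cong)
      fix v assume v [simp]: "v \<in> space N"
      have [simp]: "V v \<in> space (Pn n)" using V by (rule measurable_space) simp
      show "(\<integral>\<^sup>+w'. (ennreal (q v) * D (V v) w') * F v w' \<partial>Pn n) =
        ennreal (q v) * (\<integral>\<^sup>+w'. D (V v) w' * F v w' \<partial>Pn n)"
        unfolding mult.assoc by (rule nn_integral_cmult) measurable
    qed
    finally show ?thesis .
  qed
  have sets_\<Gamma>: "sets \<Gamma> = sets (N \<Otimes>\<^sub>M Pn n)" by (simp add: \<Gamma>_def)
  note sets_\<Gamma>[measurable_cong]
  have m1: "distr \<Gamma> N fst = density N q"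
  proof (rule measure_eqI)
    fix A assume "A \<in> sets (distr \<Gamma> N fst)"
    then have [measurable]: "A \<in> sets N" by simp
    have "emeasure (distr \<Gamma> N fst) A = (\<integral>\<^sup>+y. indicator A (fst y) \<partial>\<Gamma>)"
      by (subst nn_integral_indicator[symmetric], simp, subst nn_integral_distr) auto
    also have "\<dots> = (\<integral>\<^sup>+v. ennreal (q v) * (\<integral>\<^sup>+w'. D (V v) w' * indicator A v \<partial>Pn n) \<partial>N)"
      by (rule \<Gamma>_int) measurable
    also have "\<dots> = (\<integral>\<^sup>+v. ennreal (q v) * indicator A v \<partial>N)"
    proof (rule nn_integral_cong)
      fix v assume "v \<in> space N"
      then have [simp]: "V v \<in> space (Pn n)" using V by (rule measurable_space[rotated])
      have "(\<integral>\<^sup>+w'. D (V v) w' * indicator A v \<partial>Pn n) = (\<integral>\<^sup>+w'. D (V v) w' \<partial>Pn n) * indicator A v"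
        by (rule nn_integral_multc) measurable
      then show "ennreal (q v) * (\<integral>\<^sup>+w'. D (V v) w' * indicator A v \<partial>Pn n) = ennreal (q v) * indicator A v"
        by (simp add: D1)
    qed
    also have "\<dots> = emeasure (density N q) A" by (simp add: emeasure_density)
    finally show "emeasure (distr \<Gamma> N fst) A = emeasure (density N q) A" .
  qed simp
  \<comment> \<open>The inner integral is a function of \<open>V v\<close>, so \<open>q\<close> may
    be replaced by its conditional expectation \<open>G\<close>.\<close>
  have marg: "(\<integral>\<^sup>+v. ennreal (q v) * (\<integral>\<^sup>+w'. D (V v) w' * F (V v) w' \<partial>Pn n) \<partial>N) =
    (\<integral>\<^sup>+w. ennreal (G w) * (\<integral>\<^sup>+w'. D w w' * F w w' \<partial>Pn n) \<partial>Pn n)"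
    if F: "(\<lambda>(w, w'). F w w') \<in> borel_measurable (Pn n \<Otimes>\<^sub>M Pn n)" for F
  proof (rule G_int)
    note [measurable (raw)] = measurable_uncurry2[OF F]
    show "(\<lambda>w. \<integral>\<^sup>+w'. D w w' * F w w' \<partial>Pn n) \<in> borel_measurable (Pn n)" by measurable
  qed
  have m2: "distr \<Gamma> (Pn n) snd = Pn n"
  proof (rule measure_eqI)
    fix A assume "A \<in> sets (distr \<Gamma> (Pn n) snd)"
    then have [measurable]: "A \<in> sets (Pn n)" by simp
    have "emeasure (distr \<Gamma> (Pn n) snd) A = (\<integral>\<^sup>+y. indicator A (snd y) \<partial>\<Gamma>)"
      by (subst nn_integral_indicator[symmetric], simp, subst nn_integral_distr) auto
    also have "\<dots> = (\<integral>\<^sup>+v. ennreal (q v) * (\<integral>\<^sup>+w'. D (V v) w' * indicator A w' \<partial>Pn n) \<partial>N)"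
      by (rule \<Gamma>_int) measurable
    also have "\<dots> = (\<integral>\<^sup>+w. ennreal (G w) * (\<integral>\<^sup>+w'. D w w' * indicator A w' \<partial>Pn n) \<partial>Pn n)"
      by (rule marg) measurable
    also have "\<dots> = emeasure (Pn n) A"
      using Du[of "indicator A"] by (simp add: plan_cost_def)
    finally show "emeasure (distr \<Gamma> (Pn n) snd) A = emeasure (Pn n) A" .
  qed simp
  have "prob_space \<Gamma>"
  proof (rule prob_spaceI)
    have "emeasure \<Gamma> (space \<Gamma>) = emeasure (distr \<Gamma> (Pn n) snd) (space (Pn n))"
      by (subst emeasure_distr) (auto simp: space_pair_measure sets_eq_imp_space_eq[OF sets_\<Gamma>] intro!: arg_cong[where f = "emeasure \<Gamma>"])
    then show "emeasure \<Gamma> (space \<Gamma>) = 1" by (simp add: m2 Pn.emeasure_space_1)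
  qed
  moreover have "(\<integral>\<^sup>+y. ennreal (path_cost n (V (fst y)) (snd y)) \<partial>\<Gamma>) \<le>
      ?C2 * Ent N q + ennreal \<epsilon>"
  proof -
    have "(\<integral>\<^sup>+y. ennreal (path_cost n (V (fst y)) (snd y)) \<partial>\<Gamma>) =
      (\<integral>\<^sup>+v. ennreal (q v) * (\<integral>\<^sup>+w'. D (V v) w' * ennreal (path_cost n (V v) w') \<partial>Pn n) \<partial>N)"
      by (rule \<Gamma>_int) measurable
    also have "\<dots> = plan_cost n G D (\<lambda>w w'. ennreal (path_cost n w w'))"
      unfolding plan_cost_def by (rule marg) measurable
    also note Dc
    also have "?C2 * Ent (Pn n) G + ennreal \<epsilon> \<le>
      ?C2 * Ent N q + ennreal \<epsilon>"
      using Ent_le by (intro add_right_mono mult_left_mono) auto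
    finally show ?thesis .
  qed
  ultimately show ?thesis using that sets_\<Gamma> m1 m2 by blast
qed

end

subsection \<open>Transport and exponential inequalities for the path law\<close>

lemma ereal_exp_infinity [simp]: "ereal_exp \<infinity> = \<top>" "ereal_exp (- \<infinity>) = 0"
  using ereal_exp.simps(2,3) by (simp_all only: infinity_ereal_def uminus_ereal.simps)

lemma ereal_exp_mono: "a \<le> b \<Longrightarrow> ereal_exp a \<le> ereal_exp b"
  by (cases a; cases b) (auto intro: ennreal_leI)

context contractive_model
begin

text \<open>If the entropy is finite, the target law has a density \<open>h\<close> with respect to
  the path law, and \<open>h\<close> composed with the path map tilts the noise with the same
  entropy. The coupling of the noises is then pushed forward to paths.\<close>

lemma T2_path_law: "T2 (C * K\<^sup>2 / (1 - r)\<^sup>2) (d_l2 n) (distr (Pn n) (path_space n) (path n))"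
  unfolding T2_def
proof (intro allI impI)
  let ?\<mu> = "distr (Pn n) (path_space n) (path n)" and ?C = "C * K\<^sup>2 / (1 - r)\<^sup>2"
  fix \<nu> assume \<nu>: "prob_space \<nu> \<and> sets \<nu> = sets ?\<mu>"
  have C': "0 < ?C" using C_pos K_pos r by simp
  interpret Pn: prob_space "Pn n" by (rule prob_space_Pn)
  interpret \<mu>: prob_space ?\<mu> by (rule Pn.prob_space_distr) simp
  show "W2 (d_l2 n) ?\<mu> \<nu> \<le> ennreal_sqrt (ennreal (2 * ?C) * rel_entropy \<nu> ?\<mu>)"
  proof (cases "absolutely_continuous ?\<mu> \<nu> \<and> integrable \<nu> (entropy_density (exp 1) ?\<mu> \<nu>)")
    case False
    then have "rel_entropy \<nu> ?\<mu> = \<top>" unfolding rel_entropy_def by auto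
    then show ?thesis using C_pos K_pos r by (simp add: ennreal_sqrt_def ennreal_mult_top)
  next
    case True
    then have ac: "absolutely_continuous ?\<mu> \<nu>" by simp
    have sets_\<nu>: "sets \<nu> = sets ?\<mu>" using \<nu> by simp
    obtain h where h: "h \<in> borel_measurable ?\<mu>"
      and h_RN: "AE w in ?\<mu>. RN_deriv ?\<mu> \<nu> w = ennreal (h w)" and h0: "\<And>w. 0 \<le> h w"
      using \<mu>.real_RN_deriv[OF prob_space.finite_measure ac sets_\<nu>] \<nu> by blast
    have [measurable]: "h \<in> borel_measurable (path_space n)" using h by simp
    have \<nu>_h: "\<nu> = density ?\<mu> h"
    proof -
      have "\<nu> = density ?\<mu> (RN_deriv ?\<mu> \<nu>)" using \<mu>.density_RN_deriv[OF ac sets_\<nu>] by simp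
      also have "\<dots> = density ?\<mu> h" using h_RN by (intro density_cong) simp_all
      finally show ?thesis .
    qed
    have h1: "(\<integral>\<^sup>+y. ennreal (h y) \<partial>?\<mu>) = 1"
    proof -
      have "(\<integral>\<^sup>+y. ennreal (h y) \<partial>?\<mu>) = (\<integral>\<^sup>+y. 1 \<partial>density ?\<mu> h)"
        by (subst nn_integral_density) simp_all
      also have "\<dots> = (\<integral>\<^sup>+y. 1 \<partial>\<nu>)" by (simp only: \<nu>_h[symmetric])
      also have "\<dots> = 1" using \<nu> prob_space.emeasure_space_1[of \<nu>] by simp
      finally show ?thesis .
    qed
    have rel: "rel_entropy \<nu> ?\<mu> = Ent ?\<mu> h"
      unfolding \<nu>_h by (rule rel_entropy_density[OF \<mu>.prob_space_axioms h h0 h1])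
    define G where "G w = h (path n w)" for w
    have G [measurable]: "G \<in> borel_measurable (Pn n)" unfolding G_def[abs_def] by measurable
    have G1: "(\<integral>\<^sup>+w. ennreal (G w) \<partial>Pn n) = 1"
      unfolding G_def h1[symmetric] by (rule nn_integral_distr[symmetric]) auto
    have EntG: "Ent (Pn n) G = Ent ?\<mu> h"
      unfolding Ent_def G_def by (rule nn_integral_distr[symmetric]) auto
    have "rel_entropy \<nu> ?\<mu> < \<infinity>" using True by (simp add: rel_entropy_def)
    then have E: "Ent (Pn n) G < \<infinity>" by (simp add: rel EntG)
    then obtain E0 where E0: "Ent (Pn n) G = ennreal E0" "0 \<le> E0" by (cases "Ent (Pn n) G") auto
    define b where "b = 2 * ?C * E0"
    have b: "ennreal (2 * ?C) * Ent (Pn n) G = ennreal b" "0 \<le> b"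
    proof -
      have "0 \<le> 2 * ?C" using C' by linarith
      then show "ennreal (2 * ?C) * Ent (Pn n) G = ennreal b" "0 \<le> b"
        unfolding b_def E0(1) using E0(2) by (rule ennreal_mult[symmetric], rule mult_nonneg_nonneg)
    qed
    have bound: "W2 (d_l2 n) ?\<mu> \<nu> \<le> ennreal (sqrt (b + \<epsilon>))" if eps: "0 < \<epsilon>" for \<epsilon>
    proof -
      have id: "distr (Pn n) (Pn n) (\<lambda>w. w) = Pn n" by (rule distr_id2) simp
      obtain \<Gamma> where \<Gamma>: "prob_space \<Gamma>" "sets \<Gamma> = sets (Pn n \<Otimes>\<^sub>M Pn n)"
        "distr \<Gamma> (Pn n) fst = density (Pn n) G" "distr \<Gamma> (Pn n) snd = Pn n"
        "(\<integral>\<^sup>+y. ennreal (path_cost n (fst y) (snd y)) \<partial>\<Gamma>) \<le> ennreal (2 * ?C) * Ent (Pn n) G + ennreal \<epsilon>"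
        by (rule lifted_coupling[OF Pn.prob_space_axioms measurable_ident_sets[OF refl] id G _ G1 E eps])
           (auto simp: G_def h0)
      note \<Gamma>(2)[measurable_cong]
      \<comment> \<open>The coordinates are exchanged: \<Gamma> has the tilted noise first, whereas
        the coupling must have the untilted path law first.\<close>
      define \<pi> where "\<pi> = distr \<Gamma> (path_space n \<Otimes>\<^sub>M path_space n) (\<lambda>y. (path n (snd y), path n (fst y)))"
      have "prob_space \<pi>" unfolding \<pi>_def by (rule prob_space.prob_space_distr[OF \<Gamma>(1)]) measurable
      moreover have "sets \<pi> = sets (?\<mu> \<Otimes>\<^sub>M \<nu>)"
        unfolding \<pi>_def by (simp, intro sets_pair_measure_cong) (simp_all add: sets_\<nu>)
      moreover have "distr \<pi> ?\<mu> fst = ?\<mu>"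
      proof -
        have "distr \<pi> ?\<mu> fst = distr \<pi> (path_space n) fst" by (intro distr_cong) simp_all
        also have "\<dots> = distr \<Gamma> (path_space n) (\<lambda>y. path n (snd y))"
          unfolding \<pi>_def by (subst distr_distr) (auto simp: comp_def)
        also have "\<dots> = distr (distr \<Gamma> (Pn n) snd) (path_space n) (path n)"
          by (subst distr_distr) (auto simp: comp_def)
        finally show ?thesis by (simp only: \<Gamma>(4))
      qed
      moreover have "distr \<pi> \<nu> snd = \<nu>"
      proof -
        have "distr \<pi> \<nu> snd = distr \<pi> (path_space n) snd" by (intro distr_cong) (simp_all add: sets_\<nu>)
        also have "\<dots> = distr \<Gamma> (path_space n) (\<lambda>y. path n (fst y))"
          unfolding \<pi>_def by (subst distr_distr) (auto simp: comp_def)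
        also have "\<dots> = distr (distr \<Gamma> (Pn n) fst) (path_space n) (path n)"
          by (subst distr_distr) (auto simp: comp_def)
        also have "\<dots> = distr (density (Pn n) (\<lambda>w. ennreal (h (path n w)))) (path_space n) (path n)"
          by (simp only: \<Gamma>(3) G_def)
        also have "\<dots> = density ?\<mu> h" by (rule density_distr[symmetric]) simp_all
        finally show ?thesis using \<nu>_h by simp
      qed
      ultimately have \<pi>: "\<pi> \<in> couplings ?\<mu> \<nu>" by (simp add: couplings_def)
      have d: "d_l2 n y y' = d_l2 n y' y" for y y' :: "nat \<Rightarrow> real^'d"
        by (simp add: d_l2_def norm_minus_commute)
      let ?S = "path_space n :: (nat \<Rightarrow> real^'d) measure"
      have [measurable]: "(\<lambda>p. d_l2 n (fst p) (snd p)) \<in> borel_measurable (?S \<Otimes>\<^sub>M ?S)"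
      proof -
        have t: "(\<lambda>p. (norm (fst p i - snd p i))\<^sup>2) \<in> borel_measurable (?S \<Otimes>\<^sub>M ?S)"
          if "i \<in> {1..n}" for i
        proof -
          have c [measurable]: "(\<lambda>y. y i) \<in> measurable ?S (borel :: (real^'d) measure)"
            unfolding path_space_def using that by (rule measurable_component_singleton)
          have [measurable]: "(\<lambda>p. fst p i) \<in> borel_measurable (?S \<Otimes>\<^sub>M ?S)"
            "(\<lambda>p. snd p i) \<in> borel_measurable (?S \<Otimes>\<^sub>M ?S)"
            by (rule measurable_compose[OF measurable_fst c], rule measurable_compose[OF measurable_snd c])
          show ?thesis by measurable
        qed
        have "(\<lambda>p. \<Sum>i=1..n. (norm (fst p i - snd p i))\<^sup>2) \<in> borel_measurable (?S \<Otimes>\<^sub>M ?S)"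
          by (rule borel_measurable_sum[OF t])
        then show ?thesis unfolding d_l2_def by measurable
      qed
      let ?I = "\<integral>\<^sup>+p. ennreal ((d_l2 n (fst p) (snd p))\<^sup>2) \<partial>\<pi>"
      have "?I = (\<integral>\<^sup>+y. ennreal (path_cost n (fst y) (snd y)) \<partial>\<Gamma>)"
        unfolding \<pi>_def by (subst nn_integral_distr) (auto simp: d_l2_path d[of "path n (snd _)"])
      also have "\<dots> \<le> ennreal (b + \<epsilon>)" using \<Gamma>(5) b eps by simp
      finally have le: "?I \<le> ennreal (b + \<epsilon>)" .
      have "W2 (d_l2 n) ?\<mu> \<nu> \<le> ennreal_sqrt ?I"
        unfolding W2_def by (rule INF_lower[OF \<pi>])
      also have "\<dots> \<le> ennreal (sqrt (b + \<epsilon>))"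
      proof (cases ?I)
        case (real a)
        have "0 \<le> b + \<epsilon>" using b eps by simp
        then have "a \<le> b + \<epsilon>" using le unfolding real by (simp only: ennreal_le_iff)
        then show ?thesis using real by (simp add: ennreal_sqrt_def ennreal_leI)
      next
        case top
        then show ?thesis using le by (simp add: top_unique)
      qed
      finally show ?thesis .
    qed
    \<comment> \<open>The slack \<open>e^2\<close> under the root costs at most \<open>e\<close>
      outside it.\<close>
    have "W2 (d_l2 n) ?\<mu> \<nu> \<le> ennreal (sqrt b)"
    proof (rule ennreal_le_epsilon)
      fix e :: real assume "0 < e"
      have "W2 (d_l2 n) ?\<mu> \<nu> \<le> ennreal (sqrt (b + e\<^sup>2))" using \<open>0 < e\<close> by (intro bound) simp
      also have "\<dots> \<le> ennreal (sqrt b + e)"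
        using sqrt_add_le_add_sqrt[of b "e\<^sup>2"] b \<open>0 < e\<close> by (intro ennreal_leI) simp
      finally show "W2 (d_l2 n) ?\<mu> \<nu> \<le> ennreal (sqrt b) + ennreal e"
        using b \<open>0 < e\<close> by simp
    qed
    also have "ennreal (sqrt b) = ennreal_sqrt (ennreal (2 * ?C) * rel_entropy \<nu> ?\<mu>)"
      unfolding rel EntG[symmetric] b(1) using b(2) by (simp add: ennreal_sqrt_def)
    finally show ?thesis .
  qed
qed

text \<open>The variational principle for the entropy: with \<open>a\<close> the integral of
  \<open>g\<close> and \<open>q = g / a\<close>, \<open>ln a\<close> is the tilted mean of
  \<open>ln g\<close> minus the entropy of \<open>q\<close>. Integrating the pointwise bound on
  \<open>ln g\<close> against a coupling of the tilted space with an untilted path leaves \<rho>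
  times the mean of \<open>F\<close> plus a transport term, which that entropy absorbs.\<close>

lemma exp_bound:
  fixes N :: "'w measure" and V :: "'w \<Rightarrow> nat \<Rightarrow> real^'m" and g :: "'w \<Rightarrow> real"
  assumes N: "prob_space N" and V [measurable]: "V \<in> measurable N (Pn n)" and dV: "distr N (Pn n) V = Pn n"
    and F [measurable]: "F \<in> borel_measurable (path_space n)"
    and F_int: "integrable (distr (Pn n) (path_space n) (path n)) F"
    and g [measurable]: "g \<in> borel_measurable N" and g0: "\<And>v. 0 \<le> g v"
    and gB: "\<And>v. v \<in> space N \<Longrightarrow> g v \<le> B"
    and \<rho>: "\<rho> = (1 - r)\<^sup>2 / (C * K\<^sup>2)"
    and le: "\<And>v w'. v \<in> space N \<Longrightarrow> w' \<in> space (Pn n) \<Longrightarrow>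
      g v \<le> exp (\<rho> * (F (path n w') + 1/2 * path_cost n (V v) w'))"
  shows "(\<integral>\<^sup>+v. ennreal (g v) \<partial>N) \<le>
    ennreal (exp (\<rho> * (\<integral>y. F y \<partial>distr (Pn n) (path_space n) (path n))))"
proof -
  interpret N: prob_space N by fact
  let ?\<mu> = "distr (Pn n) (path_space n) (path n)"
  let ?EF = "\<integral>y. F y \<partial>?\<mu>"
  let ?C = "C * K\<^sup>2 / (1 - r)\<^sup>2"
  have \<rho>_pos: "0 < \<rho>" unfolding \<rho> using C_pos K_pos r by simp
  have C\<rho>: "?C = 1 / \<rho>" unfolding \<rho> by simp
  have g_int: "integrable N g"
    by (rule N.integrable_const_bound[where B = B]) (use g0 gB in auto)
  define a where "a = (\<integral>v. g v \<partial>N)"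
  have a: "(\<integral>\<^sup>+v. ennreal (g v) \<partial>N) = ennreal a" "0 \<le> a"
    unfolding a_def using g_int g0 by (simp_all add: nn_integral_eq_integral integral_nonneg_AE)
  show ?thesis
  proof (cases "a = 0")
    case False
    then have "0 < a" using a by simp
    define q where "q v = g v / a" for v
    have q [measurable]: "q \<in> borel_measurable N" unfolding q_def[abs_def] by measurable
    have q0: "0 \<le> q v" for v using g0 \<open>0 < a\<close> by (simp add: q_def)
    have q1: "(\<integral>\<^sup>+v. ennreal (q v) \<partial>N) = 1"
    proof -
      have "(\<integral>\<^sup>+v. ennreal (q v) \<partial>N) = (\<integral>\<^sup>+v. ennreal (1 / a) * ennreal (g v) \<partial>N)"
        unfolding q_def using \<open>0 < a\<close> g0 by (intro nn_integral_cong) (simp flip: ennreal_mult)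
      also have "\<dots> = ennreal (1 / a) * ennreal a" by (simp add: nn_integral_cmult a)
      finally show ?thesis using \<open>0 < a\<close> by (simp flip: ennreal_mult)
    qed
    \<comment> \<open>The bound \<open>B\<close> on \<open>g\<close> enters here:
      \<open>psi t \<le> t^2 + 1\<close>, and \<open>q\<close> is at most
      \<open>B / a\<close>.\<close>
    have E: "Ent N q < \<infinity>"
    proof -
      have "Ent N q \<le> (\<integral>\<^sup>+v. ennreal ((B / a)\<^sup>2 + 1) \<partial>N)"
        unfolding Ent_def
      proof (intro nn_integral_mono ennreal_leI)
        fix v assume v: "v \<in> space N"
        have "psi (q v) \<le> (q v)\<^sup>2 + 1"
        proof (cases "q v = 0")
          case False
          then have "0 < q v" using q0[of v] by simp
          then have "q v * ln (q v) \<le> q v * q v"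
            using ln_le_minus_one[of "q v"] by (intro mult_left_mono) auto
          then show ?thesis using q0[of v] by (simp add: psi_def power2_eq_square)
        qed (simp add: psi_def)
        also have "(q v)\<^sup>2 \<le> (B / a)\<^sup>2"
          using q0[of v] gB[OF v] \<open>0 < a\<close> by (intro power_mono) (auto simp: q_def divide_right_mono)
        finally show "psi (q v) \<le> (B / a)\<^sup>2 + 1" by simp
      qed
      then show ?thesis by (simp add: N.emeasure_space_1 le_less_trans)
    qed
    have q_int: "integrable N q" "(\<integral>v. q v \<partial>N) = 1"
      using nn_integral_real_finite[of q N 1] q1 q0 by auto
    have qq: "integrable N (\<lambda>v. q v * ln (q v))" "Ent N q = ennreal (\<integral>v. q v * ln (q v) \<partial>N)"
      using integrable_psi_iff[OF N q q0 q1] E by auto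
    have qg: "q v * ln (g v) = q v * ln (q v) + ln a * q v" for v
    proof (cases "g v = 0")
      case False
      then show ?thesis using g0[of v] \<open>0 < a\<close> by (simp add: q_def ln_div algebra_simps)
    qed (simp add: q_def)
    have qg_int: "integrable N (\<lambda>v. q v * ln (g v))"
      unfolding qg using qq(1) q_int by auto
    \<comment> \<open>The tilted mean of \<open>ln g\<close>; thus \<open>X - ln a\<close> is the
      entropy of \<open>q\<close>.\<close>
    define X where "X = (\<integral>v. q v * ln (g v) \<partial>N)"
    have X: "X = (\<integral>v. q v * ln (q v) \<partial>N) + ln a"
      unfolding X_def qg using qq(1) q_int by simp
    have X_pos: "0 \<le> X - ln a"
    proof -
      have "(\<integral>v. q v - 1 \<partial>N) \<le> (\<integral>v. q v * ln (q v) \<partial>N)"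
        using qq(1) q_int psi_nonneg[OF q0] by (intro integral_mono) (auto simp: psi_def algebra_simps)
      then show ?thesis using q_int by (simp add: X N.prob_space)
    qed
    have "ln a \<le> \<rho> * ?EF"
    proof (rule field_le_epsilon)
      fix e :: real assume "0 < e"
      \<comment> \<open>The cost enters with the factor \<open>\<rho> / 2\<close>, so this slack
        becomes \<open>e\<close>.\<close>
      define \<epsilon> where "\<epsilon> = 2 * e / \<rho>"
      have "0 < \<epsilon>" using \<open>0 < e\<close> \<rho>_pos by (simp add: \<epsilon>_def)
      obtain \<Gamma> where \<Gamma>: "prob_space \<Gamma>" "sets \<Gamma> = sets (N \<Otimes>\<^sub>M Pn n)"
        "distr \<Gamma> N fst = density N q" "distr \<Gamma> (Pn n) snd = Pn n"
        "(\<integral>\<^sup>+y. ennreal (path_cost n (V (fst y)) (snd y)) \<partial>\<Gamma>) \<le> ennreal (2 * ?C) * Ent N q + ennreal \<epsilon>"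
        by (rule lifted_coupling[OF N V dV q q0 q1 E \<open>0 < \<epsilon>\<close>]) blast
      note \<Gamma>(2)[measurable_cong]
      have space_\<Gamma>: "space \<Gamma> = space N \<times> space (Pn n)"
        using sets_eq_imp_space_eq[OF \<Gamma>(2)] by (simp add: space_pair_measure)
      let ?pc = "\<lambda>y. path_cost n (V (fst y)) (snd y)"
      have l_dens: "integrable (density N q) (\<lambda>v. ln (g v))" "(\<integral>v. ln (g v) \<partial>density N q) = X"
        using qg_int q0 by (simp_all add: integrable_density integral_density X_def)
      have l: "integrable \<Gamma> (\<lambda>y. ln (g (fst y)))" "(\<integral>y. ln (g (fst y)) \<partial>\<Gamma>) = X"
        using l_dens unfolding \<Gamma>(3)[symmetric] by (simp_all add: integrable_distr_eq integral_distr)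
      have Fp [measurable]: "(\<lambda>w. F (path n w)) \<in> borel_measurable (Pn n)" by measurable
      have FP: "integrable (Pn n) (\<lambda>w. F (path n w))" "(\<integral>w. F (path n w) \<partial>Pn n) = ?EF"
        using F_int by (simp_all add: integrable_distr_eq integral_distr)
      have sm: "snd \<in> measurable \<Gamma> (Pn n)" by measurable
      have Fi: "integrable \<Gamma> (\<lambda>y. F (path n (snd y)))"
        using integrable_distr_eq[OF sm Fp] FP(1) by (simp only: \<Gamma>(4))
      have Fi2: "(\<integral>y. F (path n (snd y)) \<partial>\<Gamma>) = ?EF"
        using integral_distr[OF sm Fp] FP(2) by (simp only: \<Gamma>(4))
      have cost: "(\<integral>\<^sup>+y. ennreal (?pc y) \<partial>\<Gamma>) \<le> ennreal (2 * ?C * (X - ln a) + \<epsilon>)"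
      proof -
        have "ennreal (2 * ?C) * Ent N q + ennreal \<epsilon> = ennreal (2 * ?C * (X - ln a) + \<epsilon>)"
          using X_pos \<open>0 < \<epsilon>\<close> \<rho>_pos unfolding C\<rho> qq(2) by (subst ennreal_plus) (simp_all add: X ennreal_mult[symmetric])
        then show ?thesis using \<Gamma>(5) by simp
      qed
      have D: "integrable \<Gamma> (\<lambda>y. ?pc y)"
        by (rule integrableI_nonneg) (use cost in \<open>auto simp: path_cost_nonneg le_less_trans\<close>)
      have "ennreal (\<integral>y. ?pc y \<partial>\<Gamma>) \<le> ennreal (2 * ?C * (X - ln a) + \<epsilon>)"
        using cost D by (simp add: nn_integral_eq_integral path_cost_nonneg)
      then have D_le: "(\<integral>y. ?pc y \<partial>\<Gamma>) \<le> 2 * ?C * (X - ln a) + \<epsilon>"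
        using X_pos \<open>0 < \<epsilon>\<close> \<rho>_pos unfolding C\<rho> by (subst (asm) ennreal_le_iff) auto
      \<comment> \<open>The bound on \<open>g\<close> can be passed to \<open>ln g\<close> only
        where \<open>g\<close> is positive; the tilted law charges no other points.\<close>
      have "AE v in density N q. 0 < g v"
        using g0 \<open>0 < a\<close> by (subst AE_density) (auto simp: q_def zero_less_divide_iff)
      then have "AE v in distr \<Gamma> N fst. 0 < g v" by (simp only: \<Gamma>(3))
      then have pos: "AE y in \<Gamma>. 0 < g (fst y)" by (rule AE_distrD[rotated]) measurable
      have "X \<le> (\<integral>y. \<rho> * (F (path n (snd y)) + 1/2 * ?pc y) \<partial>\<Gamma>)"
        unfolding l(2)[symmetric]
      proof (rule integral_mono_AE)
        show "AE y in \<Gamma>. ln (g (fst y)) \<le> \<rho> * (F (path n (snd y)) + 1/2 * ?pc y)"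
          using pos AE_space[of \<Gamma>]
        proof eventually_elim
          case (elim y)
          then have "g (fst y) \<le> exp (\<rho> * (F (path n (snd y)) + 1/2 * ?pc y))"
            by (intro le) (auto simp: space_\<Gamma>)
          then show ?case using elim(1) by (simp add: ln_ge_iff[symmetric] ln_le_cancel_iff[symmetric] del: ln_le_cancel_iff)
        qed
      qed (use l Fi D in auto)
      also have "\<dots> = \<rho> * ?EF + \<rho> / 2 * (\<integral>y. ?pc y \<partial>\<Gamma>)"
        using Fi D by (simp add: distrib_left Fi2)
      also have "\<dots> \<le> \<rho> * ?EF + \<rho> / 2 * (2 * ?C * (X - ln a) + \<epsilon>)"
        using D_le \<rho>_pos by (intro add_left_mono mult_left_mono) auto
      \<comment> \<open>Since \<rho> is the reciprocal of the transport constant, the transport term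
        is exactly the entropy \<open>X - ln a\<close>; \<open>X\<close> cancels and only
        \<open>ln a\<close> remains.\<close>
      also have "\<rho> / 2 * (2 * ?C * (X - ln a) + \<epsilon>) = X - ln a + e"
        using \<rho>_pos unfolding C\<rho> \<epsilon>_def by (simp add: field_simps)
      finally show "ln a \<le> \<rho> * ?EF + e" by simp
    qed
    then have "a \<le> exp (\<rho> * ?EF)"
      using \<open>0 < a\<close> by (metis exp_le_cancel_iff exp_ln)
    then show ?thesis unfolding a(1) by (rule ennreal_leI)
  qed (simp add: a)
qed

end

section \<open>From the canonical noise to the given probability space\<close>

theorem corollary3p5:
  fixes M :: "'w measure"
    and f :: "real^'d \<Rightarrow> real^'d"
    and \<sigma> :: "real^'d \<Rightarrow> real^'m^'d"
    and W :: "nat \<Rightarrow> 'w \<Rightarrow> real^'m"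
    and C K r \<rho> :: real
    and n :: nat
    and x :: "real^'d"
  assumes M: "prob_space M"
    and f: "f \<in> borel_measurable borel"
    and \<sigma>: "\<sigma> \<in> borel_measurable borel"
    and W_indep: "prob_space.indep_vars M (\<lambda>_. borel) W {1..}"
    and W_ident: "\<And>k. k \<ge> 1 \<Longrightarrow> distr M borel (W k) = distr M borel (W 1)"
    and W_mean: "integrable M (W 1)" "(\<integral>\<omega>. W 1 \<omega> \<partial>M) = 0"
    and C: "C > 0" and K: "K > 0"
    and W_T2: "T2 C dist (distr M borel (W 1))"
    and \<sigma>_bound: "\<And>x w. norm (\<sigma> x *v w) \<le> K * norm w"
    and r: "0 \<le> r" "r < 1"
    and contraction: "\<And>x x'. integrable M (\<lambda>\<omega>. (norm ((\<sigma> x - \<sigma> x') *v W 1 \<omega>))\<^sup>2) \<and>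
      sqrt ((norm (f x - f x'))\<^sup>2 + (\<integral>\<omega>. (norm ((\<sigma> x - \<sigma> x') *v W 1 \<omega>))\<^sup>2 \<partial>M))
        \<le> r * norm (x - x')"
    and n: "n \<ge> 1"
    and \<rho>: "\<rho> = (1 - r)\<^sup>2 / (C * K\<^sup>2)"
  shows "T2 (C * K\<^sup>2 / (1 - r)\<^sup>2) (d_l2 n) (path_law M f \<sigma> W x n) \<and>
    (\<forall>F. F \<in> borel_measurable (path_space n) \<and> integrable (path_law M f \<sigma> W x n) F \<longrightarrow>
      nn_expectation M (\<lambda>\<omega>. ereal_exp (ereal \<rho> * Q_op n F (chain_path f \<sigma> W x n \<omega>)))
        \<le> ennreal (exp (\<rho> * (\<integral>\<omega>. F (chain_path f \<sigma> W x n \<omega>) \<partial>M))))"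
proof -
  interpret M: prob_space M by fact
  define w where "w = W 1"
  define P where "P = distr M borel w"
  note mean_w = W_mean[folded w_def] and T2_w = W_T2[folded w_def]
    and contraction_w = contraction[folded w_def]
  have W_meas: "W k \<in> borel_measurable M" if "k \<ge> 1" for k
    using W_indep that unfolding M.indep_vars_def by simp
  have [measurable]: "w \<in> borel_measurable M" unfolding w_def by (rule W_meas) simp
  have sets_P: "sets P = sets borel" by (simp add: P_def)
  interpret contractive_model P f \<sigma> x C K r
  proof (intro contractive_model.intro noise.intro noise_axioms.intro contractive_model_axioms.intro)
    show "prob_space P" unfolding P_def by (rule M.prob_space_distr) simp
    show "integrable P (\<lambda>z. z)" "(\<integral>z. z \<partial>P) = 0"
      using mean_w unfolding P_def by (simp_all add: integrable_distr_eq integral_distr)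
    show "integrable P (\<lambda>z. (norm ((\<sigma> y - \<sigma> y') *v z))\<^sup>2)" for y y'
      using contraction_w[of y y'] unfolding P_def by (simp add: integrable_distr_eq)
    show "(norm (f y - f y'))\<^sup>2 + (\<integral>z. (norm ((\<sigma> y - \<sigma> y') *v z))\<^sup>2 \<partial>P) \<le> r\<^sup>2 * (norm (y - y'))\<^sup>2" for y y'
    proof -
      have "(\<integral>z. (norm ((\<sigma> y - \<sigma> y') *v z))\<^sup>2 \<partial>P) = (\<integral>\<omega>. (norm ((\<sigma> y - \<sigma> y') *v w \<omega>))\<^sup>2 \<partial>M)"
        unfolding P_def by (rule integral_distr) measurable
      then show ?thesis
        using sqrt_le_D[OF conjunct2[OF contraction_w[of y y']]] by (simp add: power_mult_distrib)
    qed
    show "T2 C dist P" unfolding P_def by (rule T2_w)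
  qed (rule sets_P f \<sigma> C K \<sigma>_bound r)+
  define V where "V \<omega> = (\<lambda>i\<in>{1..n}. W i \<omega>)" for \<omega>
  have V [measurable]: "V \<in> measurable M (Pn n)"
    unfolding V_def[abs_def] measurable_cong_sets[OF refl sets_Pn]
    by (intro measurable_restrict W_meas) simp
  have dV: "distr M (Pn n) V = Pn n"
  proof -
    have "M.indep_vars (\<lambda>_. borel) W {1..n}"
      by (rule M.indep_vars_subset[OF W_indep]) auto
    \<comment> \<open>The description of independence by a product law asks for a nonempty index
      set, hence \<open>n\<close>.\<close>
    then have "distr M (PiM {1..n} (\<lambda>_. borel)) V = PiM {1..n} (\<lambda>i. distr M borel (W i))"
      unfolding V_def[abs_def] using n W_meas
      by (subst (asm) M.indep_vars_iff_distr_eq_PiM') auto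
    moreover have "PiM {1..n} (\<lambda>i. distr M borel (W i)) = Pn n"
      unfolding Pn_def
    proof (intro PiM_cong refl)
      fix i assume "i \<in> {1..n}"
      then show "distr M borel (W i) = P" unfolding P_def w_def by (intro W_ident) simp
    qed
    moreover have "distr M (Pn n) V = distr M (PiM {1..n} (\<lambda>_. borel)) V"
      by (rule distr_cong[OF refl sets_Pn refl])
    ultimately show ?thesis by (simp only:)
  qed
  have cp: "chain_path f \<sigma> W x n \<omega> = path n (V \<omega>)" for \<omega>
    unfolding chain_path_def path_def V_def
    by (intro ext restrict_ext chain_eq_coord_chain) simp
  let ?\<mu> = "distr (Pn n) (path_space n) (path n)"
  have law: "path_law M f \<sigma> W x n = ?\<mu>"
  proof -
    have "path_law M f \<sigma> W x n = distr M (path_space n) (\<lambda>\<omega>. path n (V \<omega>))"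
      unfolding path_law_def cp[abs_def] ..
    also have "\<dots> = distr (distr M (Pn n) V) (path_space n) (path n)"
      by (subst distr_distr) (simp_all add: comp_def)
    finally show ?thesis by (simp only: dV)
  qed
  have "nn_expectation M (\<lambda>\<omega>. ereal_exp (ereal \<rho> * Q_op n F (chain_path f \<sigma> W x n \<omega>)))
        \<le> ennreal (exp (\<rho> * (\<integral>\<omega>. F (chain_path f \<sigma> W x n \<omega>) \<partial>M)))"
    if F [measurable]: "F \<in> borel_measurable (path_space n)" and Fi: "integrable ?\<mu> F" for F
  proof -
    have \<rho>0: "0 \<le> \<rho>" unfolding \<rho> using C by simp
    have mean_F: "(\<integral>\<omega>. F (chain_path f \<sigma> W x n \<omega>) \<partial>M) = (\<integral>y. F y \<partial>?\<mu>)"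
    proof -
      have "(\<integral>y. F y \<partial>?\<mu>) = (\<integral>w. F (path n w) \<partial>distr M (Pn n) V)"
        unfolding dV by (rule integral_distr) measurable
      also have "\<dots> = (\<integral>\<omega>. F (path n (V \<omega>)) \<partial>M)" by (rule integral_distr) measurable
      finally show ?thesis by (simp add: cp)
    qed
    let ?q = "\<lambda>\<omega>. ereal_exp (ereal \<rho> * Q_op n F (chain_path f \<sigma> W x n \<omega>))"
    have upper: "?q \<omega> \<le>
      ennreal (exp (\<rho> * (F (path n w') + 1/2 * path_cost n (V \<omega>) w')))" for \<omega> w'
    proof -
      \<comment> \<open>The displacement from the given path to the untilted one is a competitor in
        the infimum, with squared length \<open>path_cost\<close>.\<close>
      define y where "y = (\<lambda>k\<in>{1..n}. path n w' k - path n (V \<omega>) k)"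
      have "y \<in> space (path_space n)" by (simp add: y_def path_space_def space_PiM)
      then have "Q_op n F (path n (V \<omega>)) \<le>
          ereal (F (\<lambda>k\<in>{1..n}. path n (V \<omega>) k + y k) + 1/2 * (\<Sum>k=1..n. (norm (y k))\<^sup>2))"
        unfolding Q_op_def by (rule INF_lower)
      also have "(\<lambda>k\<in>{1..n}. path n (V \<omega>) k + y k) = path n w'"
        by (auto simp: y_def path_def fun_eq_iff)
      also have "(\<Sum>k=1..n. (norm (y k))\<^sup>2) = path_cost n (V \<omega>) w'"
        unfolding path_cost_def dsq_def by (intro sum.cong) (auto simp: y_def path_def norm_minus_commute)
      finally have "ereal \<rho> * Q_op n F (path n (V \<omega>)) \<le>
          ereal \<rho> * ereal (F (path n w') + 1/2 * path_cost n (V \<omega>) w')"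
        using \<rho>0 by (intro ereal_mult_left_mono) auto
      from ereal_exp_mono[OF this] show ?thesis by (simp add: cp)
    qed
    \<comment> \<open>The integral is by definition a supremum over simple functions below the
      integrand, so it suffices to bound each of these, and the integrand itself may fail to be
      measurable. The integral for the completion has the same value.\<close>
    have "(\<integral>\<^sup>+\<omega>. ?q \<omega> \<partial>M)
        \<le> ennreal (exp (\<rho> * (\<integral>y. F y \<partial>?\<mu>)))"
      unfolding nn_integral_def
    proof (intro SUP_least, safe)
      fix s assume s: "simple_function M s" "s \<le> ?q"
      define g where "g \<omega> = enn2real (s \<omega>)" for \<omega>
      have s_le: "s \<omega> \<le> ennreal (exp (\<rho> * (F (path n w') + 1/2 * path_cost n (V \<omega>) w')))" for \<omega> w'
        using order_trans[OF le_funD[OF s(2)] upper] .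
      \<comment> \<open>The competitor bound \<open>upper\<close> is finite, so the simple function
        is real-valued, and with finitely many values it is bounded, as \<open>exp_bound\<close>
        requires.\<close>
      have s_g: "s \<omega> = ennreal (g \<omega>)" for \<omega>
        using le_less_trans[OF s_le ennreal_less_top, of \<omega>] by (simp add: g_def)
      have "finite (g ` space M)"
        using simple_functionD(1)[OF s(1)] unfolding g_def image_image[symmetric, of enn2real s] by (rule finite_imageI)
      have "(\<integral>\<^sup>+\<omega>. ennreal (g \<omega>) \<partial>M) \<le> ennreal (exp (\<rho> * (\<integral>y. F y \<partial>?\<mu>)))"
      proof (rule exp_bound[OF M V dV F Fi _ _ _ \<rho>])
        show "g \<in> borel_measurable M"
          unfolding g_def[abs_def] using borel_measurable_simple_function[OF s(1)] by measurable
        show "g \<omega> \<le> Max (g ` space M)" if "\<omega> \<in> space M" for \<omega>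
          using \<open>finite (g ` space M)\<close> that by (intro Max_ge) auto
        show "g \<omega> \<le> exp (\<rho> * (F (path n w') + 1/2 * path_cost n (V \<omega>) w'))" for \<omega> w'
          using s_le[of \<omega> w'] unfolding s_g by simp
      qed (simp add: g_def)
      then show "integral\<^sup>S M s \<le> ennreal (exp (\<rho> * (\<integral>y. F y \<partial>?\<mu>)))"
        unfolding s_g[symmetric] by (simp add: nn_integral_eq_simple_integral[OF s(1)])
    qed
    then show ?thesis
      unfolding nn_expectation_def nn_integral_completion mean_F .
  qed
  then show ?thesis
    unfolding law using T2_path_law[of n] by blast
qed

end
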